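(* Let $d\ge1$, $\ell\ge2$ be integers, $r\ge2$, $A\in GL_d(\mathbb R)$ with $\rho(A)<1$, $\phi\in C^r(\mathbb S^1,\mathbb R^d)$, and let $\mathbf s=(s_1,\dots,s_t)\in\mathbb R^t$ with $s_i>-d_i/2$ for all $i$. Assume that there exists $q\ge N$ such that $$B_{\mathbf s}\,q^k\,M(q)<\Big(\ell\,|\det(A)|\prod_{i=1}^t|\lambda_i|^{2s_i}\Big)^q,$$ where $k=2(d-1)\sum_{i=1}^t|s_i|$ and $B_{\mathbf s}=B_{\mathbf s}(A)=36\prod_{i=1}^t C_i^{2|s_i|}>0$ is a constant depending only on $A$ and $\mathbf s$ and independent of $q$. Then $\mu_\phi\in L^2(\mathbb S^1,\dot H^{\mathbf s}_A)$, where $\mu_\phi$ is the SRB measure of $T(x,y)=(\ell x,\,Ay+\phi(x))$.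
   Context: Setting. $\mathbb S^1=\mathbb R/\mathbb Z$; $\tau(x)=\ell x\pmod1$; $T:\mathbb S^1\times\mathbb R^d\to\mathbb S^1\times\mathbb R^d$, $T(x,y)=(\tau(x),Ay+\phi(x))$. $\|\cdot\|$, $|\cdot|$ denote Euclidean norms (or associated operator norms); $A^T$ is the transpose. Words. $\mathcal A=\{1,\dots,\ell\}$; $\mathcal A^n$ is the set of words of length $n$, $\mathcal A^\infty=\mathcal A^{\mathbb N}$. $\mathcal P(k)=[(k-1)/\ell,k/\ell)$ for $1\le k\le\ell$, $\mathcal P(\mathbf a)=\bigcap_{j=0}^{n-1}\tau^{-j}(\mathcal P(a_{n-j}))$ for $\mathbf a=(a_1,\dots,a_n)$; $[\mathbf a]_j$ is the prefix of length $j$; $\tau_{\mathbf a}^{-j}(x)$ is the unique point of $\mathcal P([\mathbf a]_j)$ mapped to $x$ by $\tau^j$. For $\mathbf a$ of length $n$, $1\le n\le\infty$, $S(x,\mathbf a)=\sum_{j=1}^nA^{j-1}\phi(\tau_{\mathbf a}^{-j}(x))$. SRB measure. $T$ has a unique SRB measure $\mu_\phi=\Psi_*(m\times\nu)$, with $\Psi(x,\mathbf a)=(x,S(x,\mathbf a))$ on $\mathbb S^1\times\mathcal A^\infty$, $m$ Lebesgue on $\mathbb S^1$, $\nu$ the Bernoulli measure with equal weights $1/\ell$. Constants. Fix $\kappa>0$ with $\phi\in\mathcal U_\kappa=\{\phi\in C^r:\max_{0\le k\le r}\sup_x\|\phi^{(k)}(x)\|\le\kappa\}$; $\alpha=\kappa\sum_{i\ge0}\|A^i\|$;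 $D=\mathbb S^1\times\{y:\|y\|\le\alpha\}$; $C^*=\{(\xi,\eta)\in\mathbb R\times\mathbb R^d:\|\eta\|\le\alpha^{-1}|\xi|\}$. $N\ge1$ is a fixed integer such that $T^N(D)\subseteq D$ and $(DT^N_z)^*(C^* )\subset C^*$ for all $z\in\mathbb S^1\times\mathbb R^d$. Concentration multiplicity. For $\mathbf c\in\mathcal A^p$, $\mathcal P_*(\mathbf c)$ is the union of $\mathcal P(\mathbf c)$ and the two adjacent intervals of the same generation; $S_{\mathbf c}(\cdot,\mathbf a):\mathcal P_*(\mathbf c)\to\mathbb R^d$ is the natural $C^r$ extension of $S(\cdot,\mathbf a)|_{\mathcal P(\mathbf c)}$, obtained by continuing each inverse branch $\tau_{\mathbf a}^{-j}$ continuously (affinely) from $\mathcal P(\mathbf c)$ to $\mathcal P_*(\mathbf c)$; $S'_{\mathbf c}$ is its $x$-derivative. For $(\xi,\eta)\in\mathbb Z\times\mathbb R^d$, $B^q_{\mathbf c}(\xi,\eta)=\{\mathbf a\in\mathcal A^q:\exists x\in\mathcal P_*(\mathbf c),\ |\xi+\eta\cdot S'_{\mathbf c}(x,\mathbf a)|<2\alpha\ell^{-q}\|(A^q)^T\eta\|\}$; $M(p,q)=\max_{\mathbf c\in\mathcal A^p}\sup_{(\xi,\eta)}\#B^q_{\mathbf c}(\xi,\eta)$; $M(q)=\lim_{p\to\infty}M(p,q)=\inf_{p\ge 1}M(p,q)$. Spectral data. $1>|\lambda_1|>\dots>|\lambda_t|>0$ are the distinct moduli of the eigenvalues of $A$.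 $\mathbb R^d=E_1\oplus\dots\oplus E_t$ is the real $A^T$-invariant spectral decomposition, $E_i$ being the real generalized spectral subspace of $A^T$ for the eigenvalues of modulus $|\lambda_i|$; $d_i=\dim E_i$, $B_i=A^T|_{E_i}$, $\pi_i:\mathbb R^d\to E_i$ the associated projections, $\eta_i=\pi_i(\eta)$. Let $m_i$ be the maximal size of a Jordan block of (the complexification of) $B_i$. $C_i\ge1$ are fixed constants, depending only on $A$, such that $\|B_i^q\|\le C_iq^{m_i-1}|\lambda_i|^q$ and $\|B_i^{-q}\|\le C_iq^{m_i-1}|\lambda_i|^{-q}$ for all $q\ge1$. Function space. For $u\in C_c^\infty(\mathbb S^1\times\mathbb R^d)$, $\|u\|^2=\int_{\mathbb S^1}\int_{\mathbb R^d}|\mathcal F_yu(x,\eta)|^2\prod_{i=1}^t|\eta_i|^{2s_i}\,d\eta\,dx=\sum_{\xi\in\mathbb Z}\int_{\mathbb R^d}|\widehat u(\xi,\eta)|^2\prod_{i=1}^t|\eta_i|^{2s_i}\,d\eta$, where $\mathcal F_y$ is the Fourier transform in $y$ and $\widehat u$ the full Fourier transform. $L^2(\mathbb S^1,\dot H^{\mathbf s}_A)$ is the completion of $C_c^\infty(\mathbb S^1\times\mathbb R^d)$ in this norm; for a finite compactly supported Borel measure $\mu$ on $\mathbb S^1\times\mathbb R^d$ with Fourier transform $\widehat\mu$, membership $\mu\in L^2(\mathbb S^1,\dot H^{\mathbf s}_A)$ means $\sum_{\xi\in\mathbb Z}\int_{\mathbb R^d}|\widehat\mu(\xi,\eta)|^2\prod_{i=1}^t|\eta_i|^{2s_i}\,d\eta<\infty$.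 *)

theory Defs
  imports
    "HOL-Probability.Probability"
    "Jordan_Normal_Form.Jordan_Normal_Form"
begin

hide_const (open) Matrix.mat Matrix.vec Matrix.row Matrix.col Determinant.det Char_Poly.eigenvalue
no_notation vec_index (infixl "$" 100)
no_notation scalar_prod (infix "\<bullet>" 70)

text \<open>
  A point of the circle \<open>\<real>/\<int>\<close> is represented by its representative in \<open>[0,1)\<close>, and a function
  on the circle is a function of period 1 on the real line.
\<close>

definition circle :: "real set" where
  "circle = {0..<1}"

definition periodic :: "(real \<Rightarrow> 'a) \<Rightarrow> bool" where
  "periodic f \<longleftrightarrow> (\<forall>x. f (x + 1) = f x)"

definition iter_deriv :: "nat \<Rightarrow> (real \<Rightarrow> 'a::real_normed_vector) \<Rightarrow> real \<Rightarrow> 'a" where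
  "iter_deriv k f = ((\<lambda>g x. vector_derivative g (at x)) ^^ k) f"

definition C_class :: "nat \<Rightarrow> (real \<Rightarrow> 'a::real_normed_vector) \<Rightarrow> bool" where
  "C_class r f \<longleftrightarrow>
     (\<forall>k<r. \<forall>x. iter_deriv k f differentiable (at x)) \<and> continuous_on UNIV (iter_deriv r f)"

definition Cr_circle :: "nat \<Rightarrow> (real \<Rightarrow> real^'n) set" where
  "Cr_circle r = {f. periodic f \<and> C_class r f}"

definition U_ball :: "nat \<Rightarrow> real \<Rightarrow> (real \<Rightarrow> real^'n) set" where
  "U_ball r \<kappa> = {f \<in> Cr_circle r. \<forall>k\<le>r. \<forall>x. norm (iter_deriv k f x) \<le> \<kappa>}"

text \<open>
  The operators \<open>^\<close> and \<open>*\<close> on the vector type act componentwise, hence a separate power of matrices.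
\<close>

primrec matpow :: "'a::semiring_1^'n^'n \<Rightarrow> nat \<Rightarrow> 'a^'n^'n" where
  "matpow M 0 = mat 1"
| "matpow M (Suc k) = M ** matpow M k"

definition opnorm_on :: "'a::real_normed_vector set \<Rightarrow> ('a \<Rightarrow> 'b::real_normed_vector) \<Rightarrow> real" where
  "opnorm_on E f = (SUP v\<in>E. norm (f v) / norm v)"

definition cmat :: "real^'n^'m \<Rightarrow> complex^'n^'m" where
  "cmat M = map_matrix complex_of_real M"

definition cvec :: "real^'n \<Rightarrow> complex^'n" where
  "cvec v = (\<chi> i. complex_of_real (v $ i))"

definition eigenvalues :: "real^'n^'n \<Rightarrow> complex set" where
  "eigenvalues M = {z. \<exists>w. w \<noteq> 0 \<and> cmat M *v w = z *s w}"

definition spec_radius :: "real^'n^'n \<Rightarrow> real" where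
  "spec_radius M = Max (cmod ` eigenvalues M)"

text \<open>The indices \<open>i\<close> below run through \<open>1, \<dots>, num_moduli A\<close>, and the moduli decrease with \<open>i\<close>.\<close>

definition num_moduli :: "real^'n^'n \<Rightarrow> nat" where
  "num_moduli A = card (cmod ` eigenvalues A)"

definition modulus :: "real^'n^'n \<Rightarrow> nat \<Rightarrow> real" where
  "modulus A i = rev (sorted_list_of_set (cmod ` eigenvalues A)) ! (i - 1)"

definition gen_eigenspace :: "real^'n^'n \<Rightarrow> complex \<Rightarrow> (complex^'n) set" where
  "gen_eigenspace M z = {w. ((\<lambda>u. cmat M *v u - z *s u) ^^ CARD('n)) w = 0}"

text \<open>\<open>spec_space A i\<close> belongs to the transpose of \<open>A\<close>, which has the same eigenvalues as \<open>A\<close>.\<close>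

definition spec_space :: "real^'n^'n \<Rightarrow> nat \<Rightarrow> (real^'n) set" where
  "spec_space A i = {v. cvec v \<in> vec.span
     (\<Union>z\<in>{z \<in> eigenvalues (transpose A). cmod z = modulus A i}. gen_eigenspace (transpose A) z)}"

definition spec_proj :: "real^'n^'n \<Rightarrow> nat \<Rightarrow> real^'n \<Rightarrow> real^'n" where
  "spec_proj A i \<eta> = (THE u.
     (\<forall>j\<in>{1..num_moduli A}. u j \<in> spec_space A j) \<and>
     (\<forall>j. j \<notin> {1..num_moduli A} \<longrightarrow> u j = 0) \<and>
     \<eta> = (\<Sum>j=1..num_moduli A. u j)) i"

text \<open>
  The complexification of the restriction of \<open>f\<close> to the invariant subspace \<open>E\<close> is given by the matrix
  \<open>M\<close> of \<open>f\<close> in a basis \<open>vs\<close> of \<open>E\<close>, read as a complex matrix.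
\<close>

definition max_jordan_block :: "(real^'n \<Rightarrow> real^'n) \<Rightarrow> (real^'n) set \<Rightarrow> nat" where
  "max_jordan_block f E = Max {m. \<exists>vs M n_as z.
     distinct vs \<and> independent (set vs) \<and> span (set vs) = E \<and>
     M \<in> carrier_mat (length vs) (length vs) \<and>
     (\<forall>j<length vs. f (vs ! j) = (\<Sum>i<length vs. (M $$ (i, j)) *\<^sub>R (vs ! i))) \<and>
     jordan_nf (map_mat complex_of_real M) n_as \<and> (m, z) \<in> set n_as}"

definition jordan_size :: "real^'n^'n \<Rightarrow> nat \<Rightarrow> nat" where
  "jordan_size A i = max_jordan_block (\<lambda>v. transpose A *v v) (spec_space A i)"

definition block_bounds :: "real^'n^'n \<Rightarrow> (nat \<Rightarrow> real) \<Rightarrow> bool" where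
  "block_bounds A C \<longleftrightarrow> (\<forall>i\<in>{1..num_moduli A}. C i \<ge> 1 \<and> (\<forall>q\<ge>1.
     opnorm_on (spec_space A i) (\<lambda>v. matpow (transpose A) q *v v)
       \<le> C i * real q ^ (jordan_size A i - 1) * modulus A i ^ q \<and>
     opnorm_on (spec_space A i) (\<lambda>v. matpow (matrix_inv (transpose A)) q *v v)
       \<le> C i * real q ^ (jordan_size A i - 1) / modulus A i ^ q))"

definition \<tau> :: "nat \<Rightarrow> real \<Rightarrow> real" where
  "\<tau> l x = frac (real l * x)"

definition skew :: "nat \<Rightarrow> real^'n^'n \<Rightarrow> (real \<Rightarrow> real^'n) \<Rightarrow> real \<times> (real^'n) \<Rightarrow> real \<times> (real^'n)" where
  "skew l A \<phi> = (\<lambda>(x, y). (\<tau> l x, A *v y + \<phi> x))"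

text \<open>
  The representation of \<open>skew\<close> on \<open>[0,1)\<close> jumps; its derivative as a map of the cylinder is that of
  the lift to the universal cover.
\<close>

definition skew_lift :: "nat \<Rightarrow> real^'n^'n \<Rightarrow> (real \<Rightarrow> real^'n) \<Rightarrow> real \<times> (real^'n) \<Rightarrow> real \<times> (real^'n)" where
  "skew_lift l A \<phi> = (\<lambda>(x, y). (real l * x, A *v y + \<phi> x))"

definition \<alpha> :: "real^'n^'n \<Rightarrow> real \<Rightarrow> real" where
  "\<alpha> A \<kappa> = \<kappa> * (\<Sum>i. onorm (\<lambda>v. matpow A i *v v))"

definition trap :: "real^'n^'n \<Rightarrow> real \<Rightarrow> (real \<times> (real^'n)) set" where
  "trap A \<kappa> = circle \<times> {y. norm y \<le> \<alpha> A \<kappa>}"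

definition dual_cone :: "real^'n^'n \<Rightarrow> real \<Rightarrow> (real \<times> (real^'n)) set" where
  "dual_cone A \<kappa> = {(\<xi>, \<eta>). norm \<eta> \<le> inverse (\<alpha> A \<kappa>) * \<bar>\<xi>\<bar>}"

definition admissible_N :: "nat \<Rightarrow> real^'n^'n \<Rightarrow> (real \<Rightarrow> real^'n) \<Rightarrow> real \<Rightarrow> nat \<Rightarrow> bool" where
  "admissible_N l A \<phi> \<kappa> N \<longleftrightarrow> N \<ge> 1 \<and>
     (skew l A \<phi> ^^ N) ` trap A \<kappa> \<subseteq> trap A \<kappa> \<and>
     (\<forall>z. adjoint (frechet_derivative (skew_lift l A \<phi> ^^ N) (at z)) ` dual_cone A \<kappa> \<subseteq> dual_cone A \<kappa>)"

definition words :: "nat \<Rightarrow> nat \<Rightarrow> nat list set" where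
  "words l n = {w. length w = n \<and> set w \<subseteq> {1..l}}"

definition part :: "nat \<Rightarrow> nat \<Rightarrow> real set" where
  "part l k = {(real k - 1) / real l ..< real k / real l}"

text \<open>Lists count from 0: the letter \<open>a_i\<close> of \<open>(a_1,\<dots>,a_n)\<close> is \<open>w ! (i - 1)\<close>.\<close>

definition cyl :: "nat \<Rightarrow> nat list \<Rightarrow> real set" where
  "cyl l w = {x \<in> circle. \<forall>j<length w. (\<tau> l ^^ j) x \<in> part l (w ! (length w - j - 1))}"

definition inv_branch :: "nat \<Rightarrow> nat list \<Rightarrow> real \<Rightarrow> real" where
  "inv_branch l w x = (THE y. y \<in> cyl l w \<and> (\<tau> l ^^ length w) y = x)"

text \<open>For an infinite word \<open>a\<close>, the letter \<open>a_i\<close> is \<open>a (i - 1)\<close>, so \<open>map a [0..<j]\<close> is its prefix of length \<open>j\<close>.\<close>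

definition S_inf :: "nat \<Rightarrow> real^'n^'n \<Rightarrow> (real \<Rightarrow> real^'n) \<Rightarrow> real \<Rightarrow> (nat \<Rightarrow> nat) \<Rightarrow> real^'n" where
  "S_inf l A \<phi> x a = (\<Sum>j. matpow A j *v \<phi> (inv_branch l (map a [0..<Suc j]) x))"

definition bernoulli :: "nat \<Rightarrow> (nat \<Rightarrow> nat) measure" where
  "bernoulli l = (\<Pi>\<^sub>M j\<in>(UNIV::nat set). uniform_count_measure {1..l})"

definition srb :: "nat \<Rightarrow> real^'n^'n \<Rightarrow> (real \<Rightarrow> real^'n) \<Rightarrow> (real \<times> (real^'n)) measure" where
  "srb l A \<phi> = distr (restrict_space lborel circle \<Otimes>\<^sub>M bernoulli l) borel
     (\<lambda>(x, a). (x, S_inf l A \<phi> x a))"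

text \<open>
  \<open>cyl l c\<close> has length \<open>l^-p\<close> with \<open>p = length c\<close>, so its two neighbours of the same generation are
  its translates by \<open>\<plusminus>l^-p\<close>.  Their union with it is taken on the real line, next to \<open>cyl l c\<close>, and
  may leave \<open>[0,1)\<close>; this is where the affine continuations of the inverse branches live.
\<close>

definition cyl_star :: "nat \<Rightarrow> nat list \<Rightarrow> real set" where
  "cyl_star l c = (\<Union>k\<in>{-1, 0, 1}. (\<lambda>x. x + k / real l ^ length c) ` cyl l c)"

definition ext_branch :: "nat \<Rightarrow> nat list \<Rightarrow> nat list \<Rightarrow> real \<Rightarrow> real" where
  "ext_branch l c w = (THE g. (\<exists>m b. g = (\<lambda>x. m * x + b)) \<and> (\<forall>x\<in>cyl l c. g x = inv_branch l w x))"

definition S_ext :: "nat \<Rightarrow> real^'n^'n \<Rightarrow> (real \<Rightarrow> real^'n) \<Rightarrow> nat list \<Rightarrow> nat list \<Rightarrow> real \<Rightarrow> real^'n" where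
  "S_ext l A \<phi> c a x = (\<Sum>j=1..length a. matpow A (j - 1) *v \<phi> (ext_branch l c (take j a) x))"

definition S_ext_deriv :: "nat \<Rightarrow> real^'n^'n \<Rightarrow> (real \<Rightarrow> real^'n) \<Rightarrow> nat list \<Rightarrow> nat list \<Rightarrow> real \<Rightarrow> real^'n" where
  "S_ext_deriv l A \<phi> c a x = vector_derivative (S_ext l A \<phi> c a) (at x)"

definition conc :: "nat \<Rightarrow> real^'n^'n \<Rightarrow> (real \<Rightarrow> real^'n) \<Rightarrow> real \<Rightarrow> nat \<Rightarrow> nat list \<Rightarrow> int \<Rightarrow> real^'n \<Rightarrow> nat list set" where
  "conc l A \<phi> \<kappa> q c \<xi> \<eta> = {a \<in> words l q. \<exists>x\<in>cyl_star l c.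
     \<bar>real_of_int \<xi> + inner \<eta> (S_ext_deriv l A \<phi> c a x)\<bar>
       < 2 * \<alpha> A \<kappa> / real l ^ q * norm (transpose (matpow A q) *v \<eta>)}"

definition mult_pq :: "nat \<Rightarrow> real^'n^'n \<Rightarrow> (real \<Rightarrow> real^'n) \<Rightarrow> real \<Rightarrow> nat \<Rightarrow> nat \<Rightarrow> nat" where
  "mult_pq l A \<phi> \<kappa> p q =
     Max ((\<lambda>c. SUP (\<xi>, \<eta>)\<in>UNIV. card (conc l A \<phi> \<kappa> q c \<xi> \<eta>)) ` words l p)"

text \<open>\<open>mult_pq\<close> is decreasing in \<open>p\<close>, as \<open>cyl_star\<close> shrinks; the infimum is the limit for \<open>p \<rightarrow> \<infinity>\<close>.\<close>

definition conc_mult :: "nat \<Rightarrow> real^'n^'n \<Rightarrow> (real \<Rightarrow> real^'n) \<Rightarrow> real \<Rightarrow> nat \<Rightarrow> nat" where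
  "conc_mult l A \<phi> \<kappa> q = (INF p\<in>{1..}. mult_pq l A \<phi> \<kappa> p q)"

definition fourier :: "(real \<times> (real^'n)) measure \<Rightarrow> int \<Rightarrow> real^'n \<Rightarrow> complex" where
  "fourier \<mu> \<xi> \<eta> = (\<integral>z. cis (- 2 * pi * (real_of_int \<xi> * fst z + inner \<eta> (snd z))) \<partial>\<mu>)"

text \<open>\<open>0 powr a = 0\<close> for every \<open>a\<close>; this only affects a null set of \<open>\<eta>\<close>.\<close>

definition weight :: "real^'n^'n \<Rightarrow> (nat \<Rightarrow> real) \<Rightarrow> real^'n \<Rightarrow> real" where
  "weight A s \<eta> = (\<Prod>i=1..num_moduli A. norm (spec_proj A i \<eta>) powr (2 * s i))"

definition in_L2_Hdot :: "real^'n^'n \<Rightarrow> (nat \<Rightarrow> real) \<Rightarrow> (real \<times> (real^'n)) measure \<Rightarrow> bool" where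
  "in_L2_Hdot A s \<mu> \<longleftrightarrow>
     (\<integral>\<^sup>+\<xi>. (\<integral>\<^sup>+\<eta>. ennreal ((cmod (fourier \<mu> \<xi> \<eta>))\<^sup>2 * weight A s \<eta>) \<partial>lborel)
        \<partial>count_space UNIV) < \<infinity>"

definition B_const :: "real^'n^'n \<Rightarrow> (nat \<Rightarrow> real) \<Rightarrow> (nat \<Rightarrow> real) \<Rightarrow> real" where
  "B_const A C s = 36 * (\<Prod>i=1..num_moduli A. C i powr (2 * \<bar>s i\<bar>))"

end

theory Submission
  imports Defs "HOL-Computational_Algebra.Field_as_Ring" "HOL-Computational_Algebra.Fundamental_Theorem_Algebra"
    "Jordan_Normal_Form.Jordan_Normal_Form_Existence"
begin

hide_const (open) VectorSpace.subspace Matrix.mat Matrix.vec Matrix.row Matrix.col Determinant.det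
  Char_Poly.eigenvalue
no_notation vec_index (infixl "$" 100)
no_notation scalar_prod (infix "\<bullet>" 70)

text \<open>
  Over a point \<open>x\<close> of the circle the SRB measure is the distribution of \<open>S_inf l A \<phi> x a\<close> for a random
  word \<open>a\<close>.  Cutting the words off after \<open>n\<close> letters leaves the uniform distribution on the \<open>l^n\<close> points
  \<open>S w x\<close>, whose Fourier transform in the fibre is a finite exponential sum \<open>F n \<eta> x\<close>.  By Bessel's
  inequality in \<open>x\<close> and Fatou's lemma in \<open>n\<close> it is enough to bound the weighted energies
  \<open>\<integral> G n \<eta> * weight A s \<eta>\<close> with \<open>G n \<eta> = \<integral> |F n \<eta> x|^2 dx\<close>, uniformly in \<open>n\<close> and with a cutoff in \<open>\<eta>\<close> that
  disappears as \<open>n\<close> grows.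

  Self-similarity expresses \<open>F (q + n) \<eta>\<close> through the \<open>F n\<close> at the frequency \<open>freq A q \<eta>\<close>, one term for each
  word of length \<open>q\<close>.  Expanding the square produces pairs of words.  A pair is near, over \<open>x\<close>, if the
  phases of its two terms have almost the same derivative; the number of near partners of a word is
  at most \<open>conc_mult\<close>, because the derivative of one phase is within \<open>1/2\<close> of an integer \<open>- \<xi>\<close>.  The product
  of a pair that is not near oscillates, also after \<open>m\<close> further letters, and one partial integration
  over short windows makes its contribution small for large \<open>m\<close> and large \<open>\<eta>\<close>.  This is
  \<open>basic_inequality\<close>: up to a small multiple of \<open>G\<close> and of the energy \<open>H\<close> of the derivative,
  \<open>G (q + m + n) \<eta>\<close> is at most \<open>27/8 * conc_mult / l^q\<close> times \<open>G (m + n) (freq A q \<eta>)\<close>.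

  Integrating this inequality against the weight and substituting \<open>freq A q \<eta>\<close> for \<open>\<eta>\<close> costs the
  factor \<open>1 / |det A|^q\<close>, and the comparison of the weights at \<open>\<eta>\<close> and \<open>freq A q \<eta>\<close>
  (\<open>weight_le_weight_freq\<close>) the further factor \<open>\<Prod> C_i^(2 |s_i|) * q^k / \<Prod> |\<lambda>_i|^(2 s_i q)\<close>.  The hypothesis on \<open>q\<close>
  says that the product of all these factors is small, so that the recursion contracts
  (\<open>energy_bounded\<close>).  The small frequencies, where the inequality is not available, contribute a constant, since
  the weight is locally integrable (\<open>weight_locally_integrable\<close>); this is where \<open>s_i > - d_i / 2\<close> enters.
  The energies of \<open>F\<close> and of its derivative are coupled; the derivative contracts on its own, because
  the inverse branches do.

  The spectral decomposition behind the weight is the primary decomposition of the transpose of \<open>A\<close>,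
  derived from Bezout's identity for polynomials.
\<close>

section \<open>Generalized eigenspaces\<close>

definition poly_act :: "complex^'n^'n \<Rightarrow> complex poly \<Rightarrow> complex^'n \<Rightarrow> complex^'n" where
  "poly_act M p u = fold_coeffs (\<lambda>a w. a *s u + M *v w) p 0"

lemma poly_act_0 [simp]: "poly_act M 0 u = 0"
  by (simp add: poly_act_def)

lemma poly_act_pCons [simp]: "poly_act M (pCons a p) u = a *s u + M *v poly_act M p u"
  by (cases "a = 0 \<and> p = 0") (auto simp: poly_act_def)

lemma poly_act_1 [simp]: "poly_act M 1 u = u"
  by (simp add: one_pCons)

lemma poly_act_add: "poly_act M (p + q) u = poly_act M p u + poly_act M q u"
proof (induction p arbitrary: q)
  case (pCons a p)
  obtain b r where q: "q = pCons b r" by (cases q)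
  have "poly_act M (pCons a p + q) u = (a + b) *s u + M *v (poly_act M p u + poly_act M r u)"
    unfolding q add_pCons poly_act_pCons pCons.IH ..
  then show ?case by (simp add: q vec.scale_left_distrib matrix_vector_right_distrib)
qed simp

lemma poly_act_smult: "poly_act M (Polynomial.smult a p) u = a *s poly_act M p u"
  by (induction p) (auto simp: vec.scale_right_distrib matrix_vector_mult_scaleR vector_scalar_commute)

lemma poly_act_zero_right [simp]: "poly_act M p 0 = 0"
  by (induction p) auto

lemma poly_act_add_right: "poly_act M p (u + v) = poly_act M p u + poly_act M p v"
  by (induction p) (auto simp: vec.scale_right_distrib matrix_vector_right_distrib algebra_simps)

lemma poly_act_smult_right: "poly_act M p (c *s u) = c *s poly_act M p u"
  by (induction p) (auto simp: vec.scale_right_distrib vector_scalar_commute vector_smult_assoc mult.commute)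

lemma poly_act_sum_right: "poly_act M p (sum f I) = (\<Sum>i\<in>I. poly_act M p (f i))"
  by (induction I rule: infinite_finite_induct) (auto simp: poly_act_add_right)

lemma poly_act_commute: "poly_act M p (M *v u) = M *v poly_act M p u"
  by (induction p) (auto simp: matrix_vector_right_distrib vector_scalar_commute)

lemma poly_act_mult: "poly_act M (p * q) u = poly_act M p (poly_act M q u)"
  by (induction p) (auto simp: poly_act_add poly_act_smult)

lemma poly_act_linear_power:
  "poly_act M ([:-z, 1:] ^ k) u = ((\<lambda>u. M *v u - z *s u) ^^ k) u"
  by (induction k) (auto simp: poly_act_mult simp del: mult_pCons_left)

lemma poly_act_eigenvector:
  assumes "M *v w = z *s w"
  shows "poly_act M p w = poly p z *s w"
  by (induction p)
    (auto simp: assms vector_scalar_commute vector_smult_assoc vec.scale_left_distrib mult.commute)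

text \<open>
  The \<open>n + 1\<close> vectors \<open>u, M u, \<dots>, M\<^sup>n u\<close> are linearly dependent.  The bound on the degree bounds the
  multiplicities of the roots, and therefore fits the exponent \<open>n\<close> in \<open>gen_eigenspace\<close>.
\<close>

lemma annihilating_poly_vector:
  fixes M :: "complex^'n^'n"
  obtains p where "p \<noteq> 0" "degree p \<le> CARD('n)" "poly_act M p u = 0"
proof -
  define f where "f = (\<lambda>i. ((*v) M ^^ i) u)"
  have f: "poly_act M (monom c i) u = c *s f i" for c i
    by (induction i) (auto simp: f_def monom_0 monom_Suc vector_scalar_commute)
  have fs: "poly_act M (\<Sum>i\<in>I. monom (c i) i) u = (\<Sum>i\<in>I. c i *s f i)" if "finite I" for I and c :: "nat \<Rightarrow> complex"
    using that by (induction I) (auto simp: poly_act_add f)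
  have "\<exists>c. (\<exists>i\<in>{..CARD('n)}. c i \<noteq> 0) \<and> (\<Sum>i\<in>{..CARD('n)}. c i *s f i) = 0"
  proof (cases "inj_on f {..CARD('n)}")
    case False
    then obtain i j where ij: "i \<le> CARD('n)" "j \<le> CARD('n)" "i \<noteq> j" "f i = f j"
      by (auto simp: inj_on_def)
    have "(\<Sum>k\<in>{..CARD('n)}. (if k = i then 1 else if k = j then -1 else 0) *s f k)
        = (\<Sum>k\<in>{i,j}. (if k = i then 1 else if k = j then -1 else 0) *s f k)"
      using ij by (intro sum.mono_neutral_right) auto
    also have "\<dots> = 0" using ij by auto
    finally show ?thesis using ij
      by (intro exI[of _ "\<lambda>k. if k = i then 1 else if k = j then -1 else 0"]) auto
  next
    case True
    have "card (f ` {..CARD('n)}) = Suc CARD('n)"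
      using True by (simp add: card_image)
    then have "vec.dependent (f ` {..CARD('n)})"
      using vec.independent_card_le_dim[of "f ` {..CARD('n)}" UNIV] by (auto simp: vec.dim_UNIV vec.dimension_def card_cart_basis)
    then obtain g where g: "\<exists>v\<in>f ` {..CARD('n)}. g v \<noteq> 0" "(\<Sum>v\<in>f ` {..CARD('n)}. g v *s v) = 0"
      by (subst (asm) vec.dependent_finite) auto
    have "(\<Sum>i\<in>{..CARD('n)}. g (f i) *s f i) = 0"
      using g(2) by (simp add: sum.reindex[OF True])
    then show ?thesis using g(1) by (intro exI[of _ "\<lambda>i. g (f i)"]) auto
  qed
  then obtain c i where c: "i \<le> CARD('n)" "c i \<noteq> 0" "(\<Sum>i\<le>CARD('n). c i *s f i) = 0" by auto
  let ?p = "\<Sum>i\<le>CARD('n). monom (c i) i"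
  have "coeff ?p i = c i" using c(1) by (simp add: coeff_sum)
  then have "?p \<noteq> 0" using c(2) by auto
  moreover have "degree ?p \<le> CARD('n)"
    by (intro degree_sum_le) (auto intro: order.trans[OF degree_monom_le])
  moreover have "poly_act M ?p u = 0" using fs[of "{..CARD('n)}" c] c(3) by simp
  ultimately show thesis using that by blast
qed

lemma coprime_linear_polys:
  fixes a b :: complex
  assumes "a \<noteq> b"
  shows "coprime [:-a, 1:] [:-b, 1:]"
proof (rule coprimeI)
  fix d assume "d dvd [:-a, 1:]" "d dvd [:-b, 1:]"
  then have "d dvd [:-a, 1:] - [:-b, 1:]" by (rule dvd_diff)
  then have "d dvd [:b - a:]" by simp
  moreover have "is_unit [:b - a:]" using assms by (simp add: is_unit_const_poly_iff dvd_field_iff)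
  ultimately show "is_unit d" by (rule dvd_trans)
qed

text \<open>
  A vector killed by \<open>g\<close> is thus recovered from its image under \<open>f\<close>; the spectral
  decomposition and its uniqueness both come from this.
\<close>

lemma poly_act_bezout:
  assumes "coprime f g"
  obtains a b where "\<And>u. u = poly_act M a (poly_act M f u) + poly_act M b (poly_act M g u)"
proof -
  obtain a b where "a * f + b * g = 1"
    using bezout_coefficients_fst_snd[of f g] assms by (metis coprime_imp_gcd_eq_1)
  then have "u = poly_act M (a * f + b * g) u" for u by simp
  then show thesis using that[of a b] by (simp add: poly_act_add poly_act_mult)
qed

text \<open>
  Splitting off one root \<open>z\<close> at a time: for \<open>p = [:-z, 1:]^k * g\<close> Bezout's identity writes \<open>u\<close> as a sum of
  a vector killed by \<open>g\<close>, to which the induction applies, and one killed by \<open>[:-z, 1:]^k\<close>.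
\<close>

lemma poly_act_zero_in_span:
  fixes M :: "complex^'n^'n"
  assumes "p \<noteq> 0" "degree p \<le> CARD('n)" "poly_act M p u = 0"
  shows "u \<in> vec.span (\<Union>z. {w. poly_act M ([:-z, 1:] ^ CARD('n)) w = 0})"
  using assms
proof (induction "degree p" arbitrary: p u rule: less_induct)
  case less
  let ?U = "\<Union>z. {w. poly_act M ([:-z, 1:] ^ CARD('n)) w = 0}"
  show ?case
  proof (cases "degree p = 0")
    case True
    then obtain c where "p = [:c:]" by (metis degree_eq_zeroE)
    then have "c \<noteq> 0" "c *s u = 0" using less.prems by auto
    then have "u = 0" by simp
    then show ?thesis by (simp add: vec.span_zero)
  next
    case False
    then obtain z where z: "poly p z = 0"
      using alg_closed_imp_poly_has_root[of p] by blast
    define k where "k = order z p"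
    obtain g where g: "p = [:-z, 1:] ^ k * g" "\<not> [:-z, 1:] dvd g"
      using order_decomp[OF less.prems(1), of z] unfolding k_def by blast
    have k0: "k > 0" using z less.prems(1) unfolding k_def by (simp add: order_root)
    have g0: "g \<noteq> 0" using g less.prems(1) by auto
    have deg: "degree p = k + degree g"
      using g(1) g0 by (simp add: degree_mult_eq degree_linear_power)
    have "prime_elem [:-z, 1:]" by (rule prime_elem_linear_field_poly) simp
    then have "coprime [:-z, 1:] g" using g(2) by (rule prime_elem_imp_coprime)
    then have "coprime ([:-z, 1:] ^ k) g" by simp
    then obtain a b where ab: "\<And>u. u = poly_act M a (poly_act M ([:-z, 1:] ^ k) u) + poly_act M b (poly_act M g u)"
      using poly_act_bezout by blast
    let ?v = "poly_act M a (poly_act M ([:-z, 1:] ^ k) u)" and ?w = "poly_act M b (poly_act M g u)"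
    have "poly_act M g ?v = poly_act M (a * p) u"
      by (simp add: poly_act_mult[symmetric] g(1) ac_simps)
    then have "poly_act M g ?v = 0" by (simp add: poly_act_mult less.prems(3))
    then have "?v \<in> vec.span ?U"
      using less.hyps[of g ?v] deg k0 g0 less.prems(2) by auto
    moreover have "poly_act M ([:-z, 1:] ^ CARD('n)) ?w = poly_act M ([:-z, 1:] ^ (CARD('n) - k) * b * p) u"
      using deg less.prems(2)
      by (simp add: poly_act_mult[symmetric] g(1) power_add[symmetric] ac_simps)
    then have "poly_act M ([:-z, 1:] ^ CARD('n)) ?w = 0" by (simp add: poly_act_mult less.prems(3))
    then have "?w \<in> vec.span ?U" by (intro vec.span_base) auto
    ultimately show ?thesis using ab[of u] vec.span_add by metis
  qed
qed

lemma gen_eigenspace_poly: "gen_eigenspace M z = {w. poly_act (cmat M) ([:-z, 1:] ^ CARD('n)) w = 0}"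
  for M :: "real^'n^'n"
  by (simp add: gen_eigenspace_def poly_act_linear_power)

text \<open>If \<open>z\<close> is not an eigenvalue then \<open>M - z\<close> is injective, and so are its powers.\<close>

lemma gen_eigenspace_trivial:
  assumes "z \<notin> eigenvalues M"
  shows "gen_eigenspace M z = {0}"
proof -
  have "w = 0" if "((\<lambda>u. cmat M *v u - z *s u) ^^ k) w = 0" for k w
    using that
  proof (induction k)
    case (Suc k)
    then have "cmat M *v (((\<lambda>u. cmat M *v u - z *s u) ^^ k) w) = z *s (((\<lambda>u. cmat M *v u - z *s u) ^^ k) w)"
      by simp
    with assms Suc.IH show ?case unfolding eigenvalues_def by blast
  qed simp
  moreover have "((\<lambda>u. cmat M *v u - z *s u) ^^ k) 0 = 0" for k by (induction k) auto
  ultimately show ?thesis unfolding gen_eigenspace_def by auto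
qed

lemma span_gen_eigenspaces:
  fixes M :: "real^'n^'n"
  shows "vec.span (\<Union>z\<in>eigenvalues M. gen_eigenspace M z) = UNIV"
proof -
  have "u \<in> vec.span (\<Union>z\<in>eigenvalues M. gen_eigenspace M z)" for u
  proof -
    obtain p where "p \<noteq> 0" "degree p \<le> CARD('n)" "poly_act (cmat M) p u = 0"
      using annihilating_poly_vector by blast
    from poly_act_zero_in_span[OF this] have "u \<in> vec.span (\<Union>z. gen_eigenspace M z)"
      by (simp add: gen_eigenspace_poly)
    also have "(\<Union>z. gen_eigenspace M z) \<subseteq> insert 0 (\<Union>z\<in>eigenvalues M. gen_eigenspace M z)"
      using gen_eigenspace_trivial by fastforce
    then have "vec.span (\<Union>z. gen_eigenspace M z) \<subseteq> vec.span (\<Union>z\<in>eigenvalues M. gen_eigenspace M z)"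
      using vec.span_mono by (metis vec.span_insert_0)
    finally show ?thesis .
  qed
  then show ?thesis by auto
qed

lemma finite_eigenvalues: "finite (eigenvalues M)" for M :: "real^'n^'n"
proof -
  have "\<exists>p. p \<noteq> 0 \<and> poly_act (cmat M) p u = 0" for u
    using annihilating_poly_vector by metis
  then obtain P where P: "\<And>u. P u \<noteq> 0" "\<And>u. poly_act (cmat M) (P u) u = 0" by metis
  define p where "p = (\<Prod>i\<in>UNIV. P (axis i 1))"
  have "p \<noteq> 0" unfolding p_def using P(1) by simp
  have ax: "poly_act (cmat M) p (axis i 1) = 0" for i
  proof -
    have "p = (\<Prod>j\<in>UNIV - {i}. P (axis j 1)) * P (axis i 1)"
      unfolding p_def by (subst prod.remove[of _ i]) (auto simp: mult.commute)
    then show ?thesis by (simp add: poly_act_mult P(2))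
  qed
  have "poly_act (cmat M) p u = 0" for u
  proof -
    have "u = (\<Sum>i\<in>UNIV. u $ i *s axis i 1)" by (simp add: basis_expansion)
    then have "poly_act (cmat M) p u = (\<Sum>i\<in>UNIV. u $ i *s poly_act (cmat M) p (axis i 1))"
      by (metis (no_types, lifting) poly_act_sum_right poly_act_smult_right sum.cong)
    then show ?thesis by (simp add: ax)
  qed
  then have "eigenvalues M \<subseteq> {z. poly p z = 0}"
    unfolding eigenvalues_def using poly_act_eigenvector[of "cmat M" _ _ p]
    by (smt (verit) mem_Collect_eq subsetI vec.scale_eq_0_iff)
  then show ?thesis using poly_roots_finite[OF \<open>p \<noteq> 0\<close>] finite_subset by blast
qed

lemma cmat_mult_cvec: "cmat M *v cvec v = cvec (M *v v)"
  by (simp add: cmat_def cvec_def matrix_vector_mult_def Finite_Cartesian_Product.vec_eq_iff map_matrix_def)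

lemma cvec_simps [simp]: "cvec 0 = 0" "cvec (u + v) = cvec u + cvec v" "cvec (c *\<^sub>R v) = complex_of_real c *s cvec v"
  by (simp_all add: cvec_def Finite_Cartesian_Product.vec_eq_iff)

lemma cvec_eq_iff: "cvec u = cvec v \<longleftrightarrow> u = v"
  by (simp add: cvec_def Finite_Cartesian_Product.vec_eq_iff)

lemma cvec_sum: "cvec (sum f I) = (\<Sum>i\<in>I. cvec (f i))"
  by (induction I rule: infinite_finite_induct) auto

text \<open>
  Real vectors are recovered from complex ones through the real part.  This stays within the spectral
  space of a modulus, since complex conjugation exchanges \<open>z\<close> and \<open>cnj z\<close>, which have the same modulus.
\<close>

definition conj_vec :: "complex^'n \<Rightarrow> complex^'n" where
  "conj_vec w = (\<chi> i. cnj (w $ i))"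

definition Re_vec :: "complex^'n \<Rightarrow> real^'n" where
  "Re_vec w = (\<chi> i. Re (w $ i))"

lemma cvec_Re_vec: "cvec (Re_vec w) = (1/2) *s (w + conj_vec w)"
  by (simp add: cvec_def Re_vec_def conj_vec_def Finite_Cartesian_Product.vec_eq_iff complex_eq_iff)

lemma conj_vec_mult: "conj_vec (cmat M *v w) = cmat M *v conj_vec w"
  by (simp add: conj_vec_def cmat_def matrix_vector_mult_def Finite_Cartesian_Product.vec_eq_iff map_matrix_def)

lemma eigenvalues_transpose: "eigenvalues (transpose A) = eigenvalues A" for A :: "real^'n^'n"
proof -
  have *: "z \<in> eigenvalues M \<longleftrightarrow> Determinants.det (cmat M - mat z) = 0" for z and M :: "real^'n^'n"
  proof -
    have "z \<in> eigenvalues M \<longleftrightarrow> (\<exists>w. w \<noteq> 0 \<and> (cmat M - mat z) *v w = 0)"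
    proof -
      have "mat z *v w = z *s w" for w :: "complex^'n"
        by (simp add: Finite_Cartesian_Product.mat_def matrix_vector_mult_def Finite_Cartesian_Product.vec_eq_iff
            if_distrib[of "\<lambda>x. x * _"] cong: if_cong)
      then show ?thesis by (simp add: eigenvalues_def matrix_vector_mult_diff_rdistrib)
    qed
    also have "\<dots> \<longleftrightarrow> \<not> invertible (cmat M - mat z)"
      by (metis invertible_left_inverse matrix_left_invertible_ker)
    finally show ?thesis by (simp add: invertible_det_nz)
  qed
  have "cmat (transpose A) - mat z = transpose (cmat A - mat z)" for z
    by (auto simp: cmat_def transpose_def Finite_Cartesian_Product.mat_def Finite_Cartesian_Product.vec_eq_iff map_matrix_def)
  then show ?thesis by (auto simp: * det_transpose)
qed

lemma cnj_in_eigenvalues: "z \<in> eigenvalues M \<Longrightarrow> cnj z \<in> eigenvalues M"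
proof -
  assume "z \<in> eigenvalues M"
  then obtain w where w: "w \<noteq> 0" "cmat M *v w = z *s w" by (auto simp: eigenvalues_def)
  have "cmat M *v conj_vec w = conj_vec (z *s w)" by (metis conj_vec_mult w(2))
  also have "\<dots> = cnj z *s conj_vec w" by (simp add: conj_vec_def Finite_Cartesian_Product.vec_eq_iff)
  finally have "cmat M *v conj_vec w = cnj z *s conj_vec w" .
  moreover have "conj_vec w \<noteq> 0" using w(1) by (auto simp: conj_vec_def Finite_Cartesian_Product.vec_eq_iff)
  ultimately show ?thesis by (auto simp: eigenvalues_def)
qed

text \<open>The list behind \<open>modulus\<close> counts from 0, whereas the indices start with 1.\<close>

lemma bij_betw_modulus:
  fixes A :: "real^'n^'n"
  shows "bij_betw (modulus A) {1..num_moduli A} (cmod ` eigenvalues A)"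
proof -
  let ?S = "cmod ` eigenvalues A"
  let ?L = "rev (sorted_list_of_set ?S)"
  have fin: "finite ?S" by (simp add: finite_eigenvalues)
  have "bij_betw (\<lambda>i. ?L ! i) {..<length ?L} (set ?L)"
    by (rule bij_betw_nth) auto
  then have "bij_betw (\<lambda>i. ?L ! i) {0..<num_moduli A} ?S"
    using fin by (simp add: num_moduli_def atLeast0LessThan)
  moreover have "bij_betw (\<lambda>i::nat. i - 1) {1..num_moduli A} {0..<num_moduli A}"
    by (rule bij_betwI[of _ _ _ Suc]) auto
  ultimately show ?thesis
    unfolding modulus_def using bij_betw_trans[of "\<lambda>i::nat. i - 1" _ _ "\<lambda>i. ?L ! i"] by (simp add: o_def)
qed

lemma modulus_less_1:
  fixes A :: "real^'n^'n"
  assumes "spec_radius A < 1" "i \<in> {1..num_moduli A}"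
  shows "modulus A i < 1"
proof -
  have "modulus A i \<in> cmod ` eigenvalues A" using bij_betwE[OF bij_betw_modulus] assms(2) by blast
  then have "modulus A i \<le> spec_radius A" by (simp add: spec_radius_def finite_eigenvalues)
  with assms(1) show ?thesis by simp
qed

lemma modulus_pos:
  fixes A :: "real^'n^'n"
  assumes "invertible A" "i \<in> {1..num_moduli A}"
  shows "modulus A i > 0"
proof -
  obtain z where z: "z \<in> eigenvalues A" "modulus A i = cmod z"
    using bij_betwE[OF bij_betw_modulus] assms(2) by blast
  have "z \<noteq> 0"
  proof
    assume "z = 0"
    then obtain w where w: "w \<noteq> 0" "cmat A *v w = 0" using z(1) by (auto simp: eigenvalues_def)
    obtain B where "B ** A = mat 1" using assms(1) invertible_left_inverse by blast
    then have "cmat B ** cmat A = cmat (mat 1)"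
      by (auto simp: cmat_def matrix_matrix_mult_def Finite_Cartesian_Product.vec_eq_iff map_matrix_def simp flip: of_real_mult of_real_sum)
    also have "cmat (mat 1 :: real^'n^'n) = mat 1"
      by (auto simp: cmat_def Finite_Cartesian_Product.mat_def Finite_Cartesian_Product.vec_eq_iff map_matrix_def)
    finally have "w = cmat B *v (cmat A *v w)" by (simp add: matrix_vector_mul_assoc)
    then show False using w by simp
  qed
  then show ?thesis using z(2) by simp
qed

section \<open>The real spectral decomposition\<close>

definition cspec :: "real^'n^'n \<Rightarrow> nat \<Rightarrow> (complex^'n) set" where
  "cspec A i = vec.span
     (\<Union>z\<in>{z \<in> eigenvalues (transpose A). cmod z = modulus A i}. gen_eigenspace (transpose A) z)"

lemma spec_space_cspec: "spec_space A i = {v. cvec v \<in> cspec A i}"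
  by (simp add: spec_space_def cspec_def)

lemma subspace_spec_space: "subspace (spec_space A i)"
  unfolding spec_space_cspec cspec_def
  by (rule subspaceI) (auto simp: vec.span_zero vec.span_add vec.span_scale)

lemma gen_eigenspace_invariant:
  assumes "w \<in> gen_eigenspace M z" shows "cmat M *v w \<in> gen_eigenspace M z"
  using assms by (simp add: gen_eigenspace_poly poly_act_commute)

lemma cspec_invariant:
  assumes "w \<in> cspec A i" shows "cmat (transpose A) *v w \<in> cspec A i"
  using assms unfolding cspec_def
proof (induction rule: vec.span_induct_alt)
  case (step c x y)
  have "cmat (transpose A) *v (c *s x + y) = c *s (cmat (transpose A) *v x) + cmat (transpose A) *v y"
    by (simp only: matrix_vector_right_distrib vector_scalar_commute)
  moreover have "cmat (transpose A) *v x \<in> (\<Union>z\<in>{z \<in> eigenvalues (transpose A). cmod z = modulus A i}. gen_eigenspace (transpose A) z)"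
    using step(1) gen_eigenspace_invariant by blast
  ultimately show ?case using step(2) by (simp only: vec.span_add vec.span_scale vec.span_base)
qed (simp add: vec.span_zero)

lemma spec_space_invariant:
  "v \<in> spec_space A i \<Longrightarrow> transpose A *v v \<in> spec_space A i"
  unfolding spec_space_cspec mem_Collect_eq cmat_mult_cvec[symmetric] by (rule cspec_invariant)

lemma conj_vec_gen_eigenspace:
  fixes M :: "real^'n^'n"
  assumes "w \<in> gen_eigenspace M z" shows "conj_vec w \<in> gen_eigenspace M (cnj z)"
proof -
  have *: "conj_vec (((\<lambda>u. cmat M *v u - z *s u) ^^ k) w) = ((\<lambda>u. cmat M *v u - cnj z *s u) ^^ k) (conj_vec w)" for k
  proof (induction k)
    case (Suc k)
    have "conj_vec (cmat M *v u - z *s u) = cmat M *v conj_vec u - cnj z *s conj_vec u" for u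
      by (simp flip: conj_vec_mult) (simp add: conj_vec_def Finite_Cartesian_Product.vec_eq_iff)
    then show ?case using Suc by simp
  qed simp
  have "((\<lambda>u. cmat M *v u - z *s u) ^^ CARD('n)) w = 0" using assms unfolding gen_eigenspace_def by blast
  then have "((\<lambda>u. cmat M *v u - cnj z *s u) ^^ CARD('n)) (conj_vec w) = conj_vec 0"
    by (simp only: *[symmetric])
  also have "\<dots> = 0" by (simp add: conj_vec_def Finite_Cartesian_Product.vec_eq_iff)
  finally show ?thesis unfolding gen_eigenspace_def by blast
qed

lemma conj_vec_cspec:
  fixes A :: "real^'n^'n"
  assumes "w \<in> cspec A i" shows "conj_vec w \<in> cspec A i"
  using assms unfolding cspec_def
proof (induction rule: vec.span_induct_alt)
  case base
  have "conj_vec (0 :: complex^'n) = 0" by (simp add: conj_vec_def Finite_Cartesian_Product.vec_eq_iff)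
  then show ?case by (simp add: vec.span_zero)
next
  case (step c x y)
  then obtain z where z: "z \<in> eigenvalues (transpose A)" "cmod z = modulus A i" "x \<in> gen_eigenspace (transpose A) z"
    by auto
  have "conj_vec (c *s x + y) = cnj c *s conj_vec x + conj_vec y"
    by (simp add: conj_vec_def Finite_Cartesian_Product.vec_eq_iff)
  moreover have "conj_vec x \<in> (\<Union>z\<in>{z \<in> eigenvalues (transpose A). cmod z = modulus A i}. gen_eigenspace (transpose A) z)"
    using conj_vec_gen_eigenspace[OF z(3)] cnj_in_eigenvalues[OF z(1)] z(2) by auto
  ultimately show ?case using step(2) by (simp only: vec.span_add vec.span_scale vec.span_base)
qed

lemma Re_vec_cspec: "w \<in> cspec A i \<Longrightarrow> Re_vec w \<in> spec_space A i"
  using conj_vec_cspec[of w A i]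
  unfolding spec_space_cspec mem_Collect_eq cvec_Re_vec cspec_def
  by (intro vec.span_scale vec.span_add)

lemma span_Union_decomp:
  assumes "finite I" "w \<in> vec.span (\<Union>i\<in>I. S i)"
  obtains u where "\<And>i. i \<in> I \<Longrightarrow> u i \<in> vec.span (S i)" "w = (\<Sum>i\<in>I. u i)"
proof -
  have "\<exists>u. (\<forall>i\<in>I. u i \<in> vec.span (S i)) \<and> w = (\<Sum>i\<in>I. u i)" using assms
  proof (induction I arbitrary: w rule: finite_induct)
    case (insert i I)
    then obtain x y where xy: "x \<in> vec.span (S i)" "y \<in> vec.span (\<Union>i\<in>I. S i)" "w = x + y"
      by (auto simp: vec.span_Un)
    obtain u where u: "\<forall>i\<in>I. u i \<in> vec.span (S i)" "y = (\<Sum>i\<in>I. u i)" using insert.IH[OF xy(2)] by blast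
    have "(\<Sum>j\<in>insert i I. (u(i := x)) j) = x + (\<Sum>j\<in>I. (u(i := x)) j)" using insert by simp
    also have "(\<Sum>j\<in>I. (u(i := x)) j) = (\<Sum>j\<in>I. u j)" using insert by (intro sum.cong) auto
    finally show ?case using u xy insert by (intro exI[of _ "u(i := x)"]) auto
  qed simp
  then show thesis using that by blast
qed

lemma spec_decomp_exists:
  fixes A :: "real^'n^'n"
  obtains u where "\<And>i. i \<in> {1..num_moduli A} \<Longrightarrow> u i \<in> spec_space A i" "\<eta> = (\<Sum>i=1..num_moduli A. u i)"
proof -
  let ?I = "{1..num_moduli A}"
  let ?Z = "\<lambda>i. {z \<in> eigenvalues (transpose A). cmod z = modulus A i}"
  have "(\<Union>i\<in>?I. ?Z i) = eigenvalues (transpose A)"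
    using bij_betw_imp_surj_on[OF bij_betw_modulus[of A]] by (auto simp: eigenvalues_transpose)
  then have "(\<Union>z\<in>eigenvalues (transpose A). gen_eigenspace (transpose A) z)
      = (\<Union>i\<in>?I. \<Union>z\<in>?Z i. gen_eigenspace (transpose A) z)" by blast
  then have "cvec \<eta> \<in> vec.span (\<Union>i\<in>?I. \<Union>z\<in>?Z i. gen_eigenspace (transpose A) z)"
    using span_gen_eigenspaces[of "transpose A"] by simp
  then obtain w where w: "\<And>i. i \<in> ?I \<Longrightarrow> w i \<in> cspec A i" "cvec \<eta> = (\<Sum>i\<in>?I. w i)"
    using span_Union_decomp[of ?I "cvec \<eta>"] unfolding cspec_def by blast
  have "\<eta> = Re_vec (cvec \<eta>)" by (simp add: Re_vec_def cvec_def Finite_Cartesian_Product.vec_eq_iff)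
  also have "\<dots> = (\<Sum>i\<in>?I. Re_vec (w i))" unfolding w(2) by (simp add: Re_vec_def Finite_Cartesian_Product.vec_eq_iff)
  finally show thesis using that[of "\<lambda>i. Re_vec (w i)"] w(1) Re_vec_cspec by blast
qed

text \<open>
  The product \<open>g i\<close> of the \<open>[:-z, 1:]^n\<close> over the eigenvalues \<open>z\<close> of modulus \<open>modulus A i\<close> kills the \<open>i\<close>-th space.
  It is coprime to the product \<open>h\<close> of the others, which kills the remaining summands and therefore,
  if all of them add up to 0, also \<open>u i\<close>.
\<close>

lemma spec_decomp_unique:
  fixes A :: "real^'n^'n"
  assumes u: "\<And>i. i \<in> {1..num_moduli A} \<Longrightarrow> u i \<in> spec_space A i"
    and sum: "(\<Sum>i=1..num_moduli A. u i) = 0" and i: "i \<in> {1..num_moduli A}"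
  shows "u i = 0"
proof -
  let ?I = "{1..num_moduli A}"
  let ?Z = "\<lambda>i. {z \<in> eigenvalues (transpose A). cmod z = modulus A i}"
  let ?M = "cmat (transpose A)"
  define g where "g = (\<lambda>i. \<Prod>z\<in>?Z i. [:-z, 1:] ^ CARD('n))"
  have fin: "finite (?Z i)" for i using finite_eigenvalues[of "transpose A"] by simp
  have kill: "poly_act ?M (g i) w = 0" if "w \<in> cspec A i" for i w
    using that unfolding cspec_def
  proof (induction rule: vec.span_induct_alt)
    case (step c x y)
    then obtain z where z: "z \<in> ?Z i" "x \<in> gen_eigenspace (transpose A) z" by auto
    have "g i = (\<Prod>z\<in>?Z i - {z}. [:-z, 1:] ^ CARD('n)) * [:-z, 1:] ^ CARD('n)"
      unfolding g_def using z fin by (subst prod.remove[of _ z]) (auto simp: mult.commute)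
    then have "poly_act ?M (g i) x = 0" using z(2) by (simp add: poly_act_mult gen_eigenspace_poly)
    then show ?case using step by (simp add: poly_act_add_right poly_act_smult_right)
  qed simp
  have inj: "inj_on (modulus A) ?I" using bij_betw_modulus bij_betw_imp_inj_on by blast
  have cop: "coprime (g i) (g j)" if "j \<in> ?I" "i \<noteq> j" for j
  proof -
    have "modulus A i \<noteq> modulus A j" using inj i that by (auto dest: inj_onD)
    then show ?thesis unfolding g_def
      by (intro prod_coprime_left prod_coprime_right) (auto intro!: coprime_linear_polys)
  qed
  define h where "h = (\<Prod>j\<in>?I - {i}. g j)"
  have "coprime (g i) h" unfolding h_def by (intro prod_coprime_right cop) auto
  then obtain a b where ab: "\<And>w. w = poly_act ?M a (poly_act ?M (g i) w) + poly_act ?M b (poly_act ?M h w)"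
    using poly_act_bezout by blast
  have uc: "cvec (u j) \<in> cspec A j" if "j \<in> ?I" for j using u[OF that] by (simp add: spec_space_cspec)
  have "cvec (u i) + (\<Sum>j\<in>?I - {i}. cvec (u j)) = 0"
  proof -
    have "(\<Sum>j\<in>?I. cvec (u j)) = 0" using sum by (simp only: cvec_simps(1) flip: cvec_sum)
    then show ?thesis using i by (simp only: sum.remove[OF finite_atLeastAtMost i, of "\<lambda>j. cvec (u j)"])
  qed
  then have "poly_act ?M h (cvec (u i) + (\<Sum>j\<in>?I - {i}. cvec (u j))) = 0"
    by (simp only: poly_act_zero_right)
  then have "poly_act ?M h (cvec (u i)) + (\<Sum>j\<in>?I - {i}. poly_act ?M h (cvec (u j))) = 0"
    by (simp only: poly_act_add_right poly_act_sum_right)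
  moreover have "poly_act ?M h (cvec (u j)) = 0" if "j \<in> ?I - {i}" for j
  proof -
    have "h = (\<Prod>j\<in>?I - {i} - {j}. g j) * g j"
      unfolding h_def using that by (subst prod.remove[of _ j]) (auto simp: mult.commute)
    then show ?thesis using kill[OF uc[of j]] that by (simp add: poly_act_mult)
  qed
  ultimately have "poly_act ?M h (cvec (u i)) = 0"
    by simp
  then have "cvec (u i) = 0" using ab[of "cvec (u i)"] kill[OF uc[OF i]] by simp
  then show ?thesis by (metis cvec_eq_iff cvec_simps(1))
qed

text \<open>Existence and uniqueness together make the definite description in \<open>spec_proj\<close> meaningful.\<close>

lemma spec_proj_eqI:
  fixes A :: "real^'n^'n"
  assumes "\<And>i. i \<in> {1..num_moduli A} \<Longrightarrow> u i \<in> spec_space A i" "\<eta> = (\<Sum>i=1..num_moduli A. u i)"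
    "i \<in> {1..num_moduli A}"
  shows "spec_proj A i \<eta> = u i"
proof -
  let ?I = "{1..num_moduli A}"
  define v where "v = (\<lambda>i. if i \<in> ?I then u i else 0)"
  have "(THE u. (\<forall>j\<in>?I. u j \<in> spec_space A j) \<and> (\<forall>j. j \<notin> ?I \<longrightarrow> u j = 0) \<and> \<eta> = (\<Sum>j=1..num_moduli A. u j)) = v"
  proof (rule the_equality)
    have "(\<Sum>i=1..num_moduli A. v i) = (\<Sum>i=1..num_moduli A. u i)"
      unfolding v_def by (rule sum.cong) auto
    then show "(\<forall>j\<in>?I. v j \<in> spec_space A j) \<and> (\<forall>j. j \<notin> ?I \<longrightarrow> v j = 0) \<and> \<eta> = (\<Sum>j=1..num_moduli A. v j)"
      using assms(1,2) by (auto simp: v_def)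
  next
    fix w assume w: "(\<forall>j\<in>?I. w j \<in> spec_space A j) \<and> (\<forall>j. j \<notin> ?I \<longrightarrow> w j = 0) \<and> \<eta> = (\<Sum>j=1..num_moduli A. w j)"
    show "w = v"
    proof
      fix j show "w j = v j"
      proof (cases "j \<in> ?I")
        case True
        have "w j - u j = 0"
          by (rule spec_decomp_unique[where u = "\<lambda>j. w j - u j" and A = A])
            (use w assms(1,2) True in \<open>auto simp: sum_subtractf intro: subspace_diff[OF subspace_spec_space]\<close>)
        then show ?thesis using True by (simp add: v_def)
      qed (use w in \<open>auto simp: v_def\<close>)
    qed
  qed
  then show ?thesis unfolding spec_proj_def using assms(3) by (simp add: v_def)
qed

lemma spec_proj_in: "i \<in> {1..num_moduli A} \<Longrightarrow> spec_proj A i \<eta> \<in> spec_space A i" for A :: "real^'n^'n"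
proof -
  assume i: "i \<in> {1..num_moduli A}"
  obtain u where u: "\<And>i. i \<in> {1..num_moduli A} \<Longrightarrow> u i \<in> spec_space A i" "\<eta> = (\<Sum>i=1..num_moduli A. u i)"
    using spec_decomp_exists by blast
  show ?thesis using spec_proj_eqI[OF u i] u(1)[OF i] by simp
qed

lemma sum_spec_proj: "(\<Sum>i=1..num_moduli A. spec_proj A i \<eta>) = \<eta>" for A :: "real^'n^'n"
proof -
  obtain u where u: "\<And>i. i \<in> {1..num_moduli A} \<Longrightarrow> u i \<in> spec_space A i" "\<eta> = (\<Sum>i=1..num_moduli A. u i)"
    using spec_decomp_exists by blast
  have "(\<Sum>i=1..num_moduli A. spec_proj A i \<eta>) = (\<Sum>i=1..num_moduli A. u i)"
    by (rule sum.cong[OF refl]) (rule spec_proj_eqI[OF u])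
  then show ?thesis using u(2) by simp
qed

lemma linear_spec_proj:
  fixes A :: "real^'n^'n"
  assumes i: "i \<in> {1..num_moduli A}"
  shows "linear (spec_proj A i)"
proof (rule linearI)
  fix x y :: "real^'n" and c :: real
  note sp = subspace_spec_space
  show "spec_proj A i (x + y) = spec_proj A i x + spec_proj A i y"
  proof (rule spec_proj_eqI[where u = "\<lambda>i. spec_proj A i x + spec_proj A i y", OF _ _ i])
    show "spec_proj A j x + spec_proj A j y \<in> spec_space A j" if "j \<in> {1..num_moduli A}" for j
      by (intro subspace_add[OF sp] spec_proj_in that)
    show "x + y = (\<Sum>j=1..num_moduli A. spec_proj A j x + spec_proj A j y)"
      unfolding sum.distrib sum_spec_proj ..
  qed
  show "spec_proj A i (c *\<^sub>R x) = c *\<^sub>R spec_proj A i x"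
  proof (rule spec_proj_eqI[where u = "\<lambda>i. c *\<^sub>R spec_proj A i x", OF _ _ i])
    show "c *\<^sub>R spec_proj A j x \<in> spec_space A j" if "j \<in> {1..num_moduli A}" for j
      by (intro subspace_scale[OF sp] spec_proj_in that)
    show "c *\<^sub>R x = (\<Sum>j=1..num_moduli A. c *\<^sub>R spec_proj A j x)"
      unfolding scaleR_sum_right[symmetric] sum_spec_proj ..
  qed
qed

lemma spec_proj_transpose:
  fixes A :: "real^'n^'n"
  assumes i: "i \<in> {1..num_moduli A}"
  shows "spec_proj A i (transpose A *v \<eta>) = transpose A *v spec_proj A i \<eta>"
proof (rule spec_proj_eqI[where u = "\<lambda>i. transpose A *v spec_proj A i \<eta>", OF _ _ i])
  have "(\<Sum>j=1..num_moduli A. transpose A *v spec_proj A j \<eta>) = transpose A *v (\<Sum>j=1..num_moduli A. spec_proj A j \<eta>)"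
    by (rule linear_sum[OF matrix_vector_mul_linear, symmetric])
  then show "transpose A *v \<eta> = (\<Sum>j=1..num_moduli A. transpose A *v spec_proj A j \<eta>)"
    by (simp only: sum_spec_proj)
qed (intro spec_space_invariant spec_proj_in)

lemma spec_proj_matpow:
  fixes A :: "real^'n^'n"
  assumes "i \<in> {1..num_moduli A}"
  shows "spec_proj A i (matpow (transpose A) q *v \<eta>) = matpow (transpose A) q *v spec_proj A i \<eta>"
  by (induction q) (auto simp: spec_proj_transpose[OF assms] simp flip: matrix_vector_mul_assoc simp del: transpose_matrix_vector)

text \<open>The real part of an eigenvector \<open>w\<close> may vanish; then that of \<open>\<i> *s w\<close> does not.\<close>

lemma spec_space_nontrivial:
  fixes A :: "real^'n^'n"
  assumes i: "i \<in> {1..num_moduli A}"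
  obtains v where "v \<in> spec_space A i" "v \<noteq> 0"
proof -
  obtain z where z: "z \<in> eigenvalues (transpose A)" "modulus A i = cmod z"
    using bij_betwE[OF bij_betw_modulus] i eigenvalues_transpose by blast
  then obtain w where w: "w \<noteq> 0" "cmat (transpose A) *v w = z *s w" by (auto simp: eigenvalues_def)
  \<comment> \<open>An eigenvector is killed by every positive power, also by the one in \<open>gen_eigenspace\<close>.\<close>
  have *: "((\<lambda>u. cmat (transpose A) *v u - z *s u) ^^ Suc k) w = 0" for k
    by (induction k) (auto simp: w(2))
  obtain k where "CARD('n) = Suc k" by (metis zero_less_card_finite gr0_implies_Suc)
  then have wg: "w \<in> gen_eigenspace (transpose A) z" using * unfolding gen_eigenspace_def by auto
  have wc: "c *s w \<in> cspec A i" for c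
    unfolding cspec_def using wg z by (intro vec.span_scale vec.span_base) auto
  show thesis
  proof (cases "Re_vec w = 0")
    case False
    then show thesis using that Re_vec_cspec[OF wc[of 1]] by simp
  next
    case True
    have "Re_vec (\<i> *s w) \<noteq> 0"
      using True w(1) by (auto simp: Re_vec_def Finite_Cartesian_Product.vec_eq_iff complex_eq_iff)
    then show thesis using that Re_vec_cspec[OF wc[of \<i>]] by blast
  qed
qed

section \<open>Powers of matrices\<close>

lemma matpow_add: "matpow M (a + b) = matpow M a ** matpow M b"
  by (induction a) (auto simp: matrix_mul_assoc)

lemma matpow_Suc_right: "matpow M (Suc k) = matpow M k ** M"
proof (induction k)
  case (Suc k)
  have "matpow M (Suc (Suc k)) = M ** (matpow M k ** M)" by (subst matpow.simps(2)) (simp only: Suc)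
  also have "\<dots> = matpow M (Suc k) ** M" by (simp add: matrix_mul_assoc)
  finally show ?case .
qed simp

lemma matpow_transpose: "matpow (transpose A) q = transpose (matpow A q)" for A :: "'a::comm_semiring_1^'n^'n"
proof (induction q)
  case (Suc q)
  have "matpow (transpose A) (Suc q) = transpose A ** transpose (matpow A q)"
    by (subst matpow.simps(2)) (simp only: Suc)
  also have "\<dots> = transpose (matpow A (Suc q))"
    by (subst matpow_Suc_right) (simp only: matrix_transpose_mul)
  finally show ?case .
qed (simp add: transpose_mat)

lemma det_matpow: "det (matpow A q) = det A ^ q" for A :: "real^'n^'n"
  by (induction q) (auto simp: det_mul)

lemma matrix_inv_left:
  fixes M :: "real^'n^'n"
  assumes "invertible M"
  shows "matrix_inv M ** M = mat 1"
  using someI_ex[OF assms[unfolded invertible_def]] unfolding matrix_inv_def by blast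

lemma matpow_matrix_inv:
  fixes M :: "real^'n^'n"
  assumes "invertible M"
  shows "matpow (matrix_inv M) q ** matpow M q = mat 1"
proof (induction q)
  case (Suc q)
  have "matpow (matrix_inv M) (Suc q) ** matpow M (Suc q)
      = matpow (matrix_inv M) q ** (matrix_inv M ** M) ** matpow M q"
    by (subst matpow_Suc_right) (simp add: matrix_mul_assoc)
  then show ?case using Suc assms by (simp add: matrix_inv_left)
qed simp

text \<open>For \<open>v = 0\<close> the quotient in \<open>opnorm_on\<close> is 0, which does no harm to the supremum.\<close>

lemma norm_le_opnorm_on:
  fixes f :: "'a::euclidean_space \<Rightarrow> 'b::real_normed_vector"
  assumes "linear f" "v \<in> E"
  shows "norm (f v) \<le> opnorm_on E f * norm v"
proof (cases "v = 0")
  case True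
  then show ?thesis using linear_0[OF assms(1)] by simp
next
  case False
  have bl: "bounded_linear f" by (rule linear_conv_bounded_linear[THEN iffD1, OF assms(1)])
  have "norm (f w) / norm w \<le> onorm f" for w by (rule le_onorm[OF bl])
  then have "bdd_above ((\<lambda>v. norm (f v) / norm v) ` E)" by (intro bdd_aboveI[of _ "onorm f"]) auto
  then have "norm (f v) / norm v \<le> opnorm_on E f"
    unfolding opnorm_on_def by (rule cSUP_upper[OF assms(2)])
  then show ?thesis using False by (simp add: divide_le_eq)
qed

section \<open>Sizes of Jordan blocks\<close>

lemma Jordan_block_le_dim:
  assumes "M \<in> carrier_mat k k" "jordan_nf (M :: complex Matrix.mat) n_as" "(m, z) \<in> set n_as"
  shows "m \<le> k"
proof -
  have "m \<le> order z (char_poly M)" by (rule jordan_nf_block_size_order_bound[OF assms(2,3)])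
  also have "\<dots> \<le> degree (char_poly M)"
    using degree_monic_char_poly[OF assms(1)] by (intro order_degree) auto
  finally show ?thesis using degree_monic_char_poly[OF assms(1)] by simp
qed

lemma ex_Jordan_block:
  assumes "M \<in> carrier_mat k k" "k > 0"
  obtains n_as m z where "jordan_nf (M :: complex Matrix.mat) n_as" "(m, z) \<in> set n_as"
proof -
  obtain as where "char_poly M = (\<Prod>a\<leftarrow>as. [:- a, 1:])"
    using char_poly_factorized[OF assms(1)] by blast
  then obtain n_as where j: "jordan_nf M n_as" using jordan_nf_exists[OF assms(1)] by blast
  have "n_as \<noteq> []"
  proof
    assume "n_as = []"
    then have "char_poly M = 1" using jordan_nf_char_poly[OF j] by simp
    then show False using degree_monic_char_poly[OF assms(1)] assms(2) by simp
  qed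
  then show thesis using that[OF j] by (metis list.set_intros(1) neq_Nil_conv surj_pair)
qed

text \<open>
  The set of block sizes in \<open>max_jordan_block\<close> has to be shown nonempty here, since \<open>Max {}\<close> carries no
  information.
\<close>

lemma max_jordan_block_le:
  fixes f :: "real^'n \<Rightarrow> real^'n"
  assumes E: "subspace E" and v: "v \<in> E" "v \<noteq> 0" and f: "\<And>x. x \<in> E \<Longrightarrow> f x \<in> E"
  shows "max_jordan_block f E \<le> CARD('n)"
proof -
  define Q where "Q = (\<lambda>m vs M n_as z.
     distinct vs \<and> independent (set vs) \<and> span (set vs) = E \<and>
     M \<in> carrier_mat (length vs) (length vs) \<and>
     (\<forall>j<length vs. f (vs ! j) = (\<Sum>i<length vs. (M $$ (i, j)) *\<^sub>R (vs ! i))) \<and>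
     jordan_nf (map_mat complex_of_real M) n_as \<and> (m, z) \<in> set n_as)"
  have bound: "m \<le> CARD('n)" if "Q m vs M n_as z" for m vs M n_as z
  proof -
    have "m \<le> length vs"
      using that Jordan_block_le_dim[of "map_mat complex_of_real M" "length vs" n_as m z] by (auto simp: Q_def)
    also have "length vs = card (set vs)" using that by (simp add: Q_def distinct_card)
    also have "\<dots> \<le> CARD('n)" using that independent_bound[of "set vs"] by (auto simp: Q_def)
    finally show ?thesis .
  qed
  have "\<exists>m vs M n_as z. Q m vs M n_as z"
  proof -
    obtain B where B: "B \<subseteq> E" "independent B" "E \<subseteq> span B" using basis_exists[of E] by metis
    have finB: "finite B" using B(2) independent_bound by blast
    obtain vs where vs: "set vs = B" "distinct vs" using finite_distinct_list[OF finB] by blast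
    have span: "span (set vs) = E" using B vs E by (metis span_minimal subset_antisym)
    have "vs \<noteq> []" using span v by auto
    have "\<exists>c. f x = (\<Sum>y\<in>B. c y *\<^sub>R y)" if "x \<in> B" for x
      using f[of x] that B span_finite[OF finB] by fastforce
    then obtain c where c: "\<And>x. x \<in> B \<Longrightarrow> f x = (\<Sum>y\<in>B. c x y *\<^sub>R y)" by metis
    define M where "M = Matrix.mat (length vs) (length vs) (\<lambda>(i, j). c (vs ! j) (vs ! i))"
    have M: "M \<in> carrier_mat (length vs) (length vs)" by (simp add: M_def)
    have "f (vs ! j) = (\<Sum>i<length vs. (M $$ (i, j)) *\<^sub>R (vs ! i))" if j: "j < length vs" for j
    proof -
      have "f (vs ! j) = (\<Sum>y\<in>B. c (vs ! j) y *\<^sub>R y)" using c j vs(1) nth_mem by blast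
      also have "\<dots> = (\<Sum>i<length vs. c (vs ! j) (vs ! i) *\<^sub>R (vs ! i))"
        using bij_betw_nth[OF vs(2) refl vs(1)[symmetric]]
        by (rule sum.reindex_bij_betw[symmetric])
      finally show ?thesis using j by (simp add: M_def)
    qed
    moreover obtain n_as m z where "jordan_nf (map_mat complex_of_real M) n_as" "(m, z) \<in> set n_as"
      using ex_Jordan_block[of "map_mat complex_of_real M" "length vs"] M \<open>vs \<noteq> []\<close> by auto
    ultimately show ?thesis unfolding Q_def using vs B(2) span M by blast
  qed
  then obtain m vs M n_as z where m: "Q m vs M n_as z" by blast
  define S where "S = {m. \<exists>vs M n_as z. Q m vs M n_as z}"
  have "S \<subseteq> {..CARD('n)}" using bound by (auto simp: S_def)
  moreover have "S \<noteq> {}" using m unfolding S_def by blast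
  ultimately have "Max S \<le> CARD('n)" by (meson Max_in atMost_iff finite_atMost finite_subset subsetD)
  then show ?thesis unfolding max_jordan_block_def S_def Q_def .
qed

lemma jordan_size_le:
  fixes A :: "real^'n^'n"
  assumes "i \<in> {1..num_moduli A}"
  shows "jordan_size A i \<le> CARD('n)"
proof -
  obtain v where "v \<in> spec_space A i" "v \<noteq> 0" using spec_space_nontrivial[OF assms] by blast
  then show ?thesis unfolding jordan_size_def
    by (rule max_jordan_block_le[OF subspace_spec_space]) (rule spec_space_invariant)
qed

section \<open>The weight along the dynamics\<close>

text \<open>The dynamics of \<open>skew\<close> on frequencies in the fibre direction.\<close>

abbreviation freq :: "real^'n^'n \<Rightarrow> nat \<Rightarrow> real^'n \<Rightarrow> real^'n" where
  "freq A q \<eta> \<equiv> transpose (matpow A q) *v \<eta>"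

lemma spec_proj_freq:
  fixes A :: "real^'n^'n"
  assumes "i \<in> {1..num_moduli A}"
  shows "spec_proj A i (freq A q \<eta>) = freq A q (spec_proj A i \<eta>)"
  using spec_proj_matpow[OF assms, of q \<eta>] by (simp only: matpow_transpose)

text \<open>
  The \<open>i\<close>-th factor of the weight at \<open>\<eta>\<close>, compared with the one at \<open>freq A q \<eta>\<close>, gains or loses the power
  \<open>- 2 * s i\<close> of \<open>modulus A i ^ q\<close>, up to the distortion allowed by \<open>block_bounds\<close>.
\<close>

definition weight_loss :: "real^'n^'n \<Rightarrow> (nat \<Rightarrow> real) \<Rightarrow> (nat \<Rightarrow> real) \<Rightarrow> nat \<Rightarrow> real" where
  "weight_loss A C s q = (\<Prod>i=1..num_moduli A.
     (C i * real q ^ (jordan_size A i - 1)) powr (2 * \<bar>s i\<bar>) * (modulus A i ^ q) powr (- 2 * s i))"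

text \<open>
  Half of the geometric decay is spent on the polynomial factor: \<open>x = z ^ Suc k\<close> with
  \<open>z < 1\<close>, and \<open>real q * z ^ q\<close> is bounded.
\<close>

lemma summable_poly_power:
  fixes x :: real assumes "0 \<le> x" "x < 1"
  shows "summable (\<lambda>q. real q ^ k * x ^ q)"
proof -
  define z where "z = root (Suc k) x"
  have z: "0 \<le> z" "z < 1" using assms real_root_lt_1_iff[of "Suc k" x] by (auto simp: z_def real_root_ge_zero)
  have x: "x = z ^ Suc k" unfolding z_def using assms(1) by (intro real_root_pow_pos2[symmetric]) auto
  have "(\<lambda>q. real q * z ^ q) \<longlonglongrightarrow> 0" using z by (intro powser_times_n_limit_0) simp
  then have "Bseq (\<lambda>q. real q * z ^ q)" by (meson convergentI convergent_imp_Bseq)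
  then obtain B where B: "\<And>q. norm (real q * z ^ q) \<le> B" unfolding Bseq_def by blast
  have "real q ^ k * x ^ q \<le> B ^ k * z ^ q" for q
  proof -
    have "real q ^ k * x ^ q = (real q * z ^ q) ^ k * z ^ q"
      by (simp add: x power_mult_distrib power_mult[symmetric] mult_ac)
    also have "\<dots> \<le> B ^ k * z ^ q"
      using B[of q] z by (intro mult_right_mono power_mono) auto
    finally show ?thesis .
  qed
  then show ?thesis using z assms
    by (intro summable_comparison_test[OF _ summable_mult[OF summable_geometric[of z]], of _ "B ^ k"]) auto
qed

locale spectral_bounds =
  fixes A :: "real^'n^'n" and C :: "nat \<Rightarrow> real"
  assumes invertible: "invertible A" and radius: "spec_radius A < 1" and bounds: "block_bounds A C"
begin

lemma block_upper:
  assumes i: "i \<in> {1..num_moduli A}" and q: "q \<ge> 1" and v: "v \<in> spec_space A i"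
  shows "norm (freq A q v) \<le> C i * real q ^ (jordan_size A i - 1) * modulus A i ^ q * norm v"
proof -
  have "norm (matpow (transpose A) q *v v)
      \<le> opnorm_on (spec_space A i) (\<lambda>v. matpow (transpose A) q *v v) * norm v"
    by (rule norm_le_opnorm_on[OF matrix_vector_mul_linear v])
  also have "\<dots> \<le> (C i * real q ^ (jordan_size A i - 1) * modulus A i ^ q) * norm v"
    using bounds i q by (intro mult_right_mono) (auto simp: block_bounds_def simp del: transpose_matrix_vector)
  finally show ?thesis by (simp only: matpow_transpose)
qed

lemma matpow_spec_space:
  "v \<in> spec_space A i \<Longrightarrow> freq A q v \<in> spec_space A i"
proof -
  assume v: "v \<in> spec_space A i"
  have "matpow (transpose A) q *v v \<in> spec_space A i"
    by (induction q) (simp_all add: v spec_space_invariant flip: matrix_vector_mul_assoc del: transpose_matrix_vector)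
  then show ?thesis by (simp only: matpow_transpose)
qed

lemma block_lower:
  assumes i: "i \<in> {1..num_moduli A}" and q: "q \<ge> 1" and v: "v \<in> spec_space A i"
  shows "norm v \<le> C i * real q ^ (jordan_size A i - 1) / modulus A i ^ q * norm (freq A q v)"
proof -
  let ?B = "matrix_inv (transpose A)"
  have inv: "invertible (transpose A)" using invertible by (rule transpose_invertible)
  have "v = matpow ?B q *v (matpow (transpose A) q *v v)"
    by (simp add: matrix_vector_mul_assoc matpow_matrix_inv[OF inv] del: transpose_matrix_vector)
  also have "norm \<dots> \<le> opnorm_on (spec_space A i) (\<lambda>v. matpow ?B q *v v) * norm (matpow (transpose A) q *v v)"
    by (rule norm_le_opnorm_on[OF matrix_vector_mul_linear])
      (simp only: matpow_transpose matpow_spec_space[OF v])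
  also have "\<dots> \<le> (C i * real q ^ (jordan_size A i - 1) / modulus A i ^ q) * norm (matpow (transpose A) q *v v)"
    using bounds i q by (intro mult_right_mono) (auto simp: block_bounds_def simp del: transpose_matrix_vector)
  finally show ?thesis by (simp only: matpow_transpose)
qed

lemma C_ge_1: "i \<in> {1..num_moduli A} \<Longrightarrow> C i \<ge> 1"
  using bounds by (auto simp: block_bounds_def)

text \<open>
  For \<open>s i \<ge> 0\<close> the bound for the inverse is used, for \<open>s i < 0\<close> the one for the matrix itself; a loss
  of the same form comes out in both cases.
\<close>

lemma weight_le_weight_freq:
  assumes q: "q \<ge> 1"
  shows "weight A s \<eta> \<le> weight_loss A C s q * weight A s (freq A q \<eta>)"
  unfolding weight_def weight_loss_def prod.distrib[symmetric]
proof (rule prod_mono, safe)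
  fix i assume i: "i \<in> {1..num_moduli A}"
  let ?v = "spec_proj A i \<eta>"
  let ?D = "C i * real q ^ (jordan_size A i - 1)"
  show "0 \<le> norm ?v powr (2 * s i)" by simp
  have v: "?v \<in> spec_space A i" by (rule spec_proj_in[OF i])
  have L: "modulus A i ^ q > 0" using modulus_pos[OF invertible i] by simp
  have D: "?D > 0" using C_ge_1[OF i] q by (intro mult_pos_pos) auto
  have w: "norm (spec_proj A i (freq A q \<eta>)) = norm (freq A q ?v)" by (simp only: spec_proj_freq[OF i])
  show "norm ?v powr (2 * s i) \<le> ?D powr (2 * \<bar>s i\<bar>) * (modulus A i ^ q) powr (- 2 * s i)
      * norm (spec_proj A i (freq A q \<eta>)) powr (2 * s i)"
  proof (cases "s i \<ge> 0")
    case True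
    have "norm ?v powr (2 * s i) \<le> (?D / modulus A i ^ q * norm (freq A q ?v)) powr (2 * s i)"
      using block_lower[OF i q v] True by (intro powr_mono2) auto
    also have "\<dots> = ?D powr (2 * \<bar>s i\<bar>) * (modulus A i ^ q) powr (- 2 * s i) * norm (freq A q ?v) powr (2 * s i)"
      using D L True by (simp add: powr_mult powr_divide powr_minus_divide del: transpose_matrix_vector)
    finally show ?thesis unfolding w .
  next
    case False
    show ?thesis
    proof (cases "freq A q ?v = 0")
      case True
      then have "?v = 0" using block_lower[OF i q v] by simp
      then show ?thesis by simp
    next
      case nz: False
      have "norm (freq A q ?v) / (?D * modulus A i ^ q) \<le> norm ?v"
        using block_upper[OF i q v] mult_pos_pos[OF D L] by (subst pos_divide_le_eq) (simp_all only: mult_ac)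
      then have "norm ?v powr (2 * s i) \<le> (norm (freq A q ?v) / (?D * modulus A i ^ q)) powr (2 * s i)"
        using nz D L False by (intro powr_mono2') auto
      also have "\<dots> = ?D powr (2 * \<bar>s i\<bar>) * (modulus A i ^ q) powr (- 2 * s i) * norm (freq A q ?v) powr (2 * s i)"
        using D L False by (simp add: powr_mult powr_divide powr_minus divide_simps del: transpose_matrix_vector)
      finally show ?thesis unfolding w .
    qed
  qed
qed

text \<open>
  Jordan blocks have size at most the dimension, which turns the powers of \<open>q\<close> into the exponent of
  the theorem.
\<close>

lemma weight_loss_le:
  assumes q: "q \<ge> 1"
  shows "weight_loss A C s q \<le> (\<Prod>i=1..num_moduli A. C i powr (2 * \<bar>s i\<bar>))
     * real q powr (2 * (real CARD('n) - 1) * (\<Sum>i=1..num_moduli A. \<bar>s i\<bar>))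
     / (\<Prod>i=1..num_moduli A. modulus A i powr (2 * s i)) ^ q"
proof -
  let ?I = "{1..num_moduli A}"
  have "weight_loss A C s q \<le> (\<Prod>i\<in>?I. C i powr (2 * \<bar>s i\<bar>) * real q powr (2 * (real CARD('n) - 1) * \<bar>s i\<bar>)
      * inverse ((modulus A i powr (2 * s i)) ^ q))"
    unfolding weight_loss_def
  proof (rule prod_mono, safe)
    fix i assume i: "i \<in> ?I"
    have L: "modulus A i > 0" using modulus_pos[OF invertible i] .
    have C: "C i \<ge> 1" using C_ge_1[OF i] .
    have "(C i * real q ^ (jordan_size A i - 1)) powr (2 * \<bar>s i\<bar>)
        = C i powr (2 * \<bar>s i\<bar>) * real q powr (real (jordan_size A i - 1) * (2 * \<bar>s i\<bar>))"
      using C q by (simp add: powr_mult powr_powr flip: powr_realpow)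
    also have "\<dots> \<le> C i powr (2 * \<bar>s i\<bar>) * real q powr (2 * (real CARD('n) - 1) * \<bar>s i\<bar>)"
    proof -
      have "real (jordan_size A i - 1) \<le> real (CARD('n) - 1)"
        using jordan_size_le[OF i] by (intro of_nat_mono diff_le_mono)
      also have "\<dots> = real CARD('n) - 1" by (simp add: of_nat_diff Suc_leI)
      finally have "real (jordan_size A i - 1) * (2 * \<bar>s i\<bar>) \<le> (real CARD('n) - 1) * (2 * \<bar>s i\<bar>)"
        by (intro mult_right_mono) auto
      then show ?thesis using q by (intro mult_left_mono powr_mono) (auto simp: mult_ac)
    qed
    finally have 1: "(C i * real q ^ (jordan_size A i - 1)) powr (2 * \<bar>s i\<bar>)
      \<le> C i powr (2 * \<bar>s i\<bar>) * real q powr (2 * (real CARD('n) - 1) * \<bar>s i\<bar>)" .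
    have 2: "(modulus A i ^ q) powr (- 2 * s i) = inverse ((modulus A i powr (2 * s i)) ^ q)"
      using L by (simp add: powr_powr powr_minus mult_ac flip: powr_realpow)
    show "(C i * real q ^ (jordan_size A i - 1)) powr (2 * \<bar>s i\<bar>) * (modulus A i ^ q) powr (- 2 * s i)
      \<le> C i powr (2 * \<bar>s i\<bar>) * real q powr (2 * (real CARD('n) - 1) * \<bar>s i\<bar>) * inverse ((modulus A i powr (2 * s i)) ^ q)"
      unfolding 2 using 1 by (rule mult_right_mono) simp
  qed (auto intro!: mult_nonneg_nonneg)
  also have "\<dots> = (\<Prod>i\<in>?I. C i powr (2 * \<bar>s i\<bar>))
     * (\<Prod>i\<in>?I. real q powr (2 * (real CARD('n) - 1) * \<bar>s i\<bar>))
     / (\<Prod>i\<in>?I. modulus A i powr (2 * s i)) ^ q"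
    by (simp add: prod.distrib prod_inversef prod_power_distrib divide_inverse flip: prod_inversef)
  also have "(\<Prod>i\<in>?I. real q powr (2 * (real CARD('n) - 1) * \<bar>s i\<bar>))
      = real q powr (2 * (real CARD('n) - 1) * (\<Sum>i\<in>?I. \<bar>s i\<bar>))"
    using q by (simp add: powr_sum sum_distrib_left)
  finally show ?thesis .
qed

lemma weight_loss_nonneg: "weight_loss A C s q \<ge> 0"
  unfolding weight_loss_def by (intro prod_nonneg) auto

lemma norm_freq_le:
  assumes q: "q \<ge> 1"
  shows "norm (freq A q v) \<le> (\<Sum>i=1..num_moduli A. C i * onorm (spec_proj A i) * (real q ^ (jordan_size A i - 1) * modulus A i ^ q)) * norm v"
proof -
  let ?I = "{1..num_moduli A}"
  have "freq A q v = freq A q (\<Sum>i=1..num_moduli A. spec_proj A i v)" by (simp only: sum_spec_proj)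
  also have "\<dots> = (\<Sum>i=1..num_moduli A. freq A q (spec_proj A i v))"
    by (rule linear_sum[OF matrix_vector_mul_linear])
  also have "norm \<dots> \<le> (\<Sum>i=1..num_moduli A. C i * onorm (spec_proj A i) * (real q ^ (jordan_size A i - 1) * modulus A i ^ q) * norm v)"
  proof (rule sum_norm_le)
    fix i assume i: "i \<in> ?I"
    have "norm (freq A q (spec_proj A i v)) \<le> C i * real q ^ (jordan_size A i - 1) * modulus A i ^ q * norm (spec_proj A i v)"
      by (rule block_upper[OF i q spec_proj_in[OF i]])
    also have "\<dots> \<le> C i * real q ^ (jordan_size A i - 1) * modulus A i ^ q * (onorm (spec_proj A i) * norm v)"
      using linear_spec_proj[OF i] C_ge_1[OF i] modulus_pos[OF invertible i]
      by (intro mult_left_mono onorm linear_conv_bounded_linear[THEN iffD1]) auto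
    finally show "norm (freq A q (spec_proj A i v)) \<le> C i * onorm (spec_proj A i) * (real q ^ (jordan_size A i - 1) * modulus A i ^ q) * norm v"
      by (simp only: mult_ac)
  qed
  finally show ?thesis by (simp add: sum_distrib_right)
qed

definition growth :: "nat \<Rightarrow> real" where
  "growth q = (\<Sum>i=1..num_moduli A. C i * onorm (spec_proj A i) * (real q ^ (jordan_size A i - 1) * modulus A i ^ q))"

lemma norm_freq_le_growth: "q \<ge> 1 \<Longrightarrow> norm (freq A q v) \<le> growth q * norm v"
  using norm_freq_le unfolding growth_def .

lemma growth_nonneg: "growth q \<ge> 0"
proof -
  have "0 \<le> C i * onorm (spec_proj A i) * (real q ^ (jordan_size A i - 1) * modulus A i ^ q)"
    if i: "i \<in> {1..num_moduli A}" for i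
    using C_ge_1[OF i] modulus_pos[OF invertible i] linear_spec_proj[OF i]
    by (intro mult_nonneg_nonneg onorm_pos_le linear_conv_bounded_linear[THEN iffD1]) auto
  then show ?thesis unfolding growth_def by (intro sum_nonneg)
qed

lemma summable_growth: "summable growth"
  unfolding growth_def
proof (intro summable_sum summable_mult summable_poly_power)
  fix i assume "i \<in> {1..num_moduli A}"
  then show "0 \<le> modulus A i" "modulus A i < 1"
    using modulus_pos[OF invertible] modulus_less_1[OF radius] less_imp_le by blast+
qed

text \<open>
  A matrix and its transpose have the same operator norm, so the growth of the frequencies also
  controls the powers of \<open>A\<close>.
\<close>

lemma summable_onorm_matpow: "summable (\<lambda>q. onorm (\<lambda>v. matpow A q *v v))"
proof (rule summable_comparison_test[OF _ summable_growth], intro exI allI impI)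
  fix q :: nat assume q: "q \<ge> 1"
  let ?M = "matpow A q"
  have "norm (?M *v v) \<le> growth q * norm v" for v
  proof (cases "?M *v v = 0")
    case False
    have "norm (?M *v v) * norm (?M *v v) = inner (?M *v v) (?M *v v)"
      by (simp add: dot_square_norm power2_eq_square)
    also have "\<dots> = inner (freq A q (?M *v v)) v"
      by (simp add: dot_lmul_matrix)
    also have "\<dots> \<le> norm (freq A q (?M *v v)) * norm v" by (rule norm_cauchy_schwarz)
    also have "\<dots> \<le> (growth q * norm (?M *v v)) * norm v"
      by (intro mult_right_mono norm_freq_le_growth q) auto
    finally have "norm (?M *v v) * norm (?M *v v) \<le> (growth q * norm v) * norm (?M *v v)" by (simp only: mult_ac)
    then show ?thesis using False by simp
  qed (simp add: growth_nonneg)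
  then have "onorm (\<lambda>v. ?M *v v) \<le> growth q" by (rule onorm_le)
  then show "norm (onorm (\<lambda>v. ?M *v v)) \<le> growth q"
    using onorm_pos_le[OF matrix_vector_mul_bounded_linear, of ?M] by simp
qed

lemma freq_tendsto_0: "(\<lambda>q. freq A q v) \<longlonglongrightarrow> 0"
proof (rule Lim_null_comparison)
  show "eventually (\<lambda>q. norm (freq A q v) \<le> growth q * norm v) sequentially"
    using norm_freq_le_growth eventually_sequentially by blast
  show "(\<lambda>q. growth q * norm v) \<longlonglongrightarrow> 0"
    using tendsto_mult_right[OF summable_LIMSEQ_zero[OF summable_growth], of "norm v"] by simp
qed

lemma freq_bounded:
  obtains K where "K > 0" "\<And>q v. norm (freq A q v) \<le> K * norm v"
proof -
  have "Bseq growth" using summable_LIMSEQ_zero[OF summable_growth] by (meson convergentI convergent_imp_Bseq)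
  then obtain K where K: "K > 0" "\<And>q. norm (growth q) \<le> K" unfolding Bseq_def by blast
  have "norm (freq A q v) \<le> (K + 1) * norm v" for q v
  proof (cases "q = 0")
    case True
    then show ?thesis using K(1) by (simp add: transpose_mat distrib_right)
  next
    case False
    then have "norm (freq A q v) \<le> growth q * norm v" by (intro norm_freq_le_growth) simp
    also have "\<dots> \<le> (K + 1) * norm v" using K(2)[of q] by (intro mult_right_mono) auto
    finally show ?thesis .
  qed
  then show thesis using that[of "K + 1"] K(1) by simp
qed

end

section \<open>Linear substitution and local integrability\<close>

lemma borel_measurable_matrix_mult [measurable]: "(\<lambda>x. B *v x) \<in> borel_measurable borel"
  for B :: "real^'n^'m"
  by (intro borel_measurable_continuous_onI linear_continuous_on matrix_vector_mul_bounded_linear)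

lemma nn_integral_shear:
  fixes e e' :: "'a::euclidean_space"
  assumes e: "e \<in> Basis" and e': "e' \<in> Basis" "e' \<noteq> e" and [measurable]: "f \<in> borel_measurable borel"
  shows "(\<integral>\<^sup>+x. f (x + (c * inner x e') *\<^sub>R e) \<partial>lborel) = (\<integral>\<^sup>+x. f x \<partial>lborel)"
proof -
  let ?M = "\<lambda>_::'a. lborel :: real measure"
  interpret product_sigma_finite ?M
    by (rule product_sigma_finite.intro) (rule sigma_finite_lborel)
  let ?S = "\<lambda>F. \<Sum>b\<in>Basis. F b *\<^sub>R b :: 'a"
  let ?S' = "\<lambda>F. \<Sum>b\<in>Basis - {e}. F b *\<^sub>R b :: 'a"
  have sumB: "?S F = F e *\<^sub>R e + ?S' F" for F using e by (rule sum.remove[OF finite_Basis])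
  have split: "(\<integral>\<^sup>+x. g x \<partial>lborel) = (\<integral>\<^sup>+F. (\<integral>\<^sup>+y. g (y *\<^sub>R e + ?S' F) \<partial>lborel) \<partial>(\<Pi>\<^sub>M b\<in>Basis - {e}. ?M b))"
    if [measurable]: "g \<in> borel_measurable borel" for g :: "'a \<Rightarrow> ennreal"
  proof -
    have "(\<integral>\<^sup>+x. g x \<partial>lborel) = (\<integral>\<^sup>+F. g (?S F) \<partial>(\<Pi>\<^sub>M b\<in>Basis. ?M b))"
      by (subst lborel_eq) (simp add: nn_integral_distr)
    also have "\<dots> = (\<integral>\<^sup>+F. g (?S F) \<partial>(\<Pi>\<^sub>M b\<in>insert e (Basis - {e}). ?M b))"
      by (simp only: insert_Diff[OF e])
    also have "\<dots> = (\<integral>\<^sup>+F. (\<integral>\<^sup>+y. g (?S (F(e := y))) \<partial>?M e) \<partial>(\<Pi>\<^sub>M b\<in>Basis - {e}. ?M b))"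
      by (rule product_nn_integral_insert) (simp_all add: insert_Diff[OF e])
    also have "\<dots> = (\<integral>\<^sup>+F. (\<integral>\<^sup>+y. g (y *\<^sub>R e + ?S' F) \<partial>?M e) \<partial>(\<Pi>\<^sub>M b\<in>Basis - {e}. ?M b))"
    proof -
      have "?S' (F(e := y)) = ?S' F" for F and y :: real by (intro sum.cong) auto
      then show ?thesis by (simp only: sumB fun_upd_same)
    qed
    finally show ?thesis .
  qed
  have inner: "inner (y *\<^sub>R e + ?S' F) e' = F e'" for y F
    using e e' by (simp add: inner_add_left inner_sum_left inner_Basis if_distrib sum.delta cong: if_cong)
  have shift: "y *\<^sub>R e + ?S' F + t *\<^sub>R e = (t + 1 * y) *\<^sub>R e + ?S' F" for y t F
    by (simp add: scaleR_add_left)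
  have "(\<integral>\<^sup>+y. f (y *\<^sub>R e + ?S' F + (c * (inner (y *\<^sub>R e + ?S' F) e')) *\<^sub>R e) \<partial>lborel)
      = (\<integral>\<^sup>+y. f (y *\<^sub>R e + ?S' F) \<partial>lborel)" for F
    unfolding inner shift
    using nn_integral_real_affine[of "\<lambda>y. f (y *\<^sub>R e + ?S' F)" 1 "c * F e'"] by simp
  then show ?thesis by (subst (1 2) split) simp_all
qed

lemma nn_integral_density_distr_const:
  fixes T :: "'a::euclidean_space \<Rightarrow> 'a"
  assumes "lborel = density (distr lborel borel T) (\<lambda>_. ennreal c)" "f \<in> borel_measurable borel"
    and [measurable]: "T \<in> borel_measurable borel"
  shows "(\<integral>\<^sup>+x. f x \<partial>lborel) = ennreal c * (\<integral>\<^sup>+x. f (T x) \<partial>lborel)"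
proof -
  have [measurable]: "f \<in> borel_measurable borel" by fact
  show ?thesis
    by (subst assms(1)) (simp add: nn_integral_density nn_integral_distr nn_integral_cmult)
qed

lemma prod_Basis_vec: "(\<Prod>b\<in>Basis. inner x b) = (\<Prod>i\<in>UNIV. x $ i)" for x :: "real^'n"
proof -
  have inj: "inj (\<lambda>k::'n. axis k (1::real))" by (auto simp: inj_on_def axis_eq_axis)
  have B: "(Basis :: (real^'n) set) = range (\<lambda>k::'n. axis k (1::real))" by (auto simp: Basis_vec_def)
  show ?thesis by (simp add: B prod.reindex[OF inj] inner_axis)
qed

text \<open>
  Every matrix is a product of elementary ones.  A shear preserves the measure since it acts on one
  coordinate by translations that depend on the other coordinates.
\<close>

lemma nn_integral_matrix:
  fixes B :: "real^'n^'n"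
  assumes "invertible B" and "f \<in> borel_measurable borel"
  shows "(\<integral>\<^sup>+x. f x \<partial>lborel) = ennreal \<bar>det B\<bar> * (\<integral>\<^sup>+x. f (B *v x) \<partial>lborel)"
proof -
  define P where "P = (\<lambda>B :: real^'n^'n. det B \<noteq> 0 \<longrightarrow> (\<forall>f\<in>borel_measurable borel.
      (\<integral>\<^sup>+x. f x \<partial>lborel) = ennreal \<bar>det B\<bar> * (\<integral>\<^sup>+x. f (B *v x) \<partial>lborel)))"
  have "P B"
  proof (rule induct_matrix_elementary[where P = P])
    fix A B :: "real^'n^'n" assume A: "P A" and B: "P B"
    show "P (A ** B)" unfolding P_def
    proof (intro impI ballI)
      fix f :: "real^'n \<Rightarrow> ennreal" assume nz: "det (A ** B) \<noteq> 0" and f[measurable]: "f \<in> borel_measurable borel"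
      have "(\<integral>\<^sup>+x. f x \<partial>lborel) = ennreal \<bar>det A\<bar> * (\<integral>\<^sup>+x. f (A *v x) \<partial>lborel)"
        by (rule A[unfolded P_def, rule_format, OF _ f]) (use nz in \<open>simp add: det_mul\<close>)
      also have "(\<integral>\<^sup>+x. f (A *v x) \<partial>lborel) = ennreal \<bar>det B\<bar> * (\<integral>\<^sup>+x. f (A *v (B *v x)) \<partial>lborel)"
      proof (rule B[unfolded P_def, rule_format])
        show "det B \<noteq> 0" using nz by (simp add: det_mul)
        show "(\<lambda>x. f (A *v x)) \<in> borel_measurable borel" by measurable
      qed
      finally show "(\<integral>\<^sup>+x. f x \<partial>lborel) = ennreal \<bar>det (A ** B)\<bar> * (\<integral>\<^sup>+x. f ((A ** B) *v x) \<partial>lborel)"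
        by (simp add: det_mul abs_mult ennreal_mult' mult.assoc matrix_vector_mul_assoc)
    qed
  next
    fix A :: "real^'n^'n" and i assume "Finite_Cartesian_Product.row i A = 0"
    then show "P A" unfolding P_def using det_zero_row(2)[of i A] by blast
  next
    fix A :: "real^'n^'n" assume A: "\<And>i j. i \<noteq> j \<Longrightarrow> A $ i $ j = 0"
    have det: "det A = (\<Prod>i\<in>UNIV. A $ i $ i)" by (rule det_diagonal[OF A])
    show "P A" unfolding P_def
    proof (intro impI ballI)
      fix f :: "real^'n \<Rightarrow> ennreal" assume nz: "det A \<noteq> 0" and [measurable]: "f \<in> borel_measurable borel"
      let ?e = "\<lambda>k::'n. axis k (1::real)"
      have inj: "inj ?e" by (auto simp: inj_on_def axis_eq_axis)
      have Bs: "(Basis :: (real^'n) set) = range ?e" by (auto simp: Basis_vec_def)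
      let ?c = "\<lambda>b. A $ (inv_into UNIV ?e b) $ (inv_into UNIV ?e b)"
      have T: "0 + (\<Sum>j\<in>Basis. (?c j * inner x j) *\<^sub>R j) = A *v x" for x
      proof -
        have "(\<Sum>j\<in>Basis. (?c j * inner x j) *\<^sub>R j) = (\<Sum>k\<in>UNIV. (A $ k $ k * x $ k) *\<^sub>R ?e k)"
          by (simp add: Bs sum.reindex[OF inj] inv_f_f[OF inj] o_def inner_axis)
        also have "\<dots> = A *v x"
        proof (subst Finite_Cartesian_Product.vec_eq_iff, rule allI)
          fix i
          have "(A *v x) $ i = (\<Sum>j\<in>UNIV. A $ i $ j * x $ j)" by (simp add: matrix_vector_mult_def)
          also have "\<dots> = (\<Sum>j\<in>UNIV. if i = j then A $ i $ i * x $ i else 0)"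
            using A by (intro sum.cong) auto
          finally show "(\<Sum>k\<in>UNIV. (A $ k $ k * x $ k) *\<^sub>R ?e k) $ i = (A *v x) $ i"
            by (simp add: axis_def if_distrib sum.delta cong: if_cong)
        qed
        finally show ?thesis by simp
      qed
      have c: "?c j \<noteq> 0" if "j \<in> Basis" for j
        using nz by (auto simp: det)
      have p: "(\<Prod>j\<in>Basis. \<bar>?c j\<bar>) = \<bar>det A\<bar>"
        by (simp add: Bs prod.reindex[OF inj] inv_f_f[OF inj] o_def det abs_prod)
      have "lborel = density (distr lborel borel (\<lambda>x. A *v x)) (\<lambda>_. ennreal \<bar>det A\<bar>)"
        using lborel_affine_euclidean[of ?c 0, OF c] unfolding T p .
      then show "(\<integral>\<^sup>+x. f x \<partial>lborel) = ennreal \<bar>det A\<bar> * (\<integral>\<^sup>+x. f (A *v x) \<partial>lborel)"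
        by (rule nn_integral_density_distr_const) auto
    qed
  next
    fix m n :: 'n assume mn: "m \<noteq> n"
    let ?t = "Transposition.transpose m n"
    let ?B = "\<chi> i j. mat 1 $ i $ ?t j :: real^'n^'n"
    have app: "(?B *v x) $ i = x $ ?t i" for x i
    proof -
      have "(?B *v x) $ i = (\<Sum>j\<in>UNIV. if j = ?t i then x $ j else 0)"
      proof -
        have "i = ?t j \<longleftrightarrow> j = ?t i" for j by (metis transpose_involutory)
        then show ?thesis
          by (simp add: matrix_vector_mult_def Finite_Cartesian_Product.mat_def if_distrib[of "\<lambda>c. c * _"] cong: if_cong)
      qed
      then show ?thesis by simp
    qed
    have det: "\<bar>det ?B\<bar> = 1"
      by (simp add: det_permute_columns permutes_swap_id sign_swap_id abs_mult)
    have "lborel = distr lborel borel (\<lambda>x. ?B *v x)"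
    proof (rule lborel_eqI)
      fix l u :: "real^'n" assume le: "\<And>b. b \<in> Basis \<Longrightarrow> inner l b \<le> inner u b"
      have le': "l $ i \<le> u $ i" for i using le[of "axis i 1"] by (simp add: inner_axis)
      have "(\<lambda>x. ?B *v x) -` box l u = box (?B *v l) (?B *v u)"
        by (auto simp: mem_box_cart app) (metis transpose_involutory)+
      then have "emeasure (distr lborel borel (\<lambda>x. ?B *v x)) (box l u) = emeasure lborel (box (?B *v l) (?B *v u))"
        by (simp add: emeasure_distr)
      also have "\<dots> = (\<Prod>b\<in>Basis. inner (?B *v u - ?B *v l) b)"
        by (rule emeasure_lborel_box) (auto simp: Basis_vec_def inner_axis app le')
      also have "(\<Prod>b\<in>Basis. inner (?B *v u - ?B *v l) b) = (\<Prod>i\<in>UNIV. (u - l) $ (?t i))"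
        by (simp add: prod_Basis_vec app)
      also have "\<dots> = (\<Prod>i\<in>UNIV. (u - l) $ i)"
        by (rule prod.reindex_bij_betw) (simp add: bij_betw_def)
      also have "\<dots> = (\<Prod>b\<in>Basis. inner (u - l) b)" by (simp add: prod_Basis_vec)
      finally show "emeasure (distr lborel borel (\<lambda>x. ?B *v x)) (box l u) = (\<Prod>b\<in>Basis. inner (u - l) b)" .
    qed simp
    then have "(\<integral>\<^sup>+x. f x \<partial>lborel) = (\<integral>\<^sup>+x. f (?B *v x) \<partial>lborel)" if "f \<in> borel_measurable borel" for f :: "real^'n \<Rightarrow> ennreal"
      using nn_integral_density_distr_const[of "\<lambda>x. ?B *v x" 1 f] that by (simp add: density_1)
    then show "P ?B" unfolding P_def det by (simp only: ennreal_1 mult_1 abs_1) blast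
  next
    fix m n :: 'n and c assume mn: "m \<noteq> n"
    let ?B = "\<chi> i j. if i = m \<and> j = n then c else of_bool (i = j) :: real^'n^'n"
    have B: "?B = (\<chi> k. if k = m then Finite_Cartesian_Product.row m (mat 1) + c *s Finite_Cartesian_Product.row n (mat 1)
        else Finite_Cartesian_Product.row k (mat 1))"
      using mn by (auto simp: Finite_Cartesian_Product.vec_eq_iff Finite_Cartesian_Product.row_def
          Finite_Cartesian_Product.mat_def)
    have det: "det ?B = 1" unfolding B using det_row_operation[OF mn, of "mat 1" c] by simp
    have app: "?B *v x = x + (c * (inner x (axis n 1))) *\<^sub>R axis m 1" for x
    proof (subst Finite_Cartesian_Product.vec_eq_iff, rule allI)
      fix i
      have "(?B *v x) $ i = (\<Sum>j\<in>UNIV. (if j = i then x $ j else 0) + (if j = n then (if i = m then c * x $ j else 0) else 0))"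
      proof -
        have "?B $ i $ j * x $ j = (if j = i then x $ j else 0) + (if j = n then (if i = m then c * x $ j else 0) else 0)" for j
          using mn by auto
        then show ?thesis unfolding matrix_vector_mult_def by simp
      qed
      also have "\<dots> = x $ i + (if i = m then c * x $ n else 0)"
        by (simp add: sum.distrib)
      finally have b: "(?B *v x) $ i = x $ i + (if i = m then c * x $ n else 0)" .
      then show "(?B *v x) $ i = (x + (c * (inner x (axis n 1))) *\<^sub>R axis m 1) $ i"
      proof -
        have "inner x (axis n 1) = x $ n" by (simp add: inner_axis)
        with b show ?thesis by (simp add: axis_def)
      qed
    qed
    have "(\<integral>\<^sup>+x. f x \<partial>lborel) = (\<integral>\<^sup>+x. f (?B *v x) \<partial>lborel)" if "f \<in> borel_measurable borel" for f :: "real^'n \<Rightarrow> ennreal"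
      unfolding app by (rule nn_integral_shear[symmetric]) (use mn that in \<open>auto simp: axis_eq_axis axis_in_Basis_iff\<close>)
    then show "P ?B" unfolding P_def det by (simp only: ennreal_1 mult_1 abs_1) blast
  qed
  then have PB: "det B \<noteq> 0 \<longrightarrow> (\<forall>f\<in>borel_measurable borel.
      (\<integral>\<^sup>+x. f x \<partial>lborel) = ennreal \<bar>det B\<bar> * (\<integral>\<^sup>+x. f (B *v x) \<partial>lborel))"
    unfolding P_def .
  have nz: "det B \<noteq> 0" using assms(1) invertible_det_nz by blast
  show ?thesis by (rule bspec[OF mp[OF PB nz] assms(2)])
qed

text \<open>The condition \<open>a > -1\<close> is the one-dimensional form of \<open>s_i > - d_i / 2\<close>.\<close>

lemma nn_integral_abs_powr_finite:
  fixes a R :: real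
  assumes a: "a > -1"
  shows "(\<integral>\<^sup>+t. ennreal (\<bar>t\<bar> powr a) * indicator {-R..R} t \<partial>lborel) < \<infinity>"
proof (cases "R \<ge> 0")
  case False
  then have "{-R..R} = {}" by auto
  then show ?thesis by simp
next
  case True
  let ?h = "\<lambda>t::real. ennreal (t powr a) * indicator {0..R} t"
  have fin: "(\<integral>\<^sup>+t. ?h t \<partial>lborel) < \<infinity>"
    by (subst nn_integral_has_integral_lebesgue'[OF _ has_integral_powr_from_0[OF a True]]) auto
  have "(\<integral>\<^sup>+t. ennreal (\<bar>t\<bar> powr a) * indicator {-R..R} t \<partial>lborel) \<le> (\<integral>\<^sup>+t. ?h t + ?h (- t) \<partial>lborel)"
    by (rule nn_integral_mono) (auto simp: indicator_def abs_if)
  also have "\<dots> = (\<integral>\<^sup>+t. ?h t \<partial>lborel) + (\<integral>\<^sup>+t. ?h (- t) \<partial>lborel)"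
    by (rule nn_integral_add) auto
  also have "(\<integral>\<^sup>+t. ?h (- t) \<partial>lborel) = (\<integral>\<^sup>+t. ?h t \<partial>lborel)"
    using nn_integral_real_affine[of ?h "-1" 0] by simp
  finally show ?thesis
    by (rule order.strict_trans1) (use fin in \<open>simp add: less_top[symmetric]\<close>)
qed

lemma nn_integral_vec_prod:
  fixes f :: "'n::finite \<Rightarrow> real \<Rightarrow> ennreal"
  assumes [measurable]: "\<And>k. f k \<in> borel_measurable borel"
  shows "(\<integral>\<^sup>+y. (\<Prod>k\<in>UNIV. f k (y $ k)) \<partial>(lborel :: (real^'n) measure)) = (\<Prod>k\<in>UNIV. (\<integral>\<^sup>+t. f k t \<partial>lborel))"
proof -
  let ?e = "\<lambda>k::'n. axis k (1::real)"
  have inj: "inj ?e" by (auto simp: inj_on_def axis_eq_axis)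
  have B: "(Basis :: (real^'n) set) = range ?e" by (auto simp: Basis_vec_def)
  let ?F = "\<lambda>b. f (inv_into UNIV ?e b)"
  have "(\<integral>\<^sup>+y. (\<Prod>b\<in>Basis. ?F b (inner y b)) \<partial>lborel) = (\<Prod>b\<in>Basis. (\<integral>\<^sup>+t. ?F b t \<partial>lborel))"
    by (rule nn_integral_lborel_prod) auto
  then show ?thesis
    by (simp add: B prod.reindex[OF inj] inv_f_f[OF inj] o_def inner_axis)
qed

lemma spec_proj_spec_space:
  fixes A :: "real^'n^'n"
  assumes "i \<in> {1..num_moduli A}" "j \<in> {1..num_moduli A}" "v \<in> spec_space A j"
  shows "spec_proj A i v = (if i = j then v else 0)"
proof (rule spec_proj_eqI[where u = "\<lambda>i. if i = j then v else 0", OF _ _ assms(1)])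
  show "(if i = j then v else 0) \<in> spec_space A i" if "i \<in> {1..num_moduli A}" for i
    using assms(3) subspace_0[OF subspace_spec_space] by auto
  show "v = (\<Sum>i=1..num_moduli A. if i = j then v else 0)"
    using assms(2) by (subst sum.delta) auto
qed

lemma weight_measurable [measurable]:
  fixes A :: "real^'n^'n"
  shows "weight A s \<in> borel_measurable borel"
proof -
  have "spec_proj A i \<in> borel_measurable borel" if "i \<in> {1..num_moduli A}" for i
    using linear_spec_proj[OF that]
    by (intro borel_measurable_continuous_onI linear_continuous_on) (rule linear_conv_bounded_linear[THEN iffD1])
  then show ?thesis unfolding weight_def by measurable
qed

lemma weight_nonneg: "weight A s \<eta> \<ge> 0"
  unfolding weight_def by (intro prod_nonneg) auto

text \<open>
  Coordinates \<open>y\<close> in a basis that is the union of bases of the spectral spaces; \<open>\<iota>\<close> tells to which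
  space a coordinate belongs.
\<close>

lemma adapted_coordinates:
  fixes A :: "real^'n^'n"
  obtains P :: "real^'n^'n" and \<iota> :: "'n \<Rightarrow> nat" and K :: real
  where "invertible P" "K > 0"
    "\<And>k. \<iota> k \<in> {1..num_moduli A}"
    "\<And>i. i \<in> {1..num_moduli A} \<Longrightarrow> card {k. \<iota> k = i} = dim (spec_space A i)"
    "\<And>k y. \<bar>y $ k\<bar> \<le> K * norm (spec_proj A (\<iota> k) (P *v y))"
    "\<And>k y. \<bar>y $ k\<bar> \<le> K * norm (P *v y)"
proof -
  let ?I = "{1..num_moduli A}"
  have "\<exists>B. B \<subseteq> spec_space A i \<and> independent B \<and> spec_space A i \<subseteq> span B \<and> card B = dim (spec_space A i)" for i
    using basis_exists[of "spec_space A i"] by metis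
  then obtain B where B: "\<And>i. B i \<subseteq> spec_space A i" "\<And>i. independent (B i)"
      "\<And>i. spec_space A i \<subseteq> span (B i)" "\<And>i. card (B i) = dim (spec_space A i)" by metis
  have finB: "finite (B i)" for i using B(2) independent_bound by blast
  have proj: "spec_proj A i b = (if i = j then b else 0)" if "i \<in> ?I" "j \<in> ?I" "b \<in> B j" for i j b
    using spec_proj_spec_space that B(1) by blast
  have disj: "i = j" if "i \<in> ?I" "j \<in> ?I" "b \<in> B i" "b \<in> B j" for i j b
  proof (rule ccontr)
    assume "i \<noteq> j"
    then have "b = 0" using proj[OF that(1,1,3)] proj[OF that(1,2,4)] by simp
    then show False using B(2)[of i] that(3) dependent_zero by blast
  qed
  define BB where "BB = (\<Union>i\<in>?I. B i)"
  have finBB: "finite BB" using finB by (simp add: BB_def)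
  have proj_sum: "spec_proj A i (\<Sum>b\<in>BB. c b *\<^sub>R b) = (\<Sum>b\<in>B i. c b *\<^sub>R b)" if i: "i \<in> ?I" for i c
  proof -
    have "spec_proj A i (\<Sum>b\<in>BB. c b *\<^sub>R b) = (\<Sum>b\<in>BB. c b *\<^sub>R spec_proj A i b)"
      by (simp only: linear_sum[OF linear_spec_proj[OF i]] linear_scale[OF linear_spec_proj[OF i]])
    also have "\<dots> = (\<Sum>b\<in>B i. c b *\<^sub>R b)"
    proof (rule sum.mono_neutral_cong_right[OF finBB])
      show "B i \<subseteq> BB" using i by (auto simp: BB_def)
      show "\<forall>b\<in>BB - B i. c b *\<^sub>R spec_proj A i b = 0"
      proof
        fix b assume "b \<in> BB - B i"
        then obtain j where "j \<in> ?I" "b \<in> B j" "i \<noteq> j" unfolding BB_def by blast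
        then show "c b *\<^sub>R spec_proj A i b = 0" using proj[OF i] by simp
      qed
      show "c b *\<^sub>R spec_proj A i b = c b *\<^sub>R b" if "b \<in> B i" for b using proj[OF i i that] by simp
    qed
    finally show ?thesis .
  qed
  have indep: "independent BB"
  proof (rule independent_if_scalars_zero[OF finBB])
    fix c b assume z: "(\<Sum>b\<in>BB. c b *\<^sub>R b) = 0" and b: "b \<in> BB"
    then obtain i where i: "i \<in> ?I" "b \<in> B i" by (auto simp: BB_def)
    have "(\<Sum>b\<in>B i. c b *\<^sub>R b) = 0"
      using proj_sum[OF i(1), of c] z linear_0[OF linear_spec_proj[OF i(1)]] by simp
    then show "c b = 0" using B(2)[of i] i(2) finB[of i] by (auto simp: dependent_finite)
  qed
  have "span BB = UNIV"
  proof -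
    have "v \<in> span BB" for v
    proof -
      have "spec_proj A i v \<in> span BB" if "i \<in> ?I" for i
        using spec_proj_in[OF that] B(3)[of i] span_mono[of "B i" BB] that unfolding BB_def by blast
      then have "(\<Sum>i=1..num_moduli A. spec_proj A i v) \<in> span BB" by (rule span_sum)
      then show ?thesis by (simp only: sum_spec_proj)
    qed
    then show ?thesis by blast
  qed
  then have "card BB = CARD('n)"
    using basis_card_eq_dim[of BB UNIV] indep by simp
  then have "\<exists>\<sigma>. bij_betw \<sigma> (UNIV :: 'n set) BB"
    by (intro finite_same_card_bij finBB) simp_all
  then obtain \<sigma> where \<sigma>: "bij_betw \<sigma> (UNIV :: 'n set) BB" by blast
  define \<iota> where "\<iota> = (\<lambda>k. SOME i. i \<in> ?I \<and> \<sigma> k \<in> B i)"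
  have \<iota>: "\<iota> k \<in> ?I \<and> \<sigma> k \<in> B (\<iota> k)" for k
  proof -
    have "\<exists>i. i \<in> ?I \<and> \<sigma> k \<in> B i" using bij_betwE[OF \<sigma>] unfolding BB_def by blast
    from someI_ex[OF this] show ?thesis unfolding \<iota>_def .
  qed
  have \<iota>_iff: "\<iota> k = i \<longleftrightarrow> \<sigma> k \<in> B i" if "i \<in> ?I" for i k
    using \<iota>[of k] disj that by blast
  define P :: "real^'n^'n" where "P = (\<chi> r k. \<sigma> k $ r)"
  have P: "P *v y = (\<Sum>k\<in>UNIV. y $ k *\<^sub>R \<sigma> k)" for y
    by (simp add: P_def matrix_vector_mult_def Finite_Cartesian_Product.vec_eq_iff mult.commute)
  have sums: "(\<Sum>k\<in>UNIV. g k (\<sigma> k)) = (\<Sum>b\<in>BB. g (inv_into UNIV \<sigma> b) b)" for g :: "'n \<Rightarrow> real^'n \<Rightarrow> real^'n"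
    using sum.reindex_bij_betw[OF \<sigma>, of "\<lambda>b. g (inv_into UNIV \<sigma> b) b"] \<sigma>
    by (simp add: bij_betw_def)
  have ker: "y = 0" if "P *v y = 0" for y
  proof -
    have "(\<Sum>b\<in>BB. y $ (inv_into UNIV \<sigma> b) *\<^sub>R b) = 0"
      using that sums[of "\<lambda>k b. y $ k *\<^sub>R b"] by (simp add: P)
    then have "y $ (inv_into UNIV \<sigma> b) = 0" if "b \<in> BB" for b
      using indep finBB that by (auto simp: dependent_finite)
    from this[of "\<sigma> _"] have "y $ k = 0" for k
      using \<sigma> bij_betwE[OF \<sigma>] by (auto simp: bij_betw_def)
    then show ?thesis by (simp add: Finite_Cartesian_Product.vec_eq_iff)
  qed
  have inv: "invertible P"
    using ker matrix_left_invertible_ker invertible_left_inverse by blast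
  then obtain V where V: "V ** P = mat 1" using invertible_left_inverse by blast
  define K where "K = onorm (\<lambda>v. V *v v) + 1"
  have K: "K > 0" unfolding K_def using onorm_pos_le[OF matrix_vector_mul_bounded_linear, of V] by simp
  have coord: "\<bar>y $ k\<bar> \<le> K * norm (P *v y)" for k y
  proof -
    have "\<bar>y $ k\<bar> \<le> norm y" by (rule component_le_norm_cart)
    also have "norm y = norm (V *v (P *v y))" by (simp add: matrix_vector_mul_assoc V)
    also have "\<dots> \<le> onorm (\<lambda>v. V *v v) * norm (P *v y)" by (rule onorm[OF matrix_vector_mul_bounded_linear])
    also have "\<dots> \<le> K * norm (P *v y)" by (intro mult_right_mono) (auto simp: K_def)
    finally show ?thesis .
  qed
  have block: "spec_proj A i (P *v y) = P *v (\<chi> k. if \<iota> k = i then y $ k else 0)" if i: "i \<in> ?I" for i y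
  proof -
    have "spec_proj A i (P *v y) = (\<Sum>k\<in>UNIV. y $ k *\<^sub>R spec_proj A i (\<sigma> k))"
      by (simp only: P linear_sum[OF linear_spec_proj[OF i]] linear_scale[OF linear_spec_proj[OF i]])
    also have "\<dots> = (\<Sum>k\<in>UNIV. (if \<iota> k = i then y $ k else 0) *\<^sub>R \<sigma> k)"
    proof (rule sum.cong[OF refl])
      fix k
      show "y $ k *\<^sub>R spec_proj A i (\<sigma> k) = (if \<iota> k = i then y $ k else 0) *\<^sub>R \<sigma> k"
        using proj[OF i, of "\<iota> k" "\<sigma> k"] \<iota>[of k] by auto
    qed
    finally show ?thesis by (simp add: P)
  qed
  have "\<bar>y $ k\<bar> \<le> K * norm (spec_proj A (\<iota> k) (P *v y))" for k y
    using coord[of "\<chi> j. if \<iota> j = \<iota> k then y $ j else 0" k] \<iota>[of k] by (simp add: block)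
  moreover have "card {k. \<iota> k = i} = dim (spec_space A i)" if i: "i \<in> ?I" for i
  proof -
    have "\<sigma> ` {k. \<iota> k = i} = B i"
      using \<iota>_iff[OF i] bij_betw_imp_surj_on[OF \<sigma>] i unfolding BB_def by fastforce
    moreover have "inj_on \<sigma> {k. \<iota> k = i}" using \<sigma> by (auto simp: bij_betw_def inj_on_def)
    ultimately have "card {k. \<iota> k = i} = card (B i)" using card_image by fastforce
    then show ?thesis by (simp add: B(4))
  qed
  ultimately show thesis using that[OF inv K] \<iota> coord by blast
qed

text \<open>
  A negative power of \<open>norm y\<close> in a space of dimension \<open>d\<close> is at most the product of the \<open>d\<close>-th roots
  of the same power of the coordinates; the exponents \<open>2 s / d\<close> of these are greater than \<open>- 1\<close>.
\<close>

lemma weight_locally_integrable: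
  fixes A :: "real^'n^'n"
  assumes s: "\<And>i. i \<in> {1..num_moduli A} \<Longrightarrow> s i > - real (dim (spec_space A i)) / 2"
  shows "(\<integral>\<^sup>+\<eta>. ennreal (weight A s \<eta>) * indicator {\<eta>. norm \<eta> \<le> R} \<eta> \<partial>lborel) < \<infinity>"
proof -
  let ?I = "{1..num_moduli A}"
  obtain P :: "real^'n^'n" and \<iota> :: "'n \<Rightarrow> nat" and K :: real
    where P: "invertible P" and K: "K > 0" and \<iota>: "\<And>k. \<iota> k \<in> ?I"
    and card: "\<And>i. i \<in> ?I \<Longrightarrow> card {k. \<iota> k = i} = dim (spec_space A i)"
    and block: "\<And>k y. \<bar>y $ k\<bar> \<le> K * norm (spec_proj A (\<iota> k) (P *v y))"
    and coord: "\<And>k y. \<bar>y $ k\<bar> \<le> K * norm (P *v y)"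
    using adapted_coordinates[where A = A] by metis
  define d where "d = (\<lambda>i. real (dim (spec_space A i)))"
  have d: "d i > 0" if i: "i \<in> ?I" for i
  proof -
    obtain v where "v \<in> spec_space A i" "v \<noteq> 0" using spec_space_nontrivial[OF i] by blast
    then show ?thesis unfolding d_def by (auto simp: dim_eq_0 neq0_conv[symmetric] simp del: neq0_conv)
  qed
  define R' where "R' = K * \<bar>R\<bar>"
  define Q where "Q = (\<Sum>i\<in>?I. onorm (spec_proj A i)) * \<bar>R\<bar> + 1"
  have bl: "bounded_linear (spec_proj A i)" if "i \<in> ?I" for i
    by (rule linear_conv_bounded_linear[THEN iffD1, OF linear_spec_proj[OF that]])
  have Q: "norm (spec_proj A i \<eta>) \<le> Q" if i: "i \<in> ?I" and "norm \<eta> \<le> R" for i \<eta>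
  proof -
    have "norm (spec_proj A i \<eta>) \<le> onorm (spec_proj A i) * norm \<eta>" by (rule onorm[OF bl[OF i]])
    also have "\<dots> \<le> (\<Sum>i\<in>?I. onorm (spec_proj A i)) * \<bar>R\<bar>"
      using i that(2) onorm_pos_le[OF bl]
      by (intro mult_mono member_le_sum sum_nonneg) auto
    finally show ?thesis by (simp add: Q_def)
  qed
  have Q0: "Q > 0" unfolding Q_def
    using onorm_pos_le[OF bl] by (intro add_nonneg_pos mult_nonneg_nonneg sum_nonneg) auto
  define g where "g = (\<lambda>k t. if s (\<iota> k) \<ge> 0 then Q powr (2 * s (\<iota> k) / d (\<iota> k))
      else (\<bar>t\<bar> / K) powr (2 * s (\<iota> k) / d (\<iota> k)))"
  define f where "f = (\<lambda>k t. (if t = 0 then \<top> else ennreal (g k t)) * indicator {-R'..R'} t)"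
  have [measurable]: "f k \<in> borel_measurable borel" for k unfolding f_def g_def by measurable
  have g0: "g k t > 0" if "t \<noteq> 0" for k t using that K Q0 by (auto simp: g_def)
  have fin: "(\<integral>\<^sup>+t. f k t \<partial>lborel) < \<infinity>" for k
  proof -
    have "(\<integral>\<^sup>+t. f k t \<partial>lborel) = (\<integral>\<^sup>+t. ennreal (g k t) * indicator {-R'..R'} t \<partial>lborel)"
      by (rule nn_integral_cong_AE, rule AE_mp[OF AE_lborel_singleton[of 0]]) (auto simp: f_def)
    also have "\<dots> < \<infinity>"
    proof (cases "s (\<iota> k) \<ge> 0")
      case True
      then show ?thesis by (simp add: g_def nn_integral_cmult ennreal_mult_less_top emeasure_lborel_Icc_eq)
    next
      case False
      let ?a = "2 * s (\<iota> k) / d (\<iota> k)"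
      have "?a > -1" using s[OF \<iota>[of k]] d[OF \<iota>[of k]] by (simp add: d_def field_simps)
      then have fin: "(\<integral>\<^sup>+t. ennreal (\<bar>t\<bar> powr ?a) * indicator {-R'..R'} t \<partial>lborel) < \<infinity>"
        by (rule nn_integral_abs_powr_finite)
      have "(\<integral>\<^sup>+t. ennreal (g k t) * indicator {-R'..R'} t \<partial>lborel)
          = (\<integral>\<^sup>+t. ennreal (K powr (- ?a)) * (ennreal (\<bar>t\<bar> powr ?a) * indicator {-R'..R'} t) \<partial>lborel)"
      proof (rule nn_integral_cong)
        fix t
        have "g k t = K powr (- ?a) * \<bar>t\<bar> powr ?a"
          using False K by (simp add: g_def powr_divide powr_minus_divide)
        then show "ennreal (g k t) * indicator {-R'..R'} t
            = ennreal (K powr (- ?a)) * (ennreal (\<bar>t\<bar> powr ?a) * indicator {-R'..R'} t)"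
          by (simp add: ennreal_mult' mult.assoc)
      qed
      also have "\<dots> = ennreal (K powr (- ?a)) * (\<integral>\<^sup>+t. ennreal (\<bar>t\<bar> powr ?a) * indicator {-R'..R'} t \<partial>lborel)"
        by (rule nn_integral_cmult) measurable
      finally show ?thesis using fin by (simp add: ennreal_mult_less_top)
    qed
    finally show ?thesis .
  qed
  have le: "ennreal (weight A s (P *v y)) * indicator {\<eta>. norm \<eta> \<le> R} (P *v y) \<le> (\<Prod>k\<in>UNIV. f k (y $ k))" for y
  proof (cases "norm (P *v y) \<le> R")
    case True
    have ind: "y $ k \<in> {-R'..R'}" for k
    proof -
      have "\<bar>y $ k\<bar> \<le> K * norm (P *v y)" by (rule coord)
      also have "\<dots> \<le> R'" unfolding R'_def using K True by (intro mult_left_mono) auto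
      finally show ?thesis by auto
    qed
    show ?thesis
    proof (cases "\<exists>k. y $ k = 0")
      case z: True
      then obtain k where k: "y $ k = 0" by blast
      have "f j (y $ j) \<noteq> 0" for j
        using ind[of j] g0[of "y $ j" j] by (auto simp: f_def)
      then have "(\<Prod>j\<in>UNIV - {k}. f j (y $ j)) \<noteq> 0" by simp
      moreover have "f k (y $ k) = \<top>" using ind[of k] k by (simp add: f_def)
      ultimately have "(\<Prod>k\<in>UNIV. f k (y $ k)) = \<top>"
        by (subst prod.remove[of _ k]) (auto simp: ennreal_top_mult)
      then show ?thesis by simp
    next
      case nz: False
      have "norm (spec_proj A i (P *v y)) powr (2 * s i) \<le> (\<Prod>k\<in>{k. \<iota> k = i}. g k (y $ k))" if i: "i \<in> ?I" for i
      proof -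
        let ?v = "spec_proj A i (P *v y)"
        have v0: "norm ?v powr (2 * s i) = (norm ?v powr (2 * s i / d i)) ^ dim (spec_space A i)"
          using d[OF i] by (cases "?v = 0") (simp_all add: powr_realpow[symmetric] powr_powr d_def del: dim_eq_0)
        also have "\<dots> = (\<Prod>k\<in>{k. \<iota> k = i}. norm ?v powr (2 * s i / d i))" by (simp add: card[OF i])
        also have "\<dots> \<le> (\<Prod>k\<in>{k. \<iota> k = i}. g k (y $ k))"
        proof (rule prod_mono, safe)
          fix k assume k: "i = \<iota> k"
          show "norm (spec_proj A (\<iota> k) (P *v y)) powr (2 * s (\<iota> k) / d (\<iota> k)) \<le> g k (y $ k)"
          proof (cases "s (\<iota> k) \<ge> 0")
            case True
            then show ?thesis using Q[OF \<iota> \<open>norm (P *v y) \<le> R\<close>] d[OF \<iota>, of k]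
              by (auto simp: g_def intro!: powr_mono2)
          next
            case False
            have "\<bar>y $ k\<bar> / K \<le> norm (spec_proj A (\<iota> k) (P *v y))"
              using block[of y k] K by (simp add: divide_le_eq mult.commute)
            then show ?thesis using False nz K d[OF \<iota>, of k]
              by (auto simp: g_def divide_nonpos_pos intro!: powr_mono2')
          qed
        qed simp
        finally show ?thesis .
      qed
      then have "weight A s (P *v y) \<le> (\<Prod>i\<in>?I. \<Prod>k\<in>{k. \<iota> k = i}. g k (y $ k))"
        unfolding weight_def by (intro prod_mono) auto
      also have "\<dots> = (\<Prod>k\<in>UNIV. g k (y $ k))"
      proof -
        have "range \<iota> \<subseteq> ?I" using \<iota> by blast
        then show ?thesis using prod.group[of UNIV ?I \<iota> "\<lambda>k. g k (y $ k)"] by simp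
      qed
      finally have "ennreal (weight A s (P *v y)) \<le> ennreal (\<Prod>k\<in>UNIV. g k (y $ k))" by (rule ennreal_leI)
      also have "\<dots> = (\<Prod>k\<in>UNIV. ennreal (g k (y $ k)))"
        using nz by (intro prod_ennreal[symmetric]) (auto intro: less_imp_le[OF g0])
      also have "\<dots> = (\<Prod>k\<in>UNIV. f k (y $ k))" using nz ind by (intro prod.cong) (auto simp: f_def)
      finally show ?thesis by (simp add: True)
    qed
  qed simp
  have "(\<integral>\<^sup>+\<eta>. ennreal (weight A s \<eta>) * indicator {\<eta>. norm \<eta> \<le> R} \<eta> \<partial>lborel)
      = ennreal \<bar>det P\<bar> * (\<integral>\<^sup>+y. ennreal (weight A s (P *v y)) * indicator {\<eta>. norm \<eta> \<le> R} (P *v y) \<partial>lborel)"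
    by (rule nn_integral_matrix[OF P]) measurable
  also have "\<dots> \<le> ennreal \<bar>det P\<bar> * (\<integral>\<^sup>+y. (\<Prod>k\<in>UNIV. f k (y $ k)) \<partial>lborel)"
    by (intro mult_left_mono nn_integral_mono le) auto
  also have "\<dots> = ennreal \<bar>det P\<bar> * (\<Prod>k\<in>UNIV. (\<integral>\<^sup>+t. f k t \<partial>lborel))"
    by (subst nn_integral_vec_prod) auto
  also have "\<dots> < \<infinity>"
  proof -
    have "(\<Prod>k\<in>S. (\<integral>\<^sup>+t. f k t \<partial>lborel)) < \<top>" if "finite S" for S
      using that fin by induction (auto simp: ennreal_mult_less_top)
    then show ?thesis by (simp add: ennreal_mult_less_top)
  qed
  finally show ?thesis .
qed

section \<open>Words and inverse branches\<close>

lemma words_0 [simp]: "words l 0 = {[]}"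
  by (auto simp: words_def)

lemma words_Suc: "words l (Suc n) = (\<lambda>(k, w). k # w) ` ({1..l} \<times> words l n)"
  by (auto simp: words_def length_Suc_conv image_iff)

lemma finite_words [simp]: "finite (words l n)"
  by (induction n) (auto simp: words_Suc)

lemma length_words: "w \<in> words l n \<Longrightarrow> length w = n"
  by (simp add: words_def)

lemma sum_words_Suc: "(\<Sum>w\<in>words l (Suc n). h w) = (\<Sum>k=1..l. \<Sum>w\<in>words l n. h (k # w))"
proof -
  have "inj_on (\<lambda>(k, w). k # w) ({1..l} \<times> words l n)" by (auto simp: inj_on_def)
  then show ?thesis unfolding words_Suc
    by (subst sum.reindex) (auto simp: sum.cartesian_product case_prod_beta)
qed

lemma sum_words_append:
  "(\<Sum>w\<in>words l (n + m). h w) = (\<Sum>a\<in>words l n. \<Sum>u\<in>words l m. h (a @ u))"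
  by (induction n arbitrary: h) (simp_all only: add_0 add_Suc sum_words_Suc, simp_all)

lemma card_words: "card (words l n) = l ^ n"
proof (induction n)
  case (Suc n)
  have "card (words l (Suc n)) = (\<Sum>w\<in>words l (Suc n). 1)" by simp
  also have "\<dots> = l * l ^ n" unfolding sum_words_Suc using Suc by simp
  finally show ?case by simp
qed simp

text \<open>
  The affine inverse branch, on the whole real line.  The first letter acts first, so that a prefix of
  the word belongs to a lower iterate of \<open>\<tau>\<close>.
\<close>

primrec branch :: "nat \<Rightarrow> nat list \<Rightarrow> real \<Rightarrow> real" where
  "branch l [] x = x"
| "branch l (k # w) x = branch l w ((x + real k - 1) / real l)"

lemma branch_append: "branch l (a @ u) x = branch l u (branch l a x)"
  by (induction a arbitrary: x) auto

lemma branch_affine: "branch l w x = branch l w 0 + x / real l ^ length w"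
proof (induction w arbitrary: x)
  case (Cons k w)
  show ?case
  proof (cases "l = 0")
    case False
    then show ?thesis
      using Cons.IH[of "(x + real k - 1) / real l"] Cons.IH[of "(0 + real k - 1) / real l"]
      by (simp add: add_divide_distrib diff_divide_distrib power_Suc2 del: power_Suc)
  qed simp
qed simp

lemma branch_deriv: "(branch l w has_vector_derivative 1 / real l ^ length w) (at x)"
proof -
  have "((\<lambda>x. branch l w 0 + x / real l ^ length w) has_vector_derivative 1 / real l ^ length w) (at x)"
    unfolding has_real_derivative_iff_has_vector_derivative[symmetric] divide_inverse
    by (auto intro!: derivative_eq_intros)
  moreover have "branch l w = (\<lambda>x. branch l w 0 + x / real l ^ length w)"
    by (rule ext) (rule branch_affine)
  ultimately show ?thesis by (simp only:)
qed

lemma continuous_on_branch: "continuous_on X (branch l w)"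
  using branch_deriv by (intro continuous_at_imp_continuous_on) (blast intro: has_vector_derivative_continuous)

lemma \<tau>_range: "\<tau> l x \<in> circle"
  by (simp add: \<tau>_def circle_def frac_lt_1)

lemma step_branch:
  assumes l: "l \<ge> 1" and x: "x \<in> circle" and k: "k \<in> {1..l}"
  shows "(x + real k - 1) / real l \<in> circle \<inter> part l k" "\<tau> l ((x + real k - 1) / real l) = x"
proof -
  have "x + real k - 1 < real l" "0 \<le> x + real k - 1" using x k by (auto simp: circle_def)
  then show "(x + real k - 1) / real l \<in> circle \<inter> part l k"
    using l x by (auto simp: circle_def part_def divide_simps)
  have "real l * ((x + real k - 1) / real l) = x + real_of_int (int k - 1)" using l by simp
  then have "\<tau> l ((x + real k - 1) / real l) = frac (x + real_of_int (int k - 1))"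
    unfolding \<tau>_def by (simp only:)
  also have "\<dots> = x" using x by (simp add: frac_def circle_def floor_unique[of 0])
  finally show "\<tau> l ((x + real k - 1) / real l) = x" .
qed

lemma part_\<tau>:
  assumes l: "l \<ge> 1" and z: "z \<in> part l k"
  shows "z = (\<tau> l z + real k - 1) / real l"
proof -
  have "real k - 1 \<le> real l * z" "real l * z < real k"
    using z l by (auto simp: part_def divide_simps mult.commute)
  then have "floor (real l * z) = int k - 1" by (intro floor_unique) auto
  then have "\<tau> l z = real l * z - (real k - 1)" by (simp add: \<tau>_def frac_def)
  then show ?thesis using l by simp
qed

lemma nth_Cons_shift: "j < length w \<Longrightarrow> (k # w) ! (length (k # w) - j - 1) = w ! (length w - j - 1)"
  by (simp add: nth_Cons' Suc_diff_Suc)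

lemma cyl_Cons: "y \<in> cyl l (k # w) \<longleftrightarrow> y \<in> cyl l w \<and> (\<tau> l ^^ length w) y \<in> part l k"
  unfolding cyl_def by (auto simp: less_Suc_eq nth_Cons_shift simp del: One_nat_def)

lemma branch_in_cyl:
  assumes l: "l \<ge> 1" and "set w \<subseteq> {1..l}" "x \<in> circle"
  shows "branch l w x \<in> cyl l w \<and> (\<tau> l ^^ length w) (branch l w x) = x"
  using assms(2,3)
proof (induction w arbitrary: x)
  case Nil
  then show ?case by (simp add: cyl_def)
next
  case (Cons k w)
  let ?z = "(x + real k - 1) / real l"
  have z: "?z \<in> circle \<inter> part l k" "\<tau> l ?z = x" using step_branch[OF l Cons.prems(2), of k] Cons.prems(1) by auto
  then have "branch l w ?z \<in> cyl l w \<and> (\<tau> l ^^ length w) (branch l w ?z) = ?z"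
    using Cons by auto
  then show ?case using z by (simp add: cyl_Cons)
qed

lemma cyl_branch:
  assumes l: "l \<ge> 1" and "y \<in> cyl l w"
  shows "y = branch l w ((\<tau> l ^^ length w) y)"
  using assms(2)
proof (induction w)
  case (Cons k w)
  then have y: "y \<in> cyl l w" "(\<tau> l ^^ length w) y \<in> part l k" by (auto simp: cyl_Cons)
  have "(\<tau> l ^^ length w) y = ((\<tau> l ^^ length (k # w)) y + real k - 1) / real l"
    using part_\<tau>[OF l y(2)] by simp
  then show ?case using Cons.IH[OF y(1)] by simp
qed simp

text \<open>On the circle \<open>branch\<close> is the point of the cylinder that is mapped to \<open>x\<close>, and the only one.\<close>

lemma inv_branch_eq:
  assumes l: "l \<ge> 1" and w: "set w \<subseteq> {1..l}" and x: "x \<in> circle"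
  shows "inv_branch l w x = branch l w x"
  unfolding inv_branch_def
proof (rule the_equality)
  show "branch l w x \<in> cyl l w \<and> (\<tau> l ^^ length w) (branch l w x) = x"
    by (rule branch_in_cyl[OF l w x])
  show "y = branch l w x" if "y \<in> cyl l w \<and> (\<tau> l ^^ length w) y = x" for y
    using cyl_branch[OF l, of y w] that by simp
qed

text \<open>Reading off the digits of \<open>x\<close> to the base \<open>l\<close>.\<close>

lemma circle_cyl:
  assumes l: "l \<ge> 1" and x: "x \<in> circle"
  obtains c where "c \<in> words l p" "x \<in> cyl l c"
proof -
  have "\<exists>c\<in>words l p. x \<in> cyl l c"
  proof (induction p)
    case 0
    then show ?case using x by (simp add: cyl_def)
  next
    case (Suc p)
    then obtain c where c: "c \<in> words l p" "x \<in> cyl l c" by blast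
    define z where "z = (\<tau> l ^^ p) x"
    have z: "z \<in> circle" unfolding z_def using x \<tau>_range by (cases p) auto
    define k where "k = nat (floor (real l * z)) + 1"
    have z01: "0 \<le> z" "z < 1" using z by (auto simp: circle_def)
    have fl: "0 \<le> floor (real l * z)" using z01 by simp
    have "real l * z < real l" using z01 l by simp
    then have "floor (real l * z) < int l" by (simp add: floor_less_iff)
    then have "nat (floor (real l * z)) < l" using fl by (simp add: nat_less_iff)
    then have k: "k \<in> {1..l}" by (simp add: k_def)
    have "real k - 1 = real_of_int (floor (real l * z))" using fl by (simp add: k_def)
    then have "real k - 1 \<le> real l * z" "real l * z < real k" by linarith+
    then have "z \<in> part l k" using l by (auto simp: part_def divide_simps mult.commute)
    then have "x \<in> cyl l (k # c)" using c by (simp add: cyl_Cons z_def length_words[OF c(1)])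
    moreover have "k # c \<in> words l (Suc p)" using c k by (auto simp: words_def)
    ultimately show ?case by blast
  qed
  then show thesis using that by blast
qed

text \<open>A cylinder has at least two points, and an affine function is determined by its values there.\<close>

lemma ext_branch_eq:
  assumes l: "l \<ge> 2" and c: "c \<in> words l p" and w: "set w \<subseteq> {1..l}"
  shows "ext_branch l c w = branch l w"
proof -
  have l1: "l \<ge> 1" using l by simp
  have aff: "\<exists>m b. branch l w = (\<lambda>x. m * x + b)"
  proof -
    have "branch l w = (\<lambda>x. (1 / real l ^ length w) * x + branch l w 0)"
    proof
      fix x show "branch l w x = (1 / real l ^ length w) * x + branch l w 0"
        using branch_affine[of l w x] by simp
    qed
    then show ?thesis by blast
  qed
  have cyl: "x \<in> circle" if "x \<in> cyl l c" for x using that by (simp add: cyl_def)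
  have c': "set c \<subseteq> {1..l}" using c by (simp add: words_def)
  have pts: "branch l c 0 \<in> cyl l c" "branch l c (1/2) \<in> cyl l c"
    using branch_in_cyl[OF l1 c'] by (simp_all add: circle_def)
  have ne: "branch l c 0 \<noteq> branch l c (1/2)" using branch_affine[of l c "1/2"] l by simp
  show ?thesis unfolding ext_branch_def
  proof (rule the_equality)
    show "(\<exists>m b. branch l w = (\<lambda>x. m * x + b)) \<and> (\<forall>x\<in>cyl l c. branch l w x = inv_branch l w x)"
      using aff inv_branch_eq[OF l1 w] cyl by auto
  next
    fix g assume g: "(\<exists>m b. g = (\<lambda>x. m * x + b)) \<and> (\<forall>x\<in>cyl l c. g x = inv_branch l w x)"
    then obtain m b where m: "g = (\<lambda>x. m * x + b)" by blast
    obtain m' b' where m': "branch l w = (\<lambda>x. m' * x + b')" using aff by blast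
    have "m * x + b = m' * x + b'" if "x \<in> cyl l c" for x
    proof -
      have "g x = branch l w x" using g inv_branch_eq[OF l1 w cyl[OF that]] that by simp
      then show ?thesis unfolding m m' .
    qed
    from this[OF pts(1)] this[OF pts(2)]
    have "(m - m') * (branch l c 0 - branch l c (1/2)) = 0" "m * branch l c 0 + b = m' * branch l c 0 + b'"
      by (simp_all add: algebra_simps)
    then have "m = m'" "b = b'" using ne by auto
    then show "g = branch l w" unfolding m m' by simp
  qed
qed

section \<open>The partial sums and their exponential sums\<close>

lemma has_vector_derivative_cis:
  assumes "(f has_vector_derivative f') (at x within X)"
  shows "((\<lambda>x. cis (f x)) has_vector_derivative f' *\<^sub>R (\<i> * cis (f x))) (at x within X)"
proof -
  have "((\<lambda>x. exp (\<i> * of_real (f x))) has_vector_derivative (\<i> * of_real f') * exp (\<i> * of_real (f x))) (at x within X)"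
  proof -
    have "((\<lambda>x. \<i> * of_real (f x)) has_vector_derivative \<i> * of_real f') (at x within X)"
      using assms by (intro has_vector_derivative_mult_right has_vector_derivative_of_real)
         (simp add: has_real_derivative_iff_has_vector_derivative)
    from field_vector_diff_chain_within[OF this, of exp "exp (\<i> * of_real (f x))"]
    show ?thesis by (simp add: o_def DERIV_subset[OF DERIV_exp])
  qed
  then show ?thesis by (simp add: cis_conv_exp scaleR_conv_of_real mult_ac)
qed

text \<open>
  \<open>\<phi>1\<close> and \<open>\<phi>2\<close> are the first two derivatives of \<open>\<phi>\<close>: the first governs the phases, and one partial
  integration differentiates it once more.
\<close>

locale solenoid =
  fixes l :: nat and A :: "real^'n^'n" and \<phi> \<phi>1 \<phi>2 :: "real \<Rightarrow> real^'n" and \<kappa> :: real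
  assumes l: "l \<ge> 2"
    and periodic: "\<phi> (x + 1) = \<phi> x"
    and d1: "(\<phi> has_vector_derivative \<phi>1 x) (at x)"
    and d2: "(\<phi>1 has_vector_derivative \<phi>2 x) (at x)"
    and c2: "continuous_on UNIV \<phi>2"
    and b1: "norm (\<phi>1 x) \<le> \<kappa>" and b2: "norm (\<phi>2 x) \<le> \<kappa>"
    and \<kappa>: "\<kappa> > 0"
    and summable: "summable (\<lambda>j. onorm (\<lambda>v. matpow A j *v v))"
begin

lemma l0: "real l > 0" and l1: "l \<ge> 1" using l by auto

text \<open>\<open>S1\<close> and \<open>S2\<close> are the first two derivatives of \<open>S\<close>.\<close>

definition S :: "nat list \<Rightarrow> real \<Rightarrow> real^'n" where
  "S w x = (\<Sum>j<length w. matpow A j *v \<phi> (branch l (take (Suc j) w) x))"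

definition S1 :: "nat list \<Rightarrow> real \<Rightarrow> real^'n" where
  "S1 w x = (\<Sum>j<length w. matpow A j *v ((1 / real l ^ Suc j) *\<^sub>R \<phi>1 (branch l (take (Suc j) w) x)))"

definition S2 :: "nat list \<Rightarrow> real \<Rightarrow> real^'n" where
  "S2 w x = (\<Sum>j<length w. matpow A j *v ((1 / real l ^ Suc j)^2 *\<^sub>R \<phi>2 (branch l (take (Suc j) w) x)))"

lemma S_Nil [simp]: "S [] x = 0"
  by (simp add: S_def)

lemma S_Cons: "S (k # w) x = \<phi> ((x + real k - 1) / real l) + A *v S w ((x + real k - 1) / real l)"
proof -
  have "S (k # w) x = \<phi> ((x + real k - 1) / real l)
      + (\<Sum>j<length w. A *v (matpow A j *v \<phi> (branch l (take (Suc j) w) ((x + real k - 1) / real l))))"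
    unfolding S_def by (simp add: sum.lessThan_Suc_shift matrix_vector_mul_assoc del: sum.lessThan_Suc)
  also have "(\<Sum>j<length w. A *v (matpow A j *v \<phi> (branch l (take (Suc j) w) ((x + real k - 1) / real l))))
      = A *v S w ((x + real k - 1) / real l)"
    unfolding S_def by (rule linear_sum[OF matrix_vector_mul_linear, symmetric])
  finally show ?thesis .
qed

lemma S_append: "S (a @ u) x = S a x + matpow A (length a) *v S u (branch l a x)"
proof (induction a arbitrary: x)
  case (Cons k a)
  show ?case
    unfolding append_Cons S_Cons Cons.IH
    by (simp add: matrix_vector_right_distrib matrix_vector_mul_assoc add.assoc)
qed simp

lemma compose_branch_deriv:
  assumes "\<And>x. (f has_vector_derivative f' x) (at x)"
  shows "((\<lambda>x. f (branch l w x)) has_vector_derivative (1 / real l ^ length w) *\<^sub>R f' (branch l w x)) (at x)"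
  using vector_diff_chain_at[OF branch_deriv assms, of l w x] by (simp add: o_def)

lemma matpow_deriv:
  "(f has_vector_derivative f') F \<Longrightarrow> ((\<lambda>x. M *v f x) has_vector_derivative M *v f') F" for M :: "real^'n^'m"
  by (rule bounded_linear.has_vector_derivative[OF matrix_vector_mul_bounded_linear])

lemma S_deriv: "(S w has_vector_derivative S1 w x) (at x)"
  unfolding S_def S1_def
proof (rule has_vector_derivative_sum)
  fix j assume "j \<in> {..<length w}"
  then have len: "length (take (Suc j) w) = Suc j" by simp
  show "((\<lambda>x. matpow A j *v \<phi> (branch l (take (Suc j) w) x)) has_vector_derivative
      matpow A j *v ((1 / real l ^ Suc j) *\<^sub>R \<phi>1 (branch l (take (Suc j) w) x))) (at x)"
    using compose_branch_deriv[of \<phi> \<phi>1 "take (Suc j) w" x, OF d1] unfolding len by (rule matpow_deriv)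
qed

lemma S1_deriv: "(S1 w has_vector_derivative S2 w x) (at x)"
  unfolding S1_def S2_def
proof (rule has_vector_derivative_sum)
  fix j assume "j \<in> {..<length w}"
  then have len: "length (take (Suc j) w) = Suc j" by simp
  let ?c = "1 / real l ^ Suc j"
  have "((\<lambda>x. ?c *\<^sub>R \<phi>1 (branch l (take (Suc j) w) x)) has_vector_derivative
      ?c *\<^sub>R (?c *\<^sub>R \<phi>2 (branch l (take (Suc j) w) x))) (at x)"
    using bounded_linear.has_vector_derivative[OF bounded_linear_scaleR_right compose_branch_deriv[of \<phi>1 \<phi>2 "take (Suc j) w" x, OF d2], of ?c]
    unfolding len .
  then have "((\<lambda>x. ?c *\<^sub>R \<phi>1 (branch l (take (Suc j) w) x)) has_vector_derivative
      ?c^2 *\<^sub>R \<phi>2 (branch l (take (Suc j) w) x)) (at x)"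
    by (simp add: power2_eq_square)
  then show "((\<lambda>x. matpow A j *v (?c *\<^sub>R \<phi>1 (branch l (take (Suc j) w) x))) has_vector_derivative
      matpow A j *v (?c^2 *\<^sub>R \<phi>2 (branch l (take (Suc j) w) x))) (at x)" by (rule matpow_deriv)
qed

lemma continuous_on_S: "continuous_on X (S w)"
  using S_deriv by (intro continuous_at_imp_continuous_on) (blast intro: has_vector_derivative_continuous)

lemma continuous_on_S1: "continuous_on X (S1 w)"
  using S1_deriv by (intro continuous_at_imp_continuous_on) (blast intro: has_vector_derivative_continuous)

lemma continuous_on_S2: "continuous_on X (S2 w)"
  unfolding S2_def
  by (intro continuous_intros linear_continuous_on_compose[where f = "\<lambda>x. (_ :: real) *\<^sub>R \<phi>2 (branch l _ x)"]
      continuous_on_compose2[OF c2 continuous_on_branch] matrix_vector_mul_linear) auto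

lemma \<alpha>_pos: "\<alpha> A \<kappa> > 0"
proof -
  have "onorm (\<lambda>v. matpow A 0 *v v :: real^'n) = 1"
    using onorm_id[where 'a = "real^'n"] by (simp add: id_def)
  moreover have "sum (\<lambda>j. onorm (\<lambda>v. matpow A j *v v)) {0} \<le> (\<Sum>j. onorm (\<lambda>v. matpow A j *v v))"
    by (rule sum_le_suminf[OF summable]) (auto intro: onorm_pos_le[OF matrix_vector_mul_bounded_linear])
  ultimately show ?thesis using \<kappa> by (simp add: \<alpha>_def)
qed

lemma sum_onorm_le: "\<kappa> * (\<Sum>j<n. onorm (\<lambda>v. matpow A j *v v)) \<le> \<alpha> A \<kappa>"
proof -
  have "(\<Sum>j<n. onorm (\<lambda>v. matpow A j *v v)) \<le> (\<Sum>j. onorm (\<lambda>v. matpow A j *v v))"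
    by (rule sum_le_suminf[OF summable]) (auto intro: onorm_pos_le[OF matrix_vector_mul_bounded_linear])
  then show ?thesis using \<kappa> by (simp add: \<alpha>_def)
qed

lemma norm_weighted_sum_le:
  assumes f: "\<And>j. norm (f j) \<le> \<kappa>" and c: "\<And>j. 0 \<le> c j" "\<And>j. c j \<le> r"
  shows "norm (\<Sum>j<n. matpow A j *v (c j *\<^sub>R f j)) \<le> r * \<alpha> A \<kappa>"
proof -
  let ?o = "\<lambda>j. onorm (\<lambda>v. matpow A j *v v)"
  have o: "?o j \<ge> 0" for j by (rule onorm_pos_le[OF matrix_vector_mul_bounded_linear])
  have "norm (\<Sum>j<n. matpow A j *v (c j *\<^sub>R f j)) \<le> (\<Sum>j<n. ?o j * (r * \<kappa>))"
  proof (rule sum_norm_le)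
    fix j
    have "norm (matpow A j *v (c j *\<^sub>R f j)) \<le> ?o j * norm (c j *\<^sub>R f j)"
      by (rule onorm[OF matrix_vector_mul_bounded_linear])
    also have "norm (c j *\<^sub>R f j) \<le> r * \<kappa>"
      using f[of j] c[of j] by (simp add: mult_mono)
    finally show "norm (matpow A j *v (c j *\<^sub>R f j)) \<le> ?o j * (r * \<kappa>)" using o by (simp add: mult_left_mono)
  qed
  also have "\<dots> = r * (\<kappa> * (\<Sum>j<n. ?o j))" by (simp add: sum_distrib_left sum_distrib_right mult_ac)
  also have "\<dots> \<le> r * \<alpha> A \<kappa>" using sum_onorm_le[of n] c[of 0] by (intro mult_left_mono) auto
  finally show ?thesis .
qed

lemma inv_pow_le: "1 / real l ^ Suc j \<le> 1 / 2"
proof -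
  have "2 * 1 \<le> real l * real l ^ j" using l by (intro mult_mono) auto
  then have "2 \<le> real l ^ Suc j" by simp
  then show ?thesis by (intro frac_le) auto
qed

text \<open>
  The contraction by \<open>1 / l \<le> 1/2\<close> of the first branch gives the factor \<open>1/2\<close>, on which the separation of near
  and far pairs of words rests.
\<close>

lemma norm_S1: "norm (S1 w x) \<le> \<alpha> A \<kappa> / 2"
proof -
  have "norm (S1 w x) \<le> 1 / 2 * \<alpha> A \<kappa>"
    unfolding S1_def by (rule norm_weighted_sum_le, rule b1, simp, rule inv_pow_le)
  then show ?thesis by simp
qed

lemma norm_S2: "norm (S2 w x) \<le> \<alpha> A \<kappa>"
proof -
  have "(1 / real l ^ Suc j)^2 \<le> 1" for j
    using inv_pow_le[of j] by (intro power_le_one) auto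
  then have "norm (S2 w x) \<le> 1 * \<alpha> A \<kappa>"
    unfolding S2_def by (intro norm_weighted_sum_le b2) auto
  then show ?thesis by simp
qed

lemma inner_matpow: "inner \<eta> (matpow A q *v y) = inner (freq A q \<eta>) y"
  by (metis dot_lmul_matrix transpose_matrix_vector)

lemma freq_add: "freq A (q + m) \<eta> = freq A m (freq A q \<eta>)"
  by (simp only: matpow_add matrix_transpose_mul matrix_vector_mul_assoc)

text \<open>
  The Fourier transform in the fibre over \<open>x\<close> of the measure with mass \<open>l\<^sup>-\<^sup>n\<close> in each \<open>S w x\<close>.
\<close>

definition F :: "nat \<Rightarrow> real^'n \<Rightarrow> real \<Rightarrow> complex" where
  "F n \<eta> x = (\<Sum>w\<in>words l n. cis (- 2 * pi * inner \<eta> (S w x))) / of_nat l ^ n"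

definition F1 :: "nat \<Rightarrow> real^'n \<Rightarrow> real \<Rightarrow> complex" where
  "F1 n \<eta> x = (\<Sum>w\<in>words l n. (- 2 * pi * inner \<eta> (S1 w x)) *\<^sub>R (\<i> * cis (- 2 * pi * inner \<eta> (S w x)))) / of_nat l ^ n"

lemma inner_S_deriv: "((\<lambda>x. c * inner \<eta> (S w x)) has_vector_derivative c * inner \<eta> (S1 w x)) (at x)"
  using bounded_linear.has_vector_derivative[OF bounded_linear_compose[OF bounded_linear_mult_right bounded_linear_inner_right] S_deriv]
  by simp

lemma F_deriv: "(F n \<eta> has_vector_derivative F1 n \<eta> x) (at x)"
  unfolding F_def F1_def
  by (intro has_vector_derivative_divide has_vector_derivative_sum has_vector_derivative_cis inner_S_deriv)

lemma continuous_on_F: "continuous_on X (F n \<eta>)"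
  using F_deriv by (intro continuous_at_imp_continuous_on) (blast intro: has_vector_derivative_continuous)

lemma continuous_on_F1: "continuous_on X (F1 n \<eta>)"
  unfolding F1_def using l0
  by (intro continuous_intros continuous_on_S continuous_on_S1) auto

lemma norm_F_le: "norm (F n \<eta> x) \<le> 1"
proof -
  have "norm (\<Sum>w\<in>words l n. cis (- 2 * pi * inner \<eta> (S w x))) \<le> (\<Sum>w\<in>words l n. 1)"
    by (rule sum_norm_le) simp
  then show ?thesis using l0 by (simp add: F_def norm_divide norm_power card_words divide_le_eq)
qed

text \<open>The analogue on the Fourier side of the invariance of the measure.\<close>

lemma F_add:
  "F (q + n) \<eta> x = (\<Sum>a\<in>words l q. cis (- 2 * pi * inner \<eta> (S a x)) * F n (freq A q \<eta>) (branch l a x)) / of_nat l ^ q"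
proof -
  have "(\<Sum>w\<in>words l (q + n). cis (- 2 * pi * inner \<eta> (S w x)))
      = (\<Sum>a\<in>words l q. \<Sum>u\<in>words l n. cis (- 2 * pi * inner \<eta> (S (a @ u) x)))"
    by (rule sum_words_append)
  also have "\<dots> = (\<Sum>a\<in>words l q. \<Sum>u\<in>words l n. cis (- 2 * pi * inner \<eta> (S a x)) *
      cis (- 2 * pi * inner (freq A q \<eta>) (S u (branch l a x))))"
  proof (intro sum.cong refl)
    fix a u assume a: "a \<in> words l q"
    have "inner \<eta> (S (a @ u) x) = inner \<eta> (S a x) + inner (freq A q \<eta>) (S u (branch l a x))"
      unfolding S_append length_words[OF a] inner_add_right inner_matpow ..
    then show "cis (- 2 * pi * inner \<eta> (S (a @ u) x)) = cis (- 2 * pi * inner \<eta> (S a x)) *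
      cis (- 2 * pi * inner (freq A q \<eta>) (S u (branch l a x)))"
      unfolding cis_mult by (simp only: distrib_left)
  qed
  also have "\<dots> = (\<Sum>a\<in>words l q. cis (- 2 * pi * inner \<eta> (S a x)) *
      (\<Sum>u\<in>words l n. cis (- 2 * pi * inner (freq A q \<eta>) (S u (branch l a x)))))"
    by (simp only: sum_distrib_left)
  finally have *: "(\<Sum>w\<in>words l (q + n). cis (- 2 * pi * inner \<eta> (S w x))) = \<dots>" .
  show ?thesis
    unfolding F_def * times_divide_eq_right sum_divide_distrib[symmetric] divide_divide_eq_left
      power_add mult.commute[of "of_nat l ^ n"] ..
qed

lemma periodic_step:
  assumes P: "\<And>x. P (x + 1) = (P x :: 'b::comm_monoid_add)"
  shows "(\<Sum>k=1..l. P ((x + 1 + real k - 1) / real l)) = (\<Sum>k=1..l. P ((x + real k - 1) / real l))"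
proof -
  let ?g = "\<lambda>k. P ((x + real k) / real l)"
  have "(\<Sum>k=1..l. P ((x + 1 + real k - 1) / real l)) = (\<Sum>k<l. ?g (Suc k))"
    by (rule sum.reindex_bij_witness[of _ Suc "\<lambda>k. k - 1"]) (auto simp: of_nat_diff algebra_simps)
  also have "\<dots> = (\<Sum>k<l. ?g k)"
  proof -
    obtain m where m: "l = Suc m" using l by (cases l) auto
    have "?g l = P (x / real l + 1)" using l0 by (simp add: add_divide_distrib)
    also have "\<dots> = ?g 0" using P by simp
    finally have "?g l = ?g 0" .
    then have "?g 0 + (\<Sum>k<l. ?g (Suc k)) = ?g 0 + (\<Sum>k<l. ?g k)" and "?g (Suc m) = ?g 0" and "True"
      using sum.lessThan_Suc_shift[of ?g l] sum.lessThan_Suc[of ?g l] by (auto simp: m add.commute)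
    have "(\<Sum>k<Suc m. ?g (Suc k)) = (\<Sum>k<m. ?g (Suc k)) + ?g (Suc m)" by simp
    also have "\<dots> = ?g 0 + (\<Sum>k<m. ?g (Suc k))" using \<open>?g (Suc m) = ?g 0\<close> by (simp add: add.commute)
    also have "\<dots> = (\<Sum>k<Suc m. ?g k)" by (rule sum.lessThan_Suc_shift[symmetric])
    finally show ?thesis by (simp only: m)
  qed
  also have "\<dots> = (\<Sum>k=1..l. P ((x + real k - 1) / real l))"
    by (rule sum.reindex_bij_witness[of _ "\<lambda>k. k - 1" Suc]) (auto simp: of_nat_diff algebra_simps)
  finally show ?thesis .
qed

text \<open>Going once around the circle permutes the inverse branches cyclically, up to integers.\<close>

lemma sum_branch_periodic:
  assumes P: "\<And>x. P (x + 1) = (P x :: 'b::comm_monoid_add)"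
  shows "(\<Sum>w\<in>words l n. P (branch l w (x + 1))) = (\<Sum>w\<in>words l n. P (branch l w x))"
proof (induction n arbitrary: x)
  case (Suc n)
  have "(\<Sum>w\<in>words l (Suc n). P (branch l w y)) = (\<Sum>k=1..l. (\<Sum>w\<in>words l n. P (branch l w ((y + real k - 1) / real l))))" for y
    by (simp add: sum_words_Suc)
  then show ?case using periodic_step[of "\<lambda>x. \<Sum>w\<in>words l n. P (branch l w x)", OF Suc] by simp
qed (simp add: P)

lemma F_periodic: "F n \<eta> (x + 1) = F n \<eta> x"
proof (induction n arbitrary: \<eta> x)
  case (Suc n)
  let ?P = "\<lambda>x. cis (- 2 * pi * inner \<eta> (\<phi> x)) * F n (freq A 1 \<eta>) x"
  have "F (1 + n) \<eta> x = (\<Sum>k=1..l. ?P ((x + real k - 1) / real l)) / of_nat l ^ 1" for x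
    unfolding F_add One_nat_def sum_words_Suc by (simp add: S_Cons)
  moreover have "?P (x + 1) = ?P x" for x using Suc by (simp only: periodic)
  ultimately show ?case using periodic_step[of ?P] by simp
qed (simp add: F_def)

lemma F1_periodic: "F1 n \<eta> (x + 1) = F1 n \<eta> x"
proof -
  have "((\<lambda>x. F n \<eta> (x + 1)) has_vector_derivative F1 n \<eta> (x + 1)) (at x)"
    using vector_diff_chain_at[of "\<lambda>x. x + 1" 1 x "F n \<eta>" "F1 n \<eta> (x + 1)"] F_deriv[of n \<eta> "x + 1"]
    by (simp add: o_def has_vector_derivative_add_const)
  then show ?thesis unfolding F_periodic using F_deriv vector_derivative_unique_at by blast
qed

end

text \<open>
  As a simplification rule this equation turns the frequencies, which are multiples of transposed matrices,
  into products of a row vector with a matrix.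
\<close>

declare transpose_matrix_vector [simp del]

section \<open>Integrals of periodic functions\<close>

lemma integrable_cont: "continuous_on UNIV g \<Longrightarrow> g integrable_on {a..b}" for g :: "real \<Rightarrow> 'a::banach"
  by (rule integrable_continuous_interval) (rule continuous_on_subset[of UNIV], auto)

lemma integral_pieces:
  fixes g :: "real \<Rightarrow> real"
  assumes g: "continuous_on UNIV g" and m: "m > 0"
  shows "(\<Sum>k<m. integral {c + real k / real m..c + (real k + 1) / real m} g) = integral {c..c + 1} g"
proof -
  have "(\<Sum>k<j. integral {c + real k / real m..c + (real k + 1) / real m} g) = integral {c..c + real j / real m} g" for j
  proof (induction j)
    case (Suc j)
    have "integral {c..c + real j / real m} g + integral {c + real j / real m..c + (real j + 1) / real m} g
        = integral {c..c + (real j + 1) / real m} g"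
      using m by (intro Henstock_Kurzweil_Integration.integral_combine integrable_cont[OF g]) (auto simp: divide_right_mono)
    then show ?case using Suc by (simp add: add.commute)
  qed simp
  from this[of m] show ?thesis using m by simp
qed

lemma integral_period_shift:
  fixes g :: "real \<Rightarrow> real"
  assumes g: "continuous_on UNIV g" and per: "\<And>x. g (x + 1) = g x" and c: "-1 \<le> c" "c \<le> 1"
  shows "integral {c..c + 1} g = integral {0..1} g"
proof -
  have gs: "g \<circ> (+) 1 = g" using per by (auto simp: fun_eq_iff add.commute)
  have shift: "integral {a + 1..b + 1} g = integral {a..b} g" for a b
    using integral_shift_Icc_real[of a b g 1] unfolding gs by simp
  have pos: "integral {c..c + 1} g = integral {0..1} g" if "0 \<le> c" "c \<le> 1" for c
  proof -
    have "integral {0..1} g = integral {0..c} g + integral {c..1} g"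
      using that by (intro Henstock_Kurzweil_Integration.integral_combine[symmetric] integrable_cont[OF g]) auto
    moreover have "integral {c..c + 1} g = integral {c..1} g + integral {1..c + 1} g"
      using that by (intro Henstock_Kurzweil_Integration.integral_combine[symmetric] integrable_cont[OF g]) auto
    moreover have "integral {1..c + 1} g = integral {0..c} g" using shift[of 0 c] by simp
    ultimately show ?thesis by simp
  qed
  show ?thesis
  proof (cases "c \<ge> 0")
    case True
    then show ?thesis using pos c by simp
  next
    case False
    have "integral {c..c + 1} g = integral {c + 1..c + 1 + 1} g" using shift[of c "c + 1"] by simp
    also have "\<dots> = integral {0..1} g" using False c by (intro pos) auto
    finally show ?thesis .
  qed
qed

text \<open>Windows that overlap three times, since each is prolonged by its length on both sides.\<close>

lemma integral_windows:
  fixes g :: "real \<Rightarrow> real"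
  assumes g: "continuous_on UNIV g" and per: "\<And>x. g (x + 1) = g x" and L: "L > 0"
  shows "(\<Sum>j<L. integral {real j / real L - 1 / real L..real j / real L + 2 / real L} g) = 3 * integral {0..1} g"
proof -
  let ?d = "1 / real L"
  have d: "0 \<le> ?d" "?d \<le> 1" using L by auto
  have split: "integral {real j / real L - ?d..real j / real L + 2 / real L} g
      = integral {- ?d + real j / real L..- ?d + (real j + 1) / real L} g
      + integral {0 + real j / real L..0 + (real j + 1) / real L} g
      + integral {?d + real j / real L..?d + (real j + 1) / real L} g" for j
  proof -
    have 1: "integral {real j / real L - ?d..real j / real L} g + integral {real j / real L..real j / real L + 2 / real L} g
      = integral {real j / real L - ?d..real j / real L + 2 / real L} g"
      by (intro Henstock_Kurzweil_Integration.integral_combine integrable_cont[OF g]) auto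
    have 2: "integral {real j / real L..real j / real L + ?d} g + integral {real j / real L + ?d..real j / real L + 2 / real L} g
      = integral {real j / real L..real j / real L + 2 / real L} g"
      by (intro Henstock_Kurzweil_Integration.integral_combine integrable_cont[OF g]) (auto simp: divide_right_mono)
    have e: "- ?d + real j / real L = real j / real L - ?d" "- ?d + (real j + 1) / real L = real j / real L"
      "0 + real j / real L = real j / real L" "0 + (real j + 1) / real L = real j / real L + ?d"
      "?d + real j / real L = real j / real L + ?d" "?d + (real j + 1) / real L = real j / real L + 2 / real L"
      by (simp_all add: add_divide_distrib)
    show ?thesis unfolding e using 1 2 by linarith
  qed
  have "(\<Sum>j<L. integral {c + real j / real L..c + (real j + 1) / real L} g) = integral {0..1} g"
    if "-1 \<le> c" "c \<le> 1" for c
    unfolding integral_pieces[OF g L] by (rule integral_period_shift[OF g per that])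
  from this[of "- ?d"] this[of 0] this[of ?d] show ?thesis
    unfolding split sum.distrib using d by simp
qed

lemma integral_step:
  fixes g :: "real \<Rightarrow> real"
  assumes g: "continuous_on UNIV g" and l: "l > 0"
  shows "(\<Sum>k=1..l. integral {0..1} (\<lambda>x. g ((x + real k - 1) / real l))) = real l * integral {0..1} g"
proof -
  have "integral {0..1} (\<lambda>x. g ((x + real k) / real l)) = real l * integral {0 + real k / real l..0 + (real k + 1) / real l} g" for k
  proof -
    let ?a = "real k / real l" and ?b = "(real k + 1) / real l"
    have "(g has_integral integral {?a..?b} g) (cbox ?a ?b)"
      using integrable_cont[OF g, of ?a ?b] by (simp add: integrable_integral)
    from has_integral_affinity'[OF this, of "1 / real l" ?a]
    have "((\<lambda>x. g ((1 / real l) *\<^sub>R x + ?a)) has_integral integral {?a..?b} g /\<^sub>R (1 / real l) ^ DIM(real))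
        (cbox ((?a - ?a) /\<^sub>R (1 / real l)) ((?b - ?a) /\<^sub>R (1 / real l)))" using l by simp
    moreover have "(?b - ?a) /\<^sub>R (1 / real l) = 1" using l by (simp add: add_divide_distrib)
    ultimately have "((\<lambda>x. g ((x + real k) / real l)) has_integral real l * integral {?a..?b} g) {0..1}"
      by (simp add: add_divide_distrib)
    then show ?thesis by (simp add: integral_unique)
  qed
  then have "(\<Sum>k<l. integral {0..1} (\<lambda>x. g ((x + real k) / real l))) = real l * integral {0..1} g"
    using integral_pieces[OF g l, of 0] by (simp flip: sum_distrib_left)
  also have "(\<Sum>k<l. integral {0..1} (\<lambda>x. g ((x + real k) / real l)))
      = (\<Sum>k=1..l. integral {0..1} (\<lambda>x. g ((x + real k - 1) / real l)))"
    by (rule sum.reindex_bij_witness[of _ "\<lambda>k. k - 1" Suc]) (auto simp: of_nat_diff)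
  finally show ?thesis .
qed

lemma integral_branches:
  fixes g :: "real \<Rightarrow> real"
  assumes g: "continuous_on UNIV g" and l: "l > 0"
  shows "(\<Sum>w\<in>words l n. integral {0..1} (\<lambda>x. g (branch l w x))) = real l ^ n * integral {0..1} g"
proof (induction n)
  case (Suc n)
  have cont: "continuous_on UNIV (\<lambda>x. g (branch l w x))" for w
    by (rule continuous_on_compose2[OF g continuous_on_branch]) auto
  then have cs: "continuous_on UNIV (\<lambda>x. \<Sum>w\<in>words l n. g (branch l w x))" by (intro continuous_on_sum)
  have "(\<Sum>w\<in>words l (Suc n). integral {0..1} (\<lambda>x. g (branch l w x)))
      = (\<Sum>k=1..l. integral {0..1} (\<lambda>x. \<Sum>w\<in>words l n. g (branch l w ((x + real k - 1) / real l))))"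
  proof -
    have "(\<Sum>w\<in>words l n. integral {0..1} (\<lambda>x. g (branch l (k # w) x)))
        = integral {0..1} (\<lambda>x. \<Sum>w\<in>words l n. g (branch l (k # w) x))" for k
      by (rule integral_sum[symmetric], rule finite_words, rule integrable_cont[OF cont])
    then show ?thesis unfolding sum_words_Suc by simp
  qed
  also have "\<dots> = real l * integral {0..1} (\<lambda>x. \<Sum>w\<in>words l n. g (branch l w x))"
    by (rule integral_step[OF cs l])
  also have "integral {0..1} (\<lambda>x. \<Sum>w\<in>words l n. g (branch l w x)) = (\<Sum>w\<in>words l n. integral {0..1} (\<lambda>x. g (branch l w x)))"
    by (rule integral_sum) (auto intro: integrable_cont cont)
  finally show ?case using Suc by simp
qed simp

section \<open>Oscillatory integrals\<close>

text \<open>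
  Partial integration with \<open>b / \<theta>1\<close> as amplitude.  The boundary terms vanish with \<open>b\<close>, and the factor
  \<open>2 * pi\<close> gained from the phase is estimated by 1.
\<close>

lemma oscillatory_integral_bound:
  fixes \<theta> \<theta>1 \<theta>2 b b1 :: "real \<Rightarrow> real" and g g1 :: "real \<Rightarrow> complex"
  assumes uv: "u \<le> v"
    and \<theta>: "\<And>x. (\<theta> has_vector_derivative \<theta>1 x) (at x)" and \<theta>1: "\<And>x. (\<theta>1 has_vector_derivative \<theta>2 x) (at x)"
    and b: "\<And>x. (b has_vector_derivative b1 x) (at x)" and g: "\<And>x. (g has_vector_derivative g1 x) (at x)"
    and c: "continuous_on {u..v} \<theta>2" "continuous_on {u..v} b1" "continuous_on {u..v} g1"
    and b0: "b u = 0" "b v = 0"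
    and \<rho>: "\<rho> > 0" "\<And>x. x \<in> {u..v} \<Longrightarrow> \<bar>\<theta>1 x\<bar> \<ge> \<rho>" and K: "\<And>x. x \<in> {u..v} \<Longrightarrow> \<bar>\<theta>2 x\<bar> \<le> K"
    and B: "\<And>x. x \<in> {u..v} \<Longrightarrow> \<bar>b x\<bar> \<le> B" and B1: "\<And>x. x \<in> {u..v} \<Longrightarrow> \<bar>b1 x\<bar> \<le> B1"
  shows "norm (integral {u..v} (\<lambda>x. of_real (b x) * (cis (- 2 * pi * \<theta> x) * g x)))
    \<le> integral {u..v} (\<lambda>x. (B1 / \<rho> + B * K / \<rho>\<^sup>2) * norm (g x) + B / \<rho> * norm (g1 x))"
proof -
  have cont: "continuous_on {u..v} \<theta>" "continuous_on {u..v} \<theta>1" "continuous_on {u..v} b" "continuous_on {u..v} g"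
    by (rule continuous_at_imp_continuous_on, rule ballI, rule has_vector_derivative_continuous, rule \<theta> \<theta>1 b g)+
  have nz: "\<theta>1 x \<noteq> 0" if "x \<in> {u..v}" for x using \<rho>(1) \<rho>(2)[OF that] by auto
  define a where "a = (\<lambda>x. b x / \<theta>1 x)"
  define a1 where "a1 = (\<lambda>x. (b1 x * \<theta>1 x - b x * \<theta>2 x) / (\<theta>1 x)\<^sup>2)"
  define e where "e = (\<lambda>x. cis (- 2 * pi * \<theta> x))"
  have ca: "continuous_on {u..v} a" "continuous_on {u..v} a1" "continuous_on {u..v} e"
    unfolding a_def a1_def e_def using nz by (auto intro!: continuous_intros cont c)
  define h where "h = (\<lambda>x. (of_real (a1 x) * g x + of_real (a x) * g1 x) * e x)"
  have ch: "continuous_on {u..v} h" unfolding h_def by (intro continuous_intros cont c ca)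
  have "((\<lambda>x. h x - 2 * pi * \<i> * (of_real (b x) * (e x * g x))) has_integral
      of_real (a v) * g v * e v - of_real (a u) * g u * e u) {u..v}"
  proof (rule fundamental_theorem_of_calculus[OF uv])
    fix x assume x: "x \<in> {u..v}"
    have "(a has_vector_derivative a1 x) (at x within {u..v})"
    proof -
      have "(b has_field_derivative b1 x) (at x within {u..v})" "(\<theta>1 has_field_derivative \<theta>2 x) (at x within {u..v})"
        unfolding has_real_derivative_iff_has_vector_derivative
        by (rule has_vector_derivative_at_within[OF b], rule has_vector_derivative_at_within[OF \<theta>1])
      from DERIV_divide[OF this nz[OF x]] show ?thesis
        unfolding has_real_derivative_iff_has_vector_derivative a_def a1_def power2_eq_square .
    qed
    then have 1: "((\<lambda>x. of_real (a x)) has_vector_derivative of_real (a1 x)) (at x within {u..v})"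
      by (intro has_vector_derivative_of_real) (simp only: has_real_derivative_iff_has_vector_derivative)
    have 2: "(g has_vector_derivative g1 x) (at x within {u..v})" using g by (rule has_vector_derivative_at_within)
    have "((\<lambda>x. - 2 * pi * \<theta> x) has_vector_derivative - 2 * pi * \<theta>1 x) (at x within {u..v})"
      by (rule has_vector_derivative_mult_right[OF has_vector_derivative_at_within[OF \<theta>]])
    then have 3: "(e has_vector_derivative (- 2 * pi * \<theta>1 x) *\<^sub>R (\<i> * e x)) (at x within {u..v})"
      unfolding e_def by (rule has_vector_derivative_cis)
    have "((\<lambda>x. of_real (a x) * g x * e x) has_vector_derivative
        (of_real (a x) * g x) * ((- 2 * pi * \<theta>1 x) *\<^sub>R (\<i> * e x)) + (of_real (a x) * g1 x + of_real (a1 x) * g x) * e x) (at x within {u..v})"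
      by (rule has_vector_derivative_mult[OF has_vector_derivative_mult[OF 1 2] 3])
    moreover have "(of_real (a x) * g x) * ((- 2 * pi * \<theta>1 x) *\<^sub>R (\<i> * e x)) = - 2 * pi * \<i> * (of_real (b x) * (e x * g x))"
      using nz[OF x] by (simp add: a_def scaleR_conv_of_real)
    ultimately show "((\<lambda>x. of_real (a x) * g x * e x) has_vector_derivative
        h x - 2 * pi * \<i> * (of_real (b x) * (e x * g x))) (at x within {u..v})"
      by (simp add: h_def algebra_simps)
  qed
  then have z: "((\<lambda>x. h x - 2 * pi * \<i> * (of_real (b x) * (e x * g x))) has_integral 0) {u..v}"
    by (simp add: a_def b0)
  have bi: "(\<lambda>x. of_real (b x) * (e x * g x)) integrable_on {u..v}"
    by (intro integrable_continuous_interval continuous_intros cont ca)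
  have hi: "h integrable_on {u..v}" by (rule integrable_continuous_interval[OF ch])
  have "((\<lambda>x. h x - 2 * pi * \<i> * (of_real (b x) * (e x * g x))) has_integral
      integral {u..v} h - 2 * pi * \<i> * integral {u..v} (\<lambda>x. of_real (b x) * (e x * g x))) {u..v}"
    by (intro has_integral_diff has_integral_mult_right integrable_integral hi bi)
  from has_integral_unique[OF this z]
  have "integral {u..v} h = 2 * pi * \<i> * integral {u..v} (\<lambda>x. of_real (b x) * (e x * g x))" by simp
  then have "norm (integral {u..v} h) = 2 * pi * norm (integral {u..v} (\<lambda>x. of_real (b x) * (e x * g x)))"
    by (simp add: norm_mult)
  moreover have "1 * norm (integral {u..v} (\<lambda>x. of_real (b x) * (e x * g x)))
      \<le> 2 * pi * norm (integral {u..v} (\<lambda>x. of_real (b x) * (e x * g x)))"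
    using pi_gt3 by (intro mult_right_mono) auto
  ultimately have "norm (integral {u..v} (\<lambda>x. of_real (b x) * (e x * g x))) \<le> norm (integral {u..v} h)" by simp
  also have "\<dots> \<le> integral {u..v} (\<lambda>x. (B1 / \<rho> + B * K / \<rho>\<^sup>2) * norm (g x) + B / \<rho> * norm (g1 x))"
  proof (rule integral_norm_bound_integral[OF hi])
    show "(\<lambda>x. (B1 / \<rho> + B * K / \<rho>\<^sup>2) * norm (g x) + B / \<rho> * norm (g1 x)) integrable_on {u..v}"
      by (intro integrable_continuous_interval continuous_intros cont c)
    fix x assume x: "x \<in> {u..v}"
    have t: "\<bar>\<theta>1 x\<bar> > 0" using nz[OF x] by simp
    have "\<bar>a x\<bar> \<le> B / \<rho>"
      unfolding a_def abs_divide using B[OF x] \<rho>(1) \<rho>(2)[OF x] by (intro frac_le) auto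
    have "\<bar>b1 x / \<theta>1 x\<bar> \<le> B1 / \<rho>"
      unfolding abs_divide using B1[OF x] \<rho>(1) \<rho>(2)[OF x] by (intro frac_le) auto
    moreover have "\<bar>b x * \<theta>2 x / (\<theta>1 x)\<^sup>2\<bar> \<le> B * K / \<rho>\<^sup>2"
    proof -
      have "\<bar>b x\<bar> * \<bar>\<theta>2 x\<bar> \<le> B * K" using B[OF x] K[OF x] by (intro mult_mono) auto
      moreover have "\<rho>\<^sup>2 \<le> (\<theta>1 x)\<^sup>2" using \<rho>(1) \<rho>(2)[OF x] by (metis abs_le_square_iff abs_of_pos)
      moreover have "0 \<le> B * K"
        by (rule order.trans[OF mult_nonneg_nonneg[OF abs_ge_zero abs_ge_zero] calculation(1)])
      ultimately have "\<bar>b x\<bar> * \<bar>\<theta>2 x\<bar> / (\<theta>1 x)\<^sup>2 \<le> B * K / \<rho>\<^sup>2" using \<rho>(1) by (intro frac_le) simp_all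
      then show ?thesis by (simp add: abs_mult)
    qed
    moreover have "a1 x = b1 x / \<theta>1 x - b x * \<theta>2 x / (\<theta>1 x)\<^sup>2"
      using nz[OF x] by (simp add: a1_def diff_divide_distrib power2_eq_square)
    ultimately have a1: "\<bar>a1 x\<bar> \<le> B1 / \<rho> + B * K / \<rho>\<^sup>2" by linarith
    have "norm (h x) = norm (of_real (a1 x) * g x + of_real (a x) * g1 x)" by (simp add: h_def e_def norm_mult)
    also have "\<dots> \<le> \<bar>a1 x\<bar> * norm (g x) + \<bar>a x\<bar> * norm (g1 x)"
      by (rule norm_triangle_le) (simp add: norm_mult)
    also have "\<dots> \<le> (B1 / \<rho> + B * K / \<rho>\<^sup>2) * norm (g x) + B / \<rho> * norm (g1 x)"
      by (intro add_mono mult_right_mono a1 \<open>\<bar>a x\<bar> \<le> B / \<rho>\<close>) auto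
    finally show "norm (h x) \<le> (B1 / \<rho> + B * K / \<rho>\<^sup>2) * norm (g x) + B / \<rho> * norm (g1 x)" .
  qed
  finally show ?thesis unfolding e_def .
qed

lemma norm_integral_double_sum_le:
  fixes f :: "'i \<Rightarrow> real \<Rightarrow> complex" and g :: "'j \<Rightarrow> real \<Rightarrow> complex"
  assumes "finite I" "finite J" "\<And>i. continuous_on UNIV (f i)" "\<And>j. continuous_on UNIV (g j)" "continuous_on UNIV b"
  shows "norm (integral {u..v} (\<lambda>x. of_real (b x) * ((\<Sum>i\<in>I. f i x) * cnj (\<Sum>j\<in>J. g j x))))
    \<le> (\<Sum>i\<in>I. \<Sum>j\<in>J. norm (integral {u..v} (\<lambda>x. of_real (b x) * (f i x * cnj (g j x)))))"
proof -
  have int: "(\<lambda>x. of_real (b x) * (f i x * cnj (g j x))) integrable_on {u..v}" for i j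
    by (intro integrable_cont continuous_intros assms)
  have "(\<lambda>x. of_real (b x) * ((\<Sum>i\<in>I. f i x) * cnj (\<Sum>j\<in>J. g j x)))
      = (\<lambda>x. \<Sum>i\<in>I. \<Sum>j\<in>J. of_real (b x) * (f i x * cnj (g j x)))"
    unfolding cnj_sum sum_product by (simp only: sum_distrib_left)
  then have "integral {u..v} (\<lambda>x. of_real (b x) * ((\<Sum>i\<in>I. f i x) * cnj (\<Sum>j\<in>J. g j x)))
      = (\<Sum>i\<in>I. \<Sum>j\<in>J. integral {u..v} (\<lambda>x. of_real (b x) * (f i x * cnj (g j x))))"
    using assms(1,2) int by (simp add: integral_sum integrable_sum)
  then show ?thesis by (auto intro!: sum_norm_le)
qed

section \<open>The basic inequality\<close>

context solenoid
begin

text \<open>The derivative is measured relative to \<open>norm \<eta>\<close>, its natural size.\<close>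

definition Q :: "nat \<Rightarrow> real^'n \<Rightarrow> real \<Rightarrow> real" where
  "Q n \<eta> x = (norm (F n \<eta> x))\<^sup>2 + (norm (F1 n \<eta> x))\<^sup>2 / (norm \<eta>)\<^sup>2"

lemma continuous_on_Q: "continuous_on UNIV (Q n \<eta>)"
  unfolding Q_def
  by (cases "\<eta> = 0") (auto intro!: continuous_intros continuous_on_F continuous_on_F1)

lemma Q_nonneg: "Q n \<eta> x \<ge> 0"
  by (simp add: Q_def)

lemma Q_periodic: "Q n \<eta> (x + 1) = Q n \<eta> x"
  by (simp add: Q_def F_periodic F1_periodic)

lemma S1_append: "S1 (a @ u) x = S1 a x + matpow A (length a) *v ((1 / real l ^ length a) *\<^sub>R S1 u (branch l a x))"
proof -
  have "((\<lambda>x. S a x + matpow A (length a) *v S u (branch l a x)) has_vector_derivative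
      S1 a x + matpow A (length a) *v ((1 / real l ^ length a) *\<^sub>R S1 u (branch l a x))) (at x)"
    by (rule has_vector_derivative_add[OF S_deriv matpow_deriv[OF compose_branch_deriv[OF S_deriv]]])
  moreover have "(\<lambda>x. S a x + matpow A (length a) *v S u (branch l a x)) = S (a @ u)"
    by (rule ext) (rule S_append[symmetric])
  ultimately have "(S (a @ u) has_vector_derivative
      S1 a x + matpow A (length a) *v ((1 / real l ^ length a) *\<^sub>R S1 u (branch l a x))) (at x)" by (simp only:)
  then show ?thesis using S_deriv vector_derivative_unique_at by blast
qed

lemma S1_Lipschitz: "norm (S1 w x - S1 w y) \<le> \<alpha> A \<kappa> * \<bar>x - y\<bar>"
proof -
  have "norm (S1 w x - S1 w y) \<le> \<alpha> A \<kappa> * norm (x - y)"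
  proof (rule differentiable_bound[of UNIV "S1 w" "\<lambda>x h. h *\<^sub>R S2 w x"])
    fix x :: real
    show "(S1 w has_derivative (\<lambda>h. h *\<^sub>R S2 w x)) (at x within UNIV)"
      using S1_deriv[of w x] by (simp add: has_vector_derivative_def)
    show "onorm (\<lambda>h. h *\<^sub>R S2 w x) \<le> \<alpha> A \<kappa>"
      using norm_S2[of w x] by (intro onorm_le) (auto simp: mult.commute intro: mult_left_mono)
  qed auto
  then show ?thesis by simp
qed

text \<open>
  The function \<open>E n \<eta> w\<close> is the part of the Fourier transform that belongs to the branch \<open>w\<close>; in
  the region of interest it oscillates with frequency about \<open>inner \<eta> (S1 w x)\<close>.
\<close>

definition E :: "nat \<Rightarrow> real^'n \<Rightarrow> nat list \<Rightarrow> real \<Rightarrow> complex" where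
  "E n \<eta> w x = cis (- 2 * pi * inner \<eta> (S w x)) * F n (freq A (length w) \<eta>) (branch l w x)"

lemma continuous_on_E: "continuous_on UNIV (E n \<eta> w)"
  unfolding E_def
  by (intro continuous_intros continuous_on_S continuous_on_compose2[OF continuous_on_F continuous_on_branch]) auto

lemma norm_E: "norm (E n \<eta> w x) = norm (F n (freq A (length w) \<eta>) (branch l w x))"
  by (simp add: E_def norm_mult)

lemma F_sum_E: "F (q + n) \<eta> x = (\<Sum>a\<in>words l q. E n \<eta> a x) / of_nat l ^ q"
  unfolding F_add E_def by (intro arg_cong2[where f = "(/)"] sum.cong refl) (simp only: length_words)

lemma E_sum_E: "E (m + n) \<eta> a x = (\<Sum>u\<in>words l m. E n \<eta> (a @ u) x / of_nat l ^ m)"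
proof -
  let ?q = "length a"
  have "E n \<eta> (a @ u) x = cis (- 2 * pi * inner \<eta> (S a x)) * E n (freq A ?q \<eta>) u (branch l a x)" for u
  proof -
    have "inner \<eta> (S (a @ u) x) = inner \<eta> (S a x) + inner (freq A ?q \<eta>) (S u (branch l a x))"
      unfolding S_append inner_add_right inner_matpow ..
    then have "cis (- 2 * pi * inner \<eta> (S (a @ u) x)) = cis (- 2 * pi * inner \<eta> (S a x)) *
      cis (- 2 * pi * inner (freq A ?q \<eta>) (S u (branch l a x)))"
      unfolding cis_mult by (simp only: distrib_left)
    then show ?thesis unfolding E_def length_append freq_add branch_append by (simp only: mult.assoc)
  qed
  then show ?thesis unfolding E_def[of "m + n"] F_sum_E
    by (simp only: sum_distrib_left[symmetric] sum_divide_distrib[symmetric] times_divide_eq_right)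
qed

text \<open>
  What one partial integration yields for a phase with derivative at least \<open>\<rho>\<close> on a window of length
  \<open>3 * \<delta>\<close>: the three terms come from the derivatives of the bump, of the phase derivative, and of the
  amplitude.
\<close>

definition osc_const :: "nat \<Rightarrow> real \<Rightarrow> real \<Rightarrow> real^'n \<Rightarrow> real" where
  "osc_const r \<delta> \<rho> \<eta> = (3 / (2 * \<delta>)) / \<rho> + 9/8 * (2 * \<alpha> A \<kappa> * norm \<eta>) / \<rho>\<^sup>2
     + 9/8 * (norm (freq A r \<eta>) / real l ^ r) / \<rho>"

text \<open>
  The bump \<open>(x - u) * (v - x) / (2 * \<delta>\<^sup>2)\<close> vanishes at the ends of the window, which removes the boundary
  terms of the partial integration, and it is at least 1 in the middle third.
\<close>

definition bump :: "real \<Rightarrow> real \<Rightarrow> real \<Rightarrow> real" where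
  "bump x0 \<delta> x = (x - (x0 - \<delta>)) * (x0 + 2 * \<delta> - x) / (2 * \<delta>\<^sup>2)"

lemma bump_facts:
  assumes "\<delta> > 0" "x \<in> {x0 - \<delta>..x0 + 2 * \<delta>}"
  shows "0 \<le> bump x0 \<delta> x" "bump x0 \<delta> x \<le> 9/8" "\<bar>(2 * x0 + \<delta> - 2 * x) / (2 * \<delta>\<^sup>2)\<bar> \<le> 3 / (2 * \<delta>)"
    "x \<in> {x0..x0 + \<delta>} \<Longrightarrow> bump x0 \<delta> x \<ge> 1"
proof -
  define t where "t = (x - x0) / \<delta>"
  have x: "x = x0 + t * \<delta>" using assms(1) by (simp add: t_def)
  have t: "-1 \<le> t" "t \<le> 2" using assms by (auto simp: t_def divide_simps)
  have b: "bump x0 \<delta> x = (t + 1) * (2 - t) / 2"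
    using assms(1) unfolding bump_def x by (simp add: field_simps power2_eq_square)
  show "0 \<le> bump x0 \<delta> x" unfolding b using t by auto
  have "0 \<le> (t - 1/2)^2" by simp
  then show "bump x0 \<delta> x \<le> 9/8" unfolding b by (simp add: field_simps power2_eq_square)
  have "(2 * x0 + \<delta> - 2 * x) / (2 * \<delta>\<^sup>2) = (1 - 2 * t) / (2 * \<delta>)"
    using assms(1) unfolding x by (simp add: field_simps power2_eq_square)
  moreover have "\<bar>1 - 2 * t\<bar> \<le> 3" using t by auto
  ultimately show "\<bar>(2 * x0 + \<delta> - 2 * x) / (2 * \<delta>\<^sup>2)\<bar> \<le> 3 / (2 * \<delta>)"
    using assms(1) by (simp add: abs_divide divide_right_mono)
  assume "x \<in> {x0..x0 + \<delta>}"
  then have "0 \<le> t" "t \<le> 1" using assms(1) by (auto simp: t_def divide_simps)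
  then have "0 \<le> t * (1 - t)" by (intro mult_nonneg_nonneg) auto
  then show "bump x0 \<delta> x \<ge> 1" unfolding b by (simp add: field_simps)
qed

lemma bump_deriv: "(bump x0 \<delta> has_vector_derivative (2 * x0 + \<delta> - 2 * x) / (2 * \<delta>\<^sup>2)) (at x)"
proof (cases "\<delta> = 0")
  case False
  then show ?thesis
    unfolding bump_def has_real_derivative_iff_has_vector_derivative[symmetric]
    by (auto intro!: derivative_eq_intros simp: field_simps)
next
  case True
  then show ?thesis unfolding bump_def by simp
qed

lemma continuous_on_bump: "continuous_on X (bump x0 \<delta>)"
  by (rule continuous_at_imp_continuous_on, rule ballI, rule has_vector_derivative_continuous, rule bump_deriv)

text \<open>
  The product of two branches has the amplitude \<open>g\<close>, which varies slowly, since the branches contract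
  by \<open>l^r\<close>, and the phase \<open>inner \<eta> (S w x - S w' x)\<close>, to which the bound for oscillatory integrals applies.  The mixed
  products are split symmetrically, so that the sum over all pairs stays linear in \<open>Q\<close>.
\<close>

lemma transversal_pair:
  fixes x0 \<delta> :: real
  defines "u \<equiv> x0 - \<delta>" and "v \<equiv> x0 + 2 * \<delta>"
  assumes w: "length w = r" "length w' = r" and \<delta>: "\<delta> > 0" and \<rho>: "\<rho> > 0"
    and tr: "\<And>x. x \<in> {u..v} \<Longrightarrow> \<bar>inner \<eta> (S1 w x - S1 w' x)\<bar> \<ge> \<rho>"
    and nz: "freq A r \<eta> \<noteq> 0"
  shows "norm (integral {u..v} (\<lambda>x. of_real (bump x0 \<delta> x) * (E n \<eta> w x * cnj (E n \<eta> w' x))))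
    \<le> osc_const r \<delta> \<rho> \<eta> / 2 * (integral {u..v} (\<lambda>x. Q n (freq A r \<eta>) (branch l w x))
        + integral {u..v} (\<lambda>x. Q n (freq A r \<eta>) (branch l w' x)))"
proof -
  let ?\<eta> = "freq A r \<eta>"
  let ?c = "1 / real l ^ r"
  let ?G = "\<lambda>w x. F n ?\<eta> (branch l w x)" and ?G1 = "\<lambda>w x. ?c *\<^sub>R F1 n ?\<eta> (branch l w x)"
  define g where "g = (\<lambda>x. ?G w x * cnj (?G w' x))"
  define g1 where "g1 = (\<lambda>x. ?G w x * cnj (?G1 w' x) + ?G1 w x * cnj (?G w' x))"
  have G: "(?G w has_vector_derivative ?G1 w x) (at x)" if "length w = r" for w x
    using compose_branch_deriv[of "F n ?\<eta>" "F1 n ?\<eta>" w x, OF F_deriv] that by (simp only:)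
  have gd: "(g has_vector_derivative g1 x) (at x)" for x
    unfolding g_def g1_def
    by (rule has_vector_derivative_mult[OF G[OF w(1)] has_vector_derivative_cnj[OF G[OF w(2)]]])
  have \<theta>d: "((\<lambda>x. inner \<eta> (S w x - S w' x)) has_vector_derivative inner \<eta> (S1 w x - S1 w' x)) (at x)" for x
    by (rule bounded_linear.has_vector_derivative[OF bounded_linear_inner_right has_vector_derivative_diff[OF S_deriv S_deriv]])
  have \<theta>1d: "((\<lambda>x. inner \<eta> (S1 w x - S1 w' x)) has_vector_derivative inner \<eta> (S2 w x - S2 w' x)) (at x)" for x
    by (rule bounded_linear.has_vector_derivative[OF bounded_linear_inner_right has_vector_derivative_diff[OF S1_deriv S1_deriv]])
  have cQ: "continuous_on UNIV (\<lambda>x. Q n ?\<eta> (branch l w x))" for w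
    by (rule continuous_on_compose2[OF continuous_on_Q continuous_on_branch]) auto
  have cG: "continuous_on X (?G w)" "continuous_on X (?G1 w)" for w X
    by (intro continuous_intros continuous_on_compose2[OF continuous_on_F continuous_on_branch]
        continuous_on_compose2[OF continuous_on_F1 continuous_on_branch]; auto)+
  have K: "\<bar>inner \<eta> (S2 w x - S2 w' x)\<bar> \<le> 2 * \<alpha> A \<kappa> * norm \<eta>" for x
  proof -
    have "\<bar>inner \<eta> (S2 w x - S2 w' x)\<bar> \<le> norm \<eta> * norm (S2 w x - S2 w' x)" by (rule Cauchy_Schwarz_ineq2)
    also have "norm \<eta> * norm (S2 w x - S2 w' x) \<le> norm \<eta> * (2 * \<alpha> A \<kappa>)"
    proof (rule mult_left_mono)
      show "norm (S2 w x - S2 w' x) \<le> 2 * \<alpha> A \<kappa>"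
        using norm_triangle_ineq4[of "S2 w x" "S2 w' x"] norm_S2[of w x] norm_S2[of w' x] by linarith
    qed simp
    finally show ?thesis by (simp only: mult_ac)
  qed
  let ?B1 = "3 / (2 * \<delta>)" and ?K = "2 * \<alpha> A \<kappa> * norm \<eta>"
  have "E n \<eta> w x * cnj (E n \<eta> w' x) = cis (- 2 * pi * inner \<eta> (S w x - S w' x)) * g x" for x
  proof -
    have "cis (- 2 * pi * inner \<eta> (S w x - S w' x)) = cis (- 2 * pi * inner \<eta> (S w x)) * cnj (cis (- 2 * pi * inner \<eta> (S w' x)))"
    proof -
      have "- 2 * pi * inner \<eta> (S w x - S w' x) = - 2 * pi * inner \<eta> (S w x) + - (- 2 * pi * inner \<eta> (S w' x))"
        unfolding inner_diff_right by (simp add: right_diff_distrib)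
      then show ?thesis unfolding cis_cnj cis_mult by (simp only:)
    qed
    then show ?thesis unfolding E_def g_def w by (simp only: complex_cnj_mult mult_ac)
  qed
  then have "norm (integral {u..v} (\<lambda>x. of_real (bump x0 \<delta> x) * (E n \<eta> w x * cnj (E n \<eta> w' x))))
    = norm (integral {u..v} (\<lambda>x. of_real (bump x0 \<delta> x) * (cis (- 2 * pi * inner \<eta> (S w x - S w' x)) * g x)))"
    by (simp only:)
  also have "\<dots> \<le> integral {u..v} (\<lambda>x. (?B1 / \<rho> + 9/8 * ?K / \<rho>\<^sup>2) * norm (g x) + 9/8 / \<rho> * norm (g1 x))"
  proof (rule oscillatory_integral_bound[OF _ \<theta>d \<theta>1d bump_deriv gd _ _ _ _ _ \<rho> tr K])
    show "continuous_on {u..v} g1" unfolding g1_def by (intro continuous_intros cG)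
    show "\<bar>bump x0 \<delta> x\<bar> \<le> 9/8" if "x \<in> {u..v}" for x
      using bump_facts(1,2)[OF \<delta>, of x x0] that by (simp add: u_def v_def)
    show "\<bar>(2 * x0 + \<delta> - 2 * x) / (2 * \<delta>\<^sup>2)\<bar> \<le> ?B1" if "x \<in> {u..v}" for x
      using bump_facts(3)[OF \<delta>, of x x0] that by (simp only: u_def v_def)
    show "continuous_on {u..v} (\<lambda>x. (2 * x0 + \<delta> - 2 * x) / (2 * \<delta>\<^sup>2))"
      using \<delta> by (intro continuous_intros) auto
    show "bump x0 \<delta> u = 0" "bump x0 \<delta> v = 0" by (simp_all add: bump_def u_def v_def)
    show "continuous_on {u..v} (\<lambda>x. inner \<eta> (S2 w x - S2 w' x))" by (intro continuous_intros continuous_on_S2)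
    show "u \<le> v" using \<delta> by (simp add: u_def v_def)
  qed
  also have "\<dots> \<le> integral {u..v} (\<lambda>x. osc_const r \<delta> \<rho> \<eta> / 2 * (Q n ?\<eta> (branch l w x) + Q n ?\<eta> (branch l w' x)))"
  proof (rule integral_le)
    have "continuous_on {u..v} g" "continuous_on {u..v} g1"
      unfolding g_def g1_def by (intro continuous_intros cG)+
    then show "(\<lambda>x. (?B1 / \<rho> + 9/8 * ?K / \<rho>\<^sup>2) * norm (g x) + 9/8 / \<rho> * norm (g1 x)) integrable_on {u..v}"
      by (intro integrable_continuous_interval continuous_on_add continuous_on_mult_left continuous_on_norm)
    show "(\<lambda>x. osc_const r \<delta> \<rho> \<eta> / 2 * (Q n ?\<eta> (branch l w x) + Q n ?\<eta> (branch l w' x))) integrable_on {u..v}"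
      by (intro integrable_cont continuous_intros cQ)
    fix x assume x: "x \<in> {u..v}"
    let ?q = "\<lambda>w. Q n ?\<eta> (branch l w x)"
    have amgm: "a * b \<le> (a\<^sup>2 + b\<^sup>2) / 2" for a b :: real
      using sum_squares_bound[of a b] by simp
    have Qd: "?q w = (norm (?G w x))\<^sup>2 + (norm (F1 n ?\<eta> (branch l w x)) / norm ?\<eta>)\<^sup>2" for w
      by (simp only: Q_def power_divide)
    have n0: "norm ?\<eta> > 0" using nz by simp
    have G1n: "norm (?G1 w x) = (norm ?\<eta> / real l ^ r) * (norm (F1 n ?\<eta> (branch l w x)) / norm ?\<eta>)" for w
      using n0 l0 by (simp add: divide_simps)
    have cross: "norm (?G w x) * norm (?G1 w' x) \<le> norm ?\<eta> / real l ^ r * (((norm (?G w x))\<^sup>2 + (norm (F1 n ?\<eta> (branch l w' x)) / norm ?\<eta>)\<^sup>2) / 2)" for w w'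
    proof -
      have "norm (?G w x) * norm (?G1 w' x) = (norm ?\<eta> / real l ^ r) * (norm (?G w x) * (norm (F1 n ?\<eta> (branch l w' x)) / norm ?\<eta>))"
        unfolding G1n by (simp only: mult_ac)
      also have "\<dots> \<le> norm ?\<eta> / real l ^ r * (((norm (?G w x))\<^sup>2 + (norm (F1 n ?\<eta> (branch l w' x)) / norm ?\<eta>)\<^sup>2) / 2)"
        using l0 by (intro mult_left_mono amgm) auto
      finally show ?thesis .
    qed
    have gn: "norm (g x) \<le> (?q w + ?q w') / 2"
    proof -
      have "norm (g x) = norm (?G w x) * norm (?G w' x)" by (simp only: g_def norm_mult complex_mod_cnj)
      also have "\<dots> \<le> ((norm (?G w x))\<^sup>2 + (norm (?G w' x))\<^sup>2) / 2" by (rule amgm)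
      also have "\<dots> \<le> (?q w + ?q w') / 2" unfolding Qd by (intro divide_right_mono add_mono) auto
      finally show ?thesis .
    qed
    have g1n: "norm (g1 x) \<le> norm ?\<eta> / real l ^ r * ((?q w + ?q w') / 2)"
    proof -
      have "norm (g1 x) \<le> norm (?G w x) * norm (?G1 w' x) + norm (?G w' x) * norm (?G1 w x)"
        unfolding g1_def by (rule norm_triangle_le) (simp only: norm_mult complex_mod_cnj mult_ac)
      also have "\<dots> \<le> norm ?\<eta> / real l ^ r * (((norm (?G w x))\<^sup>2 + (norm (F1 n ?\<eta> (branch l w' x)) / norm ?\<eta>)\<^sup>2) / 2)
          + norm ?\<eta> / real l ^ r * (((norm (?G w' x))\<^sup>2 + (norm (F1 n ?\<eta> (branch l w x)) / norm ?\<eta>)\<^sup>2) / 2)"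
        by (intro add_mono cross)
      also have "\<dots> = norm ?\<eta> / real l ^ r * ((?q w + ?q w') / 2)"
        unfolding Qd distrib_left[symmetric] add_divide_distrib[symmetric] by (simp only: add_ac)
      finally show ?thesis .
    qed
    have k1: "0 \<le> ?B1 / \<rho> + 9/8 * ?K / \<rho>\<^sup>2" using \<delta> \<rho> \<alpha>_pos by (intro add_nonneg_nonneg divide_nonneg_nonneg mult_nonneg_nonneg) auto
    have k2: "0 \<le> 9/8 / \<rho>" using \<rho> by simp
    have "(?B1 / \<rho> + 9/8 * ?K / \<rho>\<^sup>2) * norm (g x) + 9/8 / \<rho> * norm (g1 x)
      \<le> (?B1 / \<rho> + 9/8 * ?K / \<rho>\<^sup>2) * ((?q w + ?q w') / 2) + 9/8 / \<rho> * (norm ?\<eta> / real l ^ r * ((?q w + ?q w') / 2))"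
      by (intro add_mono mult_left_mono gn g1n k1 k2)
    also have "\<dots> = osc_const r \<delta> \<rho> \<eta> / 2 * (?q w + ?q w')"
    proof -
      have "k * (t / 2) + 9/8 / \<rho> * (c * (t / 2)) = (k + 9/8 * c / \<rho>) / 2 * t" for k t c :: real
        unfolding divide_inverse by (simp only: distrib_right distrib_left mult_ac)
      then show ?thesis unfolding osc_const_def by (simp only:)
    qed
    finally show "(?B1 / \<rho> + 9/8 * ?K / \<rho>\<^sup>2) * norm (g x) + 9/8 / \<rho> * norm (g1 x) \<le> osc_const r \<delta> \<rho> \<eta> / 2 * (?q w + ?q w')" .
  qed
  also have "\<dots> = osc_const r \<delta> \<rho> \<eta> / 2 * (integral {u..v} (\<lambda>x. Q n ?\<eta> (branch l w x)) + integral {u..v} (\<lambda>x. Q n ?\<eta> (branch l w' x)))"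
    unfolding integral_mult_right
    by (subst Henstock_Kurzweil_Integration.integral_add) (auto intro!: integrable_cont cQ)
  finally show ?thesis .
qed

text \<open>
  With \<open>- \<xi>\<close> the integer next to \<open>inner \<eta> (S1 a x0)\<close>, all near partners of \<open>a\<close> are among the words counted for
  \<open>\<xi>\<close>, since \<open>3/2 * e + 1/2 < 2 * e\<close>.
\<close>

lemma near_count:
  assumes e: "e > 1" and count: "\<And>\<xi>::int. card {a \<in> words l q. \<bar>real_of_int \<xi> + inner \<eta> (S1 a x0)\<bar> < 2 * e} \<le> M"
  shows "card {b \<in> words l q. \<bar>inner \<eta> (S1 a x0 - S1 b x0)\<bar> < 3/2 * e} \<le> M"
proof -
  define \<xi> where "\<xi> = round (- inner \<eta> (S1 a x0))"
  have r: "\<bar>real_of_int \<xi> - (- inner \<eta> (S1 a x0))\<bar> \<le> 1/2" unfolding \<xi>_def by (rule of_int_round_abs_le)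
  have "{b \<in> words l q. \<bar>inner \<eta> (S1 a x0 - S1 b x0)\<bar> < 3/2 * e} \<subseteq> {a \<in> words l q. \<bar>real_of_int \<xi> + inner \<eta> (S1 a x0)\<bar> < 2 * e}"
  proof
    fix b assume "b \<in> {b \<in> words l q. \<bar>inner \<eta> (S1 a x0 - S1 b x0)\<bar> < 3/2 * e}"
    then have b: "b \<in> words l q" "\<bar>inner \<eta> (S1 a x0) - inner \<eta> (S1 b x0)\<bar> < 3/2 * e" by (simp_all add: inner_diff_right)
    have "\<bar>real_of_int \<xi> + inner \<eta> (S1 b x0)\<bar> < 2 * e" using r b(2) e by linarith
    then show "b \<in> {a \<in> words l q. \<bar>real_of_int \<xi> + inner \<eta> (S1 a x0)\<bar> < 2 * e}" using b(1) by simp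
  qed
  then have "card {b \<in> words l q. \<bar>inner \<eta> (S1 a x0 - S1 b x0)\<bar> < 3/2 * e}
      \<le> card {a \<in> words l q. \<bar>real_of_int \<xi> + inner \<eta> (S1 a x0)\<bar> < 2 * e}" by (rule card_mono[rotated]) simp
  also have "\<dots> \<le> M" by (rule count)
  finally show ?thesis .
qed

text \<open>
  If two branches are transversal over the centre of a short window, then so are, over the whole
  window, all their refinements: the derivatives of \<open>S w\<close> are at most \<open>\<alpha> A \<kappa> / 2\<close>, and the scale \<open>e\<close> is
  twice the bound which this gives for the contribution of the later letters.
\<close>

lemma far_refined:
  assumes len: "length a = q" "length b = q"
    and far: "\<bar>inner \<eta> (S1 a x0 - S1 b x0)\<bar> \<ge> 3/2 * e"
    and e: "e = \<alpha> A \<kappa> / real l ^ q * norm (freq A q \<eta>)"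
    and \<delta>: "16 * (\<alpha> A \<kappa> * norm \<eta> * \<delta>) \<le> e" "\<bar>x - x0\<bar> \<le> 2 * \<delta>"
  shows "\<bar>inner \<eta> (S1 (a @ s) x - S1 (b @ t) x)\<bar> \<ge> e / 4"
proof -
  have drift: "\<bar>inner \<eta> (S1 w x) - inner \<eta> (S1 w x0)\<bar> \<le> e / 8" for w
  proof -
    have "\<bar>inner \<eta> (S1 w x - S1 w x0)\<bar> \<le> norm \<eta> * norm (S1 w x - S1 w x0)" by (rule Cauchy_Schwarz_ineq2)
    also have "\<dots> \<le> norm \<eta> * (\<alpha> A \<kappa> * (2 * \<delta>))"
      using S1_Lipschitz[of w x x0] \<alpha>_pos \<delta>(2)
      by (intro mult_left_mono order.trans[OF S1_Lipschitz]) auto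
    also have "\<dots> \<le> e / 8" using \<delta>(1) by (simp add: mult_ac)
    finally show ?thesis by (simp add: inner_diff_right)
  qed
  have tail: "\<bar>inner \<eta> (S1 (a @ s) x) - inner \<eta> (S1 a x)\<bar> \<le> e / 2" if "length a = q" for a s
  proof -
    have "inner \<eta> (S1 (a @ s) x) - inner \<eta> (S1 a x) = 1 / real l ^ q * inner (freq A q \<eta>) (S1 s (branch l a x))"
      unfolding S1_append inner_add_right that inner_matpow inner_scaleR_right by simp
    also have "\<bar>\<dots>\<bar> = 1 / real l ^ q * \<bar>inner (freq A q \<eta>) (S1 s (branch l a x))\<bar>"
      using l0 by (simp add: abs_mult)
    also have "\<dots> \<le> 1 / real l ^ q * (norm (freq A q \<eta>) * (\<alpha> A \<kappa> / 2))"
      using l0 by (intro mult_left_mono order.trans[OF Cauchy_Schwarz_ineq2] norm_S1) auto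
    also have "\<dots> = e / 2" unfolding e by (simp only: times_divide_eq_right times_divide_eq_left mult_1 mult_ac divide_divide_eq_left)
    finally show ?thesis .
  qed
  have "inner \<eta> (S1 a x0 - S1 b x0) = inner \<eta> (S1 a x0) - inner \<eta> (S1 b x0)"
    "inner \<eta> (S1 (a @ s) x - S1 (b @ t) x) = inner \<eta> (S1 (a @ s) x) - inner \<eta> (S1 (b @ t) x)"
    by (rule inner_diff_right)+
  then show ?thesis
    using far drift[of a] drift[of b] tail[OF len(1), of s] tail[OF len(2), of t] by linarith
qed

text \<open>
  The square of the sum over all words of length \<open>q\<close>, against a bump, splits into pairs.  Near pairs are
  estimated by the arithmetic-geometric mean inequality and counted; each word has at most \<open>M\<close> near
  partners, and \<open>9/8\<close> is the maximum of the bump.  Pairs that are not near are refined to words of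
  length \<open>q + m\<close>, all of which are transversal.
\<close>

lemma window_bound:
  fixes x0 \<delta> :: real
  defines "u \<equiv> x0 - \<delta>" and "v \<equiv> x0 + 2 * \<delta>"
  assumes e: "e = \<alpha> A \<kappa> / real l ^ q * norm (freq A q \<eta>)" "e > 1"
    and \<delta>: "\<delta> > 0" "16 * (\<alpha> A \<kappa> * norm \<eta> * \<delta>) \<le> e"
    and count: "\<And>\<xi>::int. card {a \<in> words l q. \<bar>real_of_int \<xi> + inner \<eta> (S1 a x0)\<bar> < 2 * e} \<le> M"
    and nz: "freq A (q + m) \<eta> \<noteq> 0"
  shows "integral {x0..x0 + \<delta>} (\<lambda>x. (norm (F (q + (m + n)) \<eta> x))\<^sup>2)
    \<le> 9/8 * real M / (real l ^ q)\<^sup>2 * (\<Sum>a\<in>words l q. integral {u..v} (\<lambda>x. (norm (F (m + n) (freq A q \<eta>) (branch l a x)))\<^sup>2))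
      + osc_const (q + m) \<delta> (e / 4) \<eta> / real l ^ (q + m)
          * (\<Sum>w\<in>words l (q + m). integral {u..v} (\<lambda>x. Q n (freq A (q + m) \<eta>) (branch l w x)))"
proof -
  let ?W = "words l q" and ?V = "words l m"
  define I where "I = (\<lambda>a. integral {u..v} (\<lambda>x. (norm (F (m + n) (freq A q \<eta>) (branch l a x)))\<^sup>2))"
  define J where "J = (\<lambda>w. integral {u..v} (\<lambda>x. Q n (freq A (q + m) \<eta>) (branch l w x)))"
  define K where "K = osc_const (q + m) \<delta> (e / 4) \<eta>"
  define near where "near = (\<lambda>a b. \<bar>inner \<eta> (S1 a x0 - S1 b x0)\<bar> < 3/2 * e)"
  define pair where "pair = (\<lambda>a b. norm (integral {u..v} (\<lambda>x. of_real (bump x0 \<delta> x) * (E (m + n) \<eta> a x * cnj (E (m + n) \<eta> b x)))))"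
  have e0: "e / 4 > 0" using e(2) by simp
  have K0: "K \<ge> 0" unfolding K_def osc_const_def using \<delta>(1) e0 \<alpha>_pos l0
    by (intro add_nonneg_nonneg divide_nonneg_nonneg mult_nonneg_nonneg) auto
  have cI: "continuous_on UNIV (\<lambda>x. (norm (F (m + n) (freq A q \<eta>) (branch l a x)))\<^sup>2)" for a
    by (intro continuous_intros continuous_on_compose2[OF continuous_on_F continuous_on_branch]) auto
  have cJ: "continuous_on UNIV (\<lambda>x. Q n (freq A (q + m) \<eta>) (branch l w x))" for w
    by (rule continuous_on_compose2[OF continuous_on_Q continuous_on_branch]) auto
  have I0: "I a \<ge> 0" for a unfolding I_def by (rule integral_nonneg[OF integrable_cont[OF cI]]) simp
  have J0: "J w \<ge> 0" for w unfolding J_def by (rule integral_nonneg[OF integrable_cont[OF cJ]]) (rule Q_nonneg)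
  have near_pair: "pair a b \<le> 9/16 * (I a + I b)" if ab: "a \<in> ?W" "b \<in> ?W" for a b
  proof -
    let ?f = "\<lambda>a x. (norm (F (m + n) (freq A q \<eta>) (branch l a x)))\<^sup>2"
    have "pair a b \<le> integral {u..v} (\<lambda>x. 9/16 * (?f a x + ?f b x))"
      unfolding pair_def
    proof (rule integral_norm_bound_integral)
      show "(\<lambda>x. of_real (bump x0 \<delta> x) * (E (m + n) \<eta> a x * cnj (E (m + n) \<eta> b x))) integrable_on {u..v}"
        by (intro integrable_cont continuous_intros continuous_on_bump continuous_on_E)
      show "(\<lambda>x. 9/16 * (?f a x + ?f b x)) integrable_on {u..v}"
        by (intro integrable_cont continuous_intros cI)
      fix x assume x: "x \<in> {u..v}"
      have bx: "0 \<le> bump x0 \<delta> x" "bump x0 \<delta> x \<le> 9/8"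
        using bump_facts(1,2)[OF \<delta>(1), of x x0] x by (simp_all add: u_def v_def)
      have nE: "(norm (E (m + n) \<eta> c x))\<^sup>2 = ?f c x" if "c \<in> ?W" for c
        using length_words[OF that] by (simp only: norm_E)
      have "norm (of_real (bump x0 \<delta> x) * (E (m + n) \<eta> a x * cnj (E (m + n) \<eta> b x)))
          = bump x0 \<delta> x * (norm (E (m + n) \<eta> a x) * norm (E (m + n) \<eta> b x))"
        using bx(1) by (simp add: norm_mult)
      also have "\<dots> \<le> 9/8 * (((norm (E (m + n) \<eta> a x))\<^sup>2 + (norm (E (m + n) \<eta> b x))\<^sup>2) / 2)"
        using bx sum_squares_bound[of "norm (E (m + n) \<eta> a x)" "norm (E (m + n) \<eta> b x)"]
        by (intro mult_mono) auto
      also have "\<dots> = 9/16 * (?f a x + ?f b x)" unfolding nE[OF ab(1)] nE[OF ab(2)] by simp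
      finally show "norm (of_real (bump x0 \<delta> x) * (E (m + n) \<eta> a x * cnj (E (m + n) \<eta> b x))) \<le> 9/16 * (?f a x + ?f b x)" .
    qed
    also have "\<dots> = 9/16 * (I a + I b)"
      unfolding I_def integral_mult_right
      by (subst Henstock_Kurzweil_Integration.integral_add) (auto intro!: integrable_cont cI)
    finally show ?thesis .
  qed
  have far_pair: "pair a b \<le> K / (2 * (real l ^ m)\<^sup>2) * (\<Sum>s\<in>?V. \<Sum>t\<in>?V. J (a @ s) + J (b @ t))"
    if ab: "a \<in> ?W" "b \<in> ?W" and far: "\<not> near a b" for a b
  proof -
    have "pair a b \<le> (\<Sum>s\<in>?V. \<Sum>t\<in>?V. norm (integral {u..v} (\<lambda>x. of_real (bump x0 \<delta> x) *
        (E n \<eta> (a @ s) x / of_nat l ^ m * cnj (E n \<eta> (b @ t) x / of_nat l ^ m)))))"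
      unfolding pair_def E_sum_E using l0
      by (intro norm_integral_double_sum_le finite_words continuous_intros continuous_on_E continuous_on_bump) auto
    also have "\<dots> \<le> (\<Sum>s\<in>?V. \<Sum>t\<in>?V. K / (2 * (real l ^ m)\<^sup>2) * (J (a @ s) + J (b @ t)))"
    proof (intro sum_mono)
      fix s t assume st: "s \<in> ?V" "t \<in> ?V"
      have len: "length (a @ s) = q + m" "length (b @ t) = q + m"
        using length_words ab st by (metis length_append)+
      have "(\<lambda>x. of_real (bump x0 \<delta> x) * (E n \<eta> (a @ s) x / of_nat l ^ m * cnj (E n \<eta> (b @ t) x / of_nat l ^ m)))
        = (\<lambda>x. (1 / (of_nat l ^ m)\<^sup>2) * (of_real (bump x0 \<delta> x) * (E n \<eta> (a @ s) x * cnj (E n \<eta> (b @ t) x))))"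
        by (simp add: power2_eq_square mult_ac)
      then have "norm (integral {u..v} (\<lambda>x. of_real (bump x0 \<delta> x) * (E n \<eta> (a @ s) x / of_nat l ^ m * cnj (E n \<eta> (b @ t) x / of_nat l ^ m))))
        = 1 / (real l ^ m)\<^sup>2 * norm (integral {u..v} (\<lambda>x. of_real (bump x0 \<delta> x) * (E n \<eta> (a @ s) x * cnj (E n \<eta> (b @ t) x))))"
        by (simp add: norm_mult norm_divide norm_power)
      also have "norm (integral {u..v} (\<lambda>x. of_real (bump x0 \<delta> x) * (E n \<eta> (a @ s) x * cnj (E n \<eta> (b @ t) x)))) \<le> K / 2 * (J (a @ s) + J (b @ t))"
        unfolding K_def J_def u_def v_def
      proof (rule transversal_pair[OF len \<delta>(1) e0 _ nz])
        fix x assume "x \<in> {x0 - \<delta>..x0 + 2 * \<delta>}"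
        then have xd: "\<bar>x - x0\<bar> \<le> 2 * \<delta>" using \<delta>(1) by auto
        have far': "3/2 * e \<le> \<bar>inner \<eta> (S1 a x0 - S1 b x0)\<bar>" using far by (simp only: near_def not_less)
        show "e / 4 \<le> \<bar>inner \<eta> (S1 (a @ s) x - S1 (b @ t) x)\<bar>"
          by (rule far_refined[OF length_words[OF ab(1)] length_words[OF ab(2)] far' e(1) \<delta>(2) xd])
      qed
      finally show "norm (integral {u..v} (\<lambda>x. of_real (bump x0 \<delta> x) * (E n \<eta> (a @ s) x / of_nat l ^ m * cnj (E n \<eta> (b @ t) x / of_nat l ^ m))))
        \<le> K / (2 * (real l ^ m)\<^sup>2) * (J (a @ s) + J (b @ t))"
        using l0 by (simp add: divide_simps mult_ac)
    qed
    finally show ?thesis by (simp only: sum_distrib_left)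
  qed
  have JJ: "0 \<le> K / (2 * (real l ^ m)\<^sup>2) * (\<Sum>s\<in>?V. \<Sum>t\<in>?V. J (a @ s) + J (b @ t))" for a b
    using K0 by (intro mult_nonneg_nonneg sum_nonneg add_nonneg_nonneg J0) auto
  have pair_le: "pair a b \<le> 9/16 * ((if near a b then I a else 0) + (if near a b then I b else 0))
      + K / (2 * (real l ^ m)\<^sup>2) * (\<Sum>s\<in>?V. \<Sum>t\<in>?V. J (a @ s) + J (b @ t))" if "a \<in> ?W" "b \<in> ?W" for a b
  proof (cases "near a b")
    case True
    show ?thesis unfolding if_P[OF True] using near_pair[OF that] JJ[of a b] by linarith
  next
    case False
    show ?thesis unfolding if_not_P[OF False] using far_pair[OF that False] by (simp only: add_0_left mult_zero_right)
  qed
  have sym: "near a b \<longleftrightarrow> near b a" for a b unfolding near_def inner_diff_right by (simp add: abs_minus_commute)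
  have near_sum: "(\<Sum>a\<in>?W. \<Sum>b\<in>?W. if near a b then I a else 0) \<le> real M * (\<Sum>a\<in>?W. I a)"
  proof -
    have "(\<Sum>b\<in>?W. if near a b then I a else 0) \<le> real M * I a" for a
    proof -
      have "(\<Sum>b\<in>?W. if near a b then I a else 0) = (\<Sum>b\<in>{b \<in> ?W. near a b}. I a)"
        by (rule sum.inter_filter[symmetric]) simp
      also have "\<dots> = real (card {b \<in> ?W. near a b}) * I a" by simp
      also have "\<dots> \<le> real M * I a"
        using near_count[OF e(2) count, of a] unfolding near_def by (intro mult_right_mono I0) simp
      finally show ?thesis .
    qed
    then show ?thesis unfolding sum_distrib_left by (intro sum_mono) auto
  qed
  have near_sum': "(\<Sum>a\<in>?W. \<Sum>b\<in>?W. if near a b then I b else 0) \<le> real M * (\<Sum>a\<in>?W. I a)"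
    by (subst sum.swap) (use near_sum sym in \<open>simp cong: sum.cong\<close>)
  have J_sum: "(\<Sum>a\<in>?W. \<Sum>b\<in>?W. \<Sum>s\<in>?V. \<Sum>t\<in>?V. J (a @ s) + J (b @ t)) = 2 * real l ^ (q + m) * (\<Sum>w\<in>words l (q + m). J w)"
  proof -
    have "(\<Sum>a\<in>?W. \<Sum>b\<in>?W. \<Sum>s\<in>?V. \<Sum>t\<in>?V. J (a @ s)) = real l ^ (q + m) * (\<Sum>a\<in>?W. \<Sum>s\<in>?V. J (a @ s))"
      by (simp add: card_words sum_distrib_left power_add mult_ac)
    moreover have "(\<Sum>a\<in>?W. \<Sum>b\<in>?W. \<Sum>s\<in>?V. \<Sum>t\<in>?V. J (b @ t)) = real l ^ (q + m) * (\<Sum>a\<in>?W. \<Sum>s\<in>?V. J (a @ s))"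
      by (simp add: card_words sum_distrib_left power_add mult_ac)
    ultimately show ?thesis unfolding sum_words_append sum.distrib by simp
  qed
  define X where "X = integral {u..v} (\<lambda>x. bump x0 \<delta> x * (norm (\<Sum>a\<in>?W. E (m + n) \<eta> a x))\<^sup>2)"
  have cF: "continuous_on UNIV (\<lambda>x. bump x0 \<delta> x * (norm (\<Sum>a\<in>?W. E (m + n) \<eta> a x))\<^sup>2)"
    by (intro continuous_intros continuous_on_bump continuous_on_E)
  have "X \<le> norm (complex_of_real X)" by simp
  also have "complex_of_real X = integral {u..v} (\<lambda>x. of_real (bump x0 \<delta> x) * ((\<Sum>a\<in>?W. E (m + n) \<eta> a x) * cnj (\<Sum>a\<in>?W. E (m + n) \<eta> a x)))"
    unfolding X_def using integral_linear[OF integrable_cont[OF cF] bounded_linear_of_real[where 'a = complex], of u v]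
    by (simp add: o_def complex_norm_square[symmetric] del: cnj_sum)
  also have "norm \<dots> \<le> (\<Sum>a\<in>?W. \<Sum>b\<in>?W. pair a b)"
    unfolding pair_def by (intro norm_integral_double_sum_le finite_words continuous_on_E continuous_on_bump)
  also have "\<dots> \<le> (\<Sum>a\<in>?W. \<Sum>b\<in>?W. 9/16 * ((if near a b then I a else 0) + (if near a b then I b else 0))
      + K / (2 * (real l ^ m)\<^sup>2) * (\<Sum>s\<in>?V. \<Sum>t\<in>?V. J (a @ s) + J (b @ t)))"
    by (intro sum_mono pair_le)
  also have "\<dots> = 9/16 * ((\<Sum>a\<in>?W. \<Sum>b\<in>?W. if near a b then I a else 0) + (\<Sum>a\<in>?W. \<Sum>b\<in>?W. if near a b then I b else 0))
      + K / (2 * (real l ^ m)\<^sup>2) * (\<Sum>a\<in>?W. \<Sum>b\<in>?W. \<Sum>s\<in>?V. \<Sum>t\<in>?V. J (a @ s) + J (b @ t))"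
    unfolding sum.distrib[of "\<lambda>b. 9/16 * _ b"] sum.distrib sum_distrib_left distrib_left by (simp only:)
  also have "\<dots> \<le> 9/16 * (real M * (\<Sum>a\<in>?W. I a) + real M * (\<Sum>a\<in>?W. I a))
      + K / (2 * (real l ^ m)\<^sup>2) * (2 * real l ^ (q + m) * (\<Sum>w\<in>words l (q + m). J w))"
    unfolding J_sum
    by (rule add_mono[OF mult_left_mono[OF add_mono[OF near_sum near_sum']] order.refl]) simp
  also have "\<dots> = 9/8 * real M * (\<Sum>a\<in>?W. I a) + (real l ^ q)\<^sup>2 * (K / real l ^ (q + m) * (\<Sum>w\<in>words l (q + m). J w))"
  proof -
    have "K / (2 * x\<^sup>2) * (2 * (y * x) * T) = y\<^sup>2 * (K / (y * x) * T)" if "x > 0" "y > 0" for x y T :: real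
      using that by (simp add: field_simps power2_eq_square)
    from this[of "real l ^ m" "real l ^ q"] show ?thesis unfolding power_add using l0 by simp
  qed
  finally have X: "X \<le> 9/8 * real M * (\<Sum>a\<in>?W. I a) + (real l ^ q)\<^sup>2 * (K / real l ^ (q + m) * (\<Sum>w\<in>words l (q + m). J w))" .
  have "integral {x0..x0 + \<delta>} (\<lambda>x. (norm (F (q + (m + n)) \<eta> x))\<^sup>2)
      \<le> integral {u..v} (\<lambda>x. (1 / (real l ^ q)\<^sup>2) * (bump x0 \<delta> x * (norm (\<Sum>a\<in>?W. E (m + n) \<eta> a x))\<^sup>2))"
  proof -
    have c': "continuous_on UNIV (\<lambda>x. (1 / (real l ^ q)\<^sup>2) * (bump x0 \<delta> x * (norm (\<Sum>a\<in>?W. E (m + n) \<eta> a x))\<^sup>2))"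
      by (intro continuous_intros cF)
    have "integral {x0..x0 + \<delta>} (\<lambda>x. (norm (F (q + (m + n)) \<eta> x))\<^sup>2)
      \<le> integral {x0..x0 + \<delta>} (\<lambda>x. (1 / (real l ^ q)\<^sup>2) * (bump x0 \<delta> x * (norm (\<Sum>a\<in>?W. E (m + n) \<eta> a x))\<^sup>2))"
    proof (rule integral_le)
      show "(\<lambda>x. (norm (F (q + (m + n)) \<eta> x))\<^sup>2) integrable_on {x0..x0 + \<delta>}"
        by (intro integrable_cont continuous_intros continuous_on_F)
      show "(\<lambda>x. (1 / (real l ^ q)\<^sup>2) * (bump x0 \<delta> x * (norm (\<Sum>a\<in>?W. E (m + n) \<eta> a x))\<^sup>2)) integrable_on {x0..x0 + \<delta>}"
        by (rule integrable_cont[OF c'])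
      fix x assume x: "x \<in> {x0..x0 + \<delta>}"
      then have "bump x0 \<delta> x \<ge> 1" using \<delta>(1) by (intro bump_facts(4)[OF \<delta>(1)]) auto
      then have "1 * (norm (\<Sum>a\<in>?W. E (m + n) \<eta> a x))\<^sup>2 \<le> bump x0 \<delta> x * (norm (\<Sum>a\<in>?W. E (m + n) \<eta> a x))\<^sup>2"
        by (intro mult_right_mono) auto
      then show "(norm (F (q + (m + n)) \<eta> x))\<^sup>2 \<le> (1 / (real l ^ q)\<^sup>2) * (bump x0 \<delta> x * (norm (\<Sum>a\<in>?W. E (m + n) \<eta> a x))\<^sup>2)"
        unfolding F_sum_E using l0 by (simp add: norm_divide norm_power power_divide divide_right_mono)
    qed
    also have "\<dots> \<le> integral {u..v} (\<lambda>x. (1 / (real l ^ q)\<^sup>2) * (bump x0 \<delta> x * (norm (\<Sum>a\<in>?W. E (m + n) \<eta> a x))\<^sup>2))"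
    proof (rule integral_subset_le)
      show "{x0..x0 + \<delta>} \<subseteq> {u..v}" using \<delta>(1) by (auto simp: u_def v_def)
      show "\<forall>x\<in>{u..v}. 0 \<le> (1 / (real l ^ q)\<^sup>2) * (bump x0 \<delta> x * (norm (\<Sum>a\<in>?W. E (m + n) \<eta> a x))\<^sup>2)"
        using bump_facts(1)[OF \<delta>(1), of _ x0] by (auto simp: u_def v_def)
    qed (rule integrable_cont[OF c'])+
    finally show ?thesis .
  qed
  also have "\<dots> = 1 / (real l ^ q)\<^sup>2 * X" unfolding X_def by (rule integral_mult_right)
  also have "\<dots> \<le> 1 / (real l ^ q)\<^sup>2 * (9/8 * real M * (\<Sum>a\<in>?W. I a) + (real l ^ q)\<^sup>2 * (K / real l ^ (q + m) * (\<Sum>w\<in>words l (q + m). J w)))"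
    by (rule mult_left_mono[OF X]) simp
  also have "\<dots> = 9/8 * real M / (real l ^ q)\<^sup>2 * (\<Sum>a\<in>?W. I a) + K / real l ^ (q + m) * (\<Sum>w\<in>words l (q + m). J w)"
    using l0 by (simp add: distrib_left)
  finally show ?thesis unfolding I_def J_def K_def .
qed

text \<open>
  Summation over \<open>L\<close> windows that cover the circle.  They overlap three times, which is where
  \<open>27/8 = 3 * 9/8\<close> comes from, and the branches over the circle add up to \<open>l^q\<close> times the integral.
\<close>

theorem basic_inequality:
  assumes L: "L > 0" and e: "e = \<alpha> A \<kappa> / real l ^ q * norm (freq A q \<eta>)" "e > 1"
    and small: "16 * (\<alpha> A \<kappa> * norm \<eta>) \<le> e * real L"
    and count: "\<And>(\<xi>::int) x. x \<in> circle \<Longrightarrow> card {a \<in> words l q. \<bar>real_of_int \<xi> + inner \<eta> (S1 a x)\<bar> < 2 * e} \<le> M"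
    and nz: "freq A (q + m) \<eta> \<noteq> 0"
  shows "integral {0..1} (\<lambda>x. (norm (F (q + (m + n)) \<eta> x))\<^sup>2)
    \<le> 27/8 * real M / real l ^ q * integral {0..1} (\<lambda>x. (norm (F (m + n) (freq A q \<eta>) x))\<^sup>2)
      + 3 * osc_const (q + m) (1 / real L) (e / 4) \<eta> * integral {0..1} (Q n (freq A (q + m) \<eta>))"
proof -
  let ?f = "\<lambda>x. (norm (F (q + (m + n)) \<eta> x))\<^sup>2"
  let ?g = "\<lambda>x. (norm (F (m + n) (freq A q \<eta>) x))\<^sup>2" and ?h = "Q n (freq A (q + m) \<eta>)"
  let ?K = "osc_const (q + m) (1 / real L) (e / 4) \<eta>"
  let ?int = "\<lambda>j g. integral {real j / real L - 1 / real L..real j / real L + 2 / real L} g"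
  have cf: "continuous_on UNIV ?f" "continuous_on UNIV ?g" by (intro continuous_intros continuous_on_F)+
  have windows: "(\<Sum>j<L. \<Sum>w\<in>words l r. ?int j (\<lambda>x. g (branch l w x))) = 3 * (real l ^ r * integral {0..1} g)"
    if g: "continuous_on UNIV g" "\<And>x. g (x + 1) = g x" for g :: "real \<Rightarrow> real" and r
  proof -
    have c: "continuous_on UNIV (\<lambda>x. g (branch l w x))" for w
      by (rule continuous_on_compose2[OF g(1) continuous_on_branch]) auto
    have "(\<Sum>w\<in>words l r. integral {a..b} (\<lambda>x. g (branch l w x))) = integral {a..b} (\<lambda>x. \<Sum>w\<in>words l r. g (branch l w x))" for a b
      by (rule integral_sum[symmetric]) (auto intro: integrable_cont c)
    then have "(\<Sum>j<L. \<Sum>w\<in>words l r. ?int j (\<lambda>x. g (branch l w x))) = 3 * integral {0..1} (\<lambda>x. \<Sum>w\<in>words l r. g (branch l w x))"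
      using integral_windows[OF continuous_on_sum[OF c] sum_branch_periodic[of g, OF g(2)] L] by simp
    also have "integral {0..1} (\<lambda>x. \<Sum>w\<in>words l r. g (branch l w x)) = (\<Sum>w\<in>words l r. integral {0..1} (\<lambda>x. g (branch l w x)))"
      by (rule integral_sum) (auto intro: integrable_cont c)
    also have "\<dots> = real l ^ r * integral {0..1} g" by (rule integral_branches[OF g(1)]) (use l in simp)
    finally show ?thesis .
  qed
  have "integral {0..1} ?f = (\<Sum>j<L. integral {real j / real L..real j / real L + 1 / real L} ?f)"
    using integral_pieces[OF cf(1) L, of 0] by (simp add: add_divide_distrib)
  also have "\<dots> \<le> (\<Sum>j<L. 9/8 * real M / (real l ^ q)\<^sup>2 * (\<Sum>a\<in>words l q. ?int j (\<lambda>x. ?g (branch l a x)))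
      + ?K / real l ^ (q + m) * (\<Sum>w\<in>words l (q + m). ?int j (\<lambda>x. ?h (branch l w x))))"
  proof (rule sum_mono)
    fix j assume "j \<in> {..<L}"
    then have x: "real j / real L \<in> circle" by (simp add: circle_def)
    have "16 * (\<alpha> A \<kappa> * norm \<eta> * (1 / real L)) \<le> e" using small L by (simp add: divide_simps)
    from window_bound[OF e _ this count[OF x] nz, of n] L
    show "integral {real j / real L..real j / real L + 1 / real L} ?f \<le> 9/8 * real M / (real l ^ q)\<^sup>2 * (\<Sum>a\<in>words l q. ?int j (\<lambda>x. ?g (branch l a x)))
      + ?K / real l ^ (q + m) * (\<Sum>w\<in>words l (q + m). ?int j (\<lambda>x. ?h (branch l w x)))" by simp
  qed
  also have "\<dots> = 9/8 * real M / (real l ^ q)\<^sup>2 * (\<Sum>j<L. \<Sum>a\<in>words l q. ?int j (\<lambda>x. ?g (branch l a x)))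
      + ?K / real l ^ (q + m) * (\<Sum>j<L. \<Sum>w\<in>words l (q + m). ?int j (\<lambda>x. ?h (branch l w x)))"
    by (simp only: sum.distrib sum_distrib_left)
  also have "(\<Sum>j<L. \<Sum>a\<in>words l q. ?int j (\<lambda>x. ?g (branch l a x))) = 3 * (real l ^ q * integral {0..1} ?g)"
    by (rule windows[OF cf(2)]) (simp only: F_periodic)
  also have "(\<Sum>j<L. \<Sum>w\<in>words l (q + m). ?int j (\<lambda>x. ?h (branch l w x))) = 3 * (real l ^ (q + m) * integral {0..1} ?h)"
    by (rule windows[OF continuous_on_Q Q_periodic])
  also have "9/8 * real M / (real l ^ q)\<^sup>2 * (3 * (real l ^ q * integral {0..1} ?g)) + ?K / real l ^ (q + m) * (3 * (real l ^ (q + m) * integral {0..1} ?h))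
      = 27/8 * real M / real l ^ q * integral {0..1} ?g + 3 * ?K * integral {0..1} ?h"
  proof -
    have eq: "9/8 * M / y\<^sup>2 * (3 * (y * g)) + K / z * (3 * (z * h)) = 27/8 * M / y * g + 3 * K * h"
      if "y > 0" "z > 0" for M K y z g h :: real using that by (simp add: field_simps power2_eq_square)
    show ?thesis by (rule eq) (use l0 in simp_all)
  qed
  finally show ?thesis .
qed

end

section \<open>The Lasota-Yorke recursion\<close>

lemma ennreal_le_mult: "x \<le> k * y \<Longrightarrow> 0 \<le> k \<Longrightarrow> 0 \<le> y \<Longrightarrow> ennreal x \<le> ennreal k * ennreal y"
  unfolding ennreal_mult[symmetric] by (rule ennreal_leI)

lemma ennreal_le_mult_add:
  assumes "x \<le> k * y + c * z" "0 \<le> k" "0 \<le> y" "0 \<le> c" "0 \<le> z"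
  shows "ennreal x \<le> ennreal k * ennreal y + ennreal c * ennreal z"
proof -
  have "ennreal x \<le> ennreal (k * y + c * z)" by (rule ennreal_leI[OF assms(1)])
  also have "\<dots> = ennreal k * ennreal y + ennreal c * ennreal z"
    using assms by (simp add: ennreal_mult)
  finally show ?thesis .
qed

context solenoid
begin

lemma F1_add:
  "F1 (q + n) \<eta> x = (\<Sum>a\<in>words l q. cis (- 2 * pi * inner \<eta> (S a x)) * ((1 / real l ^ q) *\<^sub>R F1 n (freq A q \<eta>) (branch l a x))
     + (- 2 * pi * inner \<eta> (S1 a x)) *\<^sub>R (\<i> * cis (- 2 * pi * inner \<eta> (S a x))) * F n (freq A q \<eta>) (branch l a x)) / of_nat l ^ q"
proof -
  let ?\<eta> = "freq A q \<eta>"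
  have "((\<lambda>x. (\<Sum>a\<in>words l q. cis (- 2 * pi * inner \<eta> (S a x)) * F n ?\<eta> (branch l a x)) / of_nat l ^ q) has_vector_derivative
     (\<Sum>a\<in>words l q. cis (- 2 * pi * inner \<eta> (S a x)) * ((1 / real l ^ q) *\<^sub>R F1 n ?\<eta> (branch l a x))
     + (- 2 * pi * inner \<eta> (S1 a x)) *\<^sub>R (\<i> * cis (- 2 * pi * inner \<eta> (S a x))) * F n ?\<eta> (branch l a x)) / of_nat l ^ q) (at x)"
  proof (rule has_vector_derivative_divide[OF has_vector_derivative_sum])
    fix a assume a: "a \<in> words l q"
    show "((\<lambda>x. cis (- 2 * pi * inner \<eta> (S a x)) * F n ?\<eta> (branch l a x)) has_vector_derivative
      cis (- 2 * pi * inner \<eta> (S a x)) * ((1 / real l ^ q) *\<^sub>R F1 n ?\<eta> (branch l a x))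
     + (- 2 * pi * inner \<eta> (S1 a x)) *\<^sub>R (\<i> * cis (- 2 * pi * inner \<eta> (S a x))) * F n ?\<eta> (branch l a x)) (at x)"
      using has_vector_derivative_mult[OF has_vector_derivative_cis[OF inner_S_deriv] compose_branch_deriv[of "F n ?\<eta>" "F1 n ?\<eta>" a x, OF F_deriv], of "- 2 * pi" \<eta> a]
      unfolding length_words[OF a] .
  qed
  moreover have "F (q + n) \<eta> = (\<lambda>x. (\<Sum>a\<in>words l q. cis (- 2 * pi * inner \<eta> (S a x)) * F n ?\<eta> (branch l a x)) / of_nat l ^ q)"
    by (rule ext) (rule F_add)
  ultimately show ?thesis using F_deriv[of "q + n" \<eta> x] vector_derivative_unique_at by (metis (no_types, lifting))
qed

lemma abs_inner_S1: "\<bar>2 * pi * inner \<eta> (S1 a x)\<bar> \<le> pi * \<alpha> A \<kappa> * norm \<eta>"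
proof -
  have "\<bar>inner \<eta> (S1 a x)\<bar> \<le> norm \<eta> * norm (S1 a x)" by (rule Cauchy_Schwarz_ineq2)
  also have "\<dots> \<le> norm \<eta> * (\<alpha> A \<kappa> / 2)" by (intro mult_left_mono norm_S1) simp
  finally have "2 * pi * \<bar>inner \<eta> (S1 a x)\<bar> \<le> 2 * pi * (norm \<eta> * (\<alpha> A \<kappa> / 2))" by (intro mult_left_mono) auto
  then show ?thesis by (simp add: abs_mult mult_ac)
qed

lemma norm_F1_le: "norm (F1 n \<eta> x) \<le> pi * \<alpha> A \<kappa> * norm \<eta>"
proof -
  have "norm (\<Sum>w\<in>words l n. (- 2 * pi * inner \<eta> (S1 w x)) *\<^sub>R (\<i> * cis (- 2 * pi * inner \<eta> (S w x))))
      \<le> (\<Sum>w\<in>words l n. pi * \<alpha> A \<kappa> * norm \<eta>)"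
    using abs_inner_S1 by (intro sum_norm_le) (simp add: norm_mult)
  then show ?thesis using l0 by (simp add: F1_def norm_divide norm_power card_words divide_le_eq mult_ac)
qed

text \<open>
  Cauchy-Schwarz for the mean over the words.  The factor \<open>1 / (l^q)^2\<close> in front of the derivative is the
  contraction of the branches.
\<close>

lemma norm_F1_add_le:
  "(norm (F1 (q + n) \<eta> x))\<^sup>2 \<le> (\<Sum>a\<in>words l q. 2 * (pi * \<alpha> A \<kappa> * norm \<eta>)\<^sup>2 * (norm (F n (freq A q \<eta>) (branch l a x)))\<^sup>2
     + 2 / (real l ^ q)\<^sup>2 * (norm (F1 n (freq A q \<eta>) (branch l a x)))\<^sup>2) / real l ^ q"
proof -
  let ?z = "\<lambda>a. cis (- 2 * pi * inner \<eta> (S a x)) * ((1 / real l ^ q) *\<^sub>R F1 n (freq A q \<eta>) (branch l a x))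
     + (- 2 * pi * inner \<eta> (S1 a x)) *\<^sub>R (\<i> * cis (- 2 * pi * inner \<eta> (S a x))) * F n (freq A q \<eta>) (branch l a x)"
  let ?r = "\<lambda>a. 2 * (pi * \<alpha> A \<kappa> * norm \<eta>)\<^sup>2 * (norm (F n (freq A q \<eta>) (branch l a x)))\<^sup>2
     + 2 / (real l ^ q)\<^sup>2 * (norm (F1 n (freq A q \<eta>) (branch l a x)))\<^sup>2"
  have z: "(norm (?z a))\<^sup>2 \<le> ?r a" for a
  proof -
    let ?u = "pi * \<alpha> A \<kappa> * norm \<eta> * norm (F n (freq A q \<eta>) (branch l a x))"
    let ?v = "1 / real l ^ q * norm (F1 n (freq A q \<eta>) (branch l a x))"
    have "norm (?z a) \<le> ?v + ?u"
    proof (rule norm_triangle_le, rule add_mono)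
      show "norm (cis (- 2 * pi * inner \<eta> (S a x)) * ((1 / real l ^ q) *\<^sub>R F1 n (freq A q \<eta>) (branch l a x))) \<le> ?v"
        by (simp add: norm_mult)
      have "norm ((- 2 * pi * inner \<eta> (S1 a x)) *\<^sub>R (\<i> * cis (- 2 * pi * inner \<eta> (S a x))) * F n (freq A q \<eta>) (branch l a x))
        = \<bar>2 * pi * inner \<eta> (S1 a x)\<bar> * norm (F n (freq A q \<eta>) (branch l a x))"
        by (simp add: norm_mult)
      also have "\<dots> \<le> ?u" by (intro mult_right_mono abs_inner_S1) simp
      finally show "norm ((- 2 * pi * inner \<eta> (S1 a x)) *\<^sub>R (\<i> * cis (- 2 * pi * inner \<eta> (S a x))) * F n (freq A q \<eta>) (branch l a x)) \<le> ?u" .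
    qed
    then have "(norm (?z a))\<^sup>2 \<le> (?v + ?u)\<^sup>2" by (intro power_mono) auto
    also have "\<dots> \<le> 2 * ?u\<^sup>2 + 2 * ?v\<^sup>2" using sum_squares_bound[of ?v ?u] by (simp only: power2_sum)
    also have "\<dots> = ?r a" by (simp add: power_mult_distrib power_divide)
    finally show ?thesis .
  qed
  have "(norm (\<Sum>a\<in>words l q. ?z a))\<^sup>2 \<le> (\<Sum>a\<in>words l q. norm (?z a))\<^sup>2"
    by (intro power_mono norm_sum) auto
  also have "\<dots> \<le> (\<Sum>a\<in>words l q. (norm (?z a))\<^sup>2) * real (card (words l q))" by (rule sum_squared_le_sum_of_squares)
  also have "\<dots> \<le> (\<Sum>a\<in>words l q. ?r a) * real l ^ q"
    unfolding card_words of_nat_power by (intro mult_right_mono sum_mono z) auto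
  finally have le: "(norm (\<Sum>a\<in>words l q. ?z a))\<^sup>2 \<le> (\<Sum>a\<in>words l q. ?r a) * real l ^ q" .
  have "(norm (F1 (q + n) \<eta> x))\<^sup>2 = (norm (\<Sum>a\<in>words l q. ?z a))\<^sup>2 / (real l ^ q)\<^sup>2"
    unfolding F1_add norm_divide norm_power norm_of_nat power_divide ..
  also have "\<dots> \<le> (\<Sum>a\<in>words l q. ?r a) * real l ^ q / (real l ^ q)\<^sup>2" by (rule divide_right_mono[OF le]) simp
  also have "\<dots> = (\<Sum>a\<in>words l q. ?r a) / real l ^ q" using l0 by (simp add: power2_eq_square)
  finally show ?thesis .
qed

definition G :: "nat \<Rightarrow> real^'n \<Rightarrow> real" where
  "G n \<eta> = integral {0..1} (\<lambda>x. (norm (F n \<eta> x))\<^sup>2)"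

text \<open>The normalization by \<open>norm \<eta>\<close> makes \<open>H\<close> bounded, like \<open>G\<close>.\<close>

definition H :: "nat \<Rightarrow> real^'n \<Rightarrow> real" where
  "H n \<eta> = integral {0..1} (\<lambda>x. (norm (F1 n \<eta> x))\<^sup>2) / (norm \<eta>)\<^sup>2"

lemma cont_sq: "continuous_on UNIV (\<lambda>x. (norm (F n \<eta> x))\<^sup>2)" "continuous_on UNIV (\<lambda>x. (norm (F1 n \<eta> x))\<^sup>2)"
  by (intro continuous_intros continuous_on_F continuous_on_F1)+

lemma G_nonneg: "G n \<eta> \<ge> 0"
  unfolding G_def by (rule integral_nonneg[OF integrable_cont[OF cont_sq(1)]]) simp

lemma H_nonneg: "H n \<eta> \<ge> 0"
  unfolding H_def by (intro divide_nonneg_nonneg integral_nonneg[OF integrable_cont[OF cont_sq(2)]]) auto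

lemma G_le_1: "G n \<eta> \<le> 1"
proof -
  have "G n \<eta> \<le> integral {0..1::real} (\<lambda>x. 1)"
    unfolding G_def by (rule integral_le[OF integrable_cont[OF cont_sq(1)]]) (auto intro: power_le_one norm_F_le)
  then show ?thesis by simp
qed

lemma H_le: "H n \<eta> \<le> (pi * \<alpha> A \<kappa>)\<^sup>2"
proof -
  have "integral {0..1} (\<lambda>x. (norm (F1 n \<eta> x))\<^sup>2) \<le> integral {0..1::real} (\<lambda>x. (pi * \<alpha> A \<kappa> * norm \<eta>)\<^sup>2)"
    by (rule integral_le[OF integrable_cont[OF cont_sq(2)]]) (auto intro: power_mono norm_F1_le)
  then have "integral {0..1} (\<lambda>x. (norm (F1 n \<eta> x))\<^sup>2) \<le> (pi * \<alpha> A \<kappa>)\<^sup>2 * (norm \<eta>)\<^sup>2"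
    by (simp add: power_mult_distrib)
  then show ?thesis unfolding H_def by (cases "\<eta> = 0") (simp_all add: divide_le_eq)
qed

lemma integral_Q: "integral {0..1} (Q n \<eta>) = G n \<eta> + H n \<eta>"
proof -
  have "integral {0..1} (\<lambda>x. (norm (F n \<eta> x))\<^sup>2 + (norm (F1 n \<eta> x))\<^sup>2 / (norm \<eta>)\<^sup>2)
      = G n \<eta> + integral {0..1} (\<lambda>x. (norm (F1 n \<eta> x))\<^sup>2 / (norm \<eta>)\<^sup>2)"
    unfolding G_def
    by (rule Henstock_Kurzweil_Integration.integral_add)
      (intro integrable_cont cont_sq, intro integrable_on_divide integrable_cont cont_sq)
  then show ?thesis unfolding Q_def H_def by simp
qed

text \<open>Division by \<open>(norm \<eta>)^2\<close> instead of \<open>(norm (freq A j \<eta>))^2\<close> costs \<open>K^2\<close>, which \<open>l^j\<close> outweighs later.\<close>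

lemma H_add_le:
  assumes K: "norm (freq A j \<eta>) \<le> K * norm \<eta>" and nz: "\<eta> \<noteq> 0" "freq A j \<eta> \<noteq> 0"
  shows "H (j + n) \<eta> \<le> 2 * (pi * \<alpha> A \<kappa>)\<^sup>2 * G n (freq A j \<eta>) + 2 * K\<^sup>2 / (real l ^ j)\<^sup>2 * H n (freq A j \<eta>)"
proof -
  let ?\<eta> = "freq A j \<eta>"
  let ?f = "\<lambda>x. 2 * (pi * \<alpha> A \<kappa> * norm \<eta>)\<^sup>2 * (norm (F n ?\<eta> x))\<^sup>2 + 2 / (real l ^ j)\<^sup>2 * (norm (F1 n ?\<eta> x))\<^sup>2"
  have cf: "continuous_on UNIV ?f" by (intro continuous_intros cont_sq)
  have cb: "continuous_on UNIV (\<lambda>x. ?f (branch l a x))" for a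
    by (rule continuous_on_compose2[OF cf continuous_on_branch]) auto
  have "integral {0..1} (\<lambda>x. (norm (F1 (j + n) \<eta> x))\<^sup>2) \<le> integral {0..1} (\<lambda>x. (\<Sum>a\<in>words l j. ?f (branch l a x)) / real l ^ j)"
    by (rule integral_le[OF integrable_cont[OF cont_sq(2)] integrable_on_divide[OF integrable_cont[OF continuous_on_sum[OF cb]]] norm_F1_add_le])
  also have "\<dots> = (\<Sum>a\<in>words l j. integral {0..1} (\<lambda>x. ?f (branch l a x))) / real l ^ j"
    unfolding integral_divide by (subst integral_sum[OF finite_words integrable_cont[OF cb]]) (rule refl)
  also have "\<dots> = integral {0..1} ?f"
    using integral_branches[OF cf, of l j] l0 l by simp
  also have "\<dots> = 2 * (pi * \<alpha> A \<kappa> * norm \<eta>)\<^sup>2 * G n ?\<eta> + 2 / (real l ^ j)\<^sup>2 * integral {0..1} (\<lambda>x. (norm (F1 n ?\<eta> x))\<^sup>2)"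
    unfolding G_def integral_mult_right[symmetric]
    by (rule Henstock_Kurzweil_Integration.integral_add) (intro integrable_cont continuous_intros cont_sq)+
  also have "integral {0..1} (\<lambda>x. (norm (F1 n ?\<eta> x))\<^sup>2) = (norm ?\<eta>)\<^sup>2 * H n ?\<eta>"
    using nz(2) by (simp add: H_def)
  also have "2 / (real l ^ j)\<^sup>2 * ((norm ?\<eta>)\<^sup>2 * H n ?\<eta>) \<le> 2 / (real l ^ j)\<^sup>2 * ((K * norm \<eta>)\<^sup>2 * H n ?\<eta>)"
    by (intro mult_left_mono mult_right_mono power_mono K H_nonneg) auto
  finally have "integral {0..1} (\<lambda>x. (norm (F1 (j + n) \<eta> x))\<^sup>2)
      \<le> 2 * (pi * \<alpha> A \<kappa> * norm \<eta>)\<^sup>2 * G n ?\<eta> + 2 / (real l ^ j)\<^sup>2 * ((K * norm \<eta>)\<^sup>2 * H n ?\<eta>)" by simp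
  also have "\<dots> = (2 * (pi * \<alpha> A \<kappa>)\<^sup>2 * G n ?\<eta> + 2 * K\<^sup>2 / (real l ^ j)\<^sup>2 * H n ?\<eta>) * (norm \<eta>)\<^sup>2"
    unfolding power_mult_distrib divide_inverse by (simp only: distrib_right distrib_left mult_ac)
  finally show ?thesis unfolding H_def[of "j + n"] using nz(1) by (simp add: divide_le_eq)
qed

lemma continuous_F_joint: "continuous_on UNIV (\<lambda>p. F n (fst p) (snd p))" "continuous_on UNIV (\<lambda>p. F1 n (fst p) (snd p))"
proof -
  have c: "continuous_on UNIV (\<lambda>p :: (real^'n) \<times> real. S w (snd p))" "continuous_on UNIV (\<lambda>p :: (real^'n) \<times> real. S1 w (snd p))" for w
    by (intro continuous_on_compose2[OF continuous_on_S] continuous_on_compose2[OF continuous_on_S1] continuous_intros; auto)+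
  show "continuous_on UNIV (\<lambda>p. F n (fst p) (snd p))" "continuous_on UNIV (\<lambda>p. F1 n (fst p) (snd p))"
    unfolding F_def F1_def using l0 by (intro continuous_intros c; auto)+
qed

lemma G_H_measurable [measurable]: "G n \<in> borel_measurable borel" "H n \<in> borel_measurable borel"
proof -
  have "continuous_on UNIV (\<lambda>\<eta>. integral (cbox 0 1) (\<lambda>x. (norm (F n \<eta> x))\<^sup>2))"
    by (rule integral_continuous_on_param)
      (use continuous_on_subset[OF continuous_F_joint(1)] in \<open>auto intro!: continuous_intros simp: case_prod_beta\<close>)
  then have "continuous_on UNIV (G n)" unfolding G_def by simp
  then show "G n \<in> borel_measurable borel" by (rule borel_measurable_continuous_onI)
  have "continuous_on UNIV (\<lambda>\<eta>. integral (cbox 0 1) (\<lambda>x. (norm (F1 n \<eta> x))\<^sup>2))"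
    by (rule integral_continuous_on_param)
      (use continuous_on_subset[OF continuous_F_joint(2)] in \<open>auto intro!: continuous_intros simp: case_prod_beta\<close>)
  then have [measurable]: "(\<lambda>\<eta>. integral {0..1} (\<lambda>x. (norm (F1 n \<eta> x))\<^sup>2)) \<in> borel_measurable borel"
    by (intro borel_measurable_continuous_onI) simp
  show "H n \<in> borel_measurable borel" unfolding H_def by measurable
qed

end

text \<open>
  Two sequences that control each other.  The factor \<open>1/2\<close> makes \<open>b\<close> bounded in terms of \<open>a\<close>, and
  the small \<open>t\<close> then closes the recursion for \<open>a\<close>.
\<close>

lemma coupled_recursion_bounded:
  fixes a b :: "nat \<Rightarrow> real"
  assumes nonneg: "\<And>n. a n \<ge> 0" "\<And>n. b n \<ge> 0" and q: "q \<ge> 1" and j: "j \<ge> 1"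
    and c: "c \<ge> 0" "t \<ge> 0" "\<rho> \<ge> 0" "Z \<ge> 0" and small: "\<rho> + t * (1 + 2 * c) < 1"
    and a: "\<And>n. a (q + (m + n)) \<le> \<rho> * a (m + n) + t * (a n + b n) + Z"
    and b: "\<And>n. b (j + n) \<le> c * a n + b n / 2"
  obtains X where "\<And>n. a n \<le> X"
proof -
  define b0 where "b0 = (\<Sum>n<j. b n)"
  define a0 where "a0 = (\<Sum>n<q + m. a n)"
  define d where "d = 1 - (\<rho> + t * (1 + 2 * c))"
  define X where "X = a0 + (t * b0 + Z) / d"
  define Y where "Y = 2 * c * X + b0"
  have d: "d > 0" using small by (simp add: d_def)
  have b0: "b0 \<ge> 0" and a0: "a0 \<ge> 0" unfolding b0_def a0_def using nonneg by (auto intro: sum_nonneg)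
  have X0: "(t * b0 + Z) / d \<ge> 0" using d c b0 by (intro divide_nonneg_nonneg add_nonneg_nonneg) auto
  then have X: "X \<ge> 0" using a0 by (simp add: X_def)
  have "a n \<le> X \<and> b n \<le> Y" for n
  proof (induction n rule: less_induct)
    case (less n)
    have "a n \<le> X"
    proof (cases "n < q + m")
      case True
      then have "a n \<le> a0" unfolding a0_def by (intro member_le_sum) (auto simp: nonneg)
      then show ?thesis using X0 by (simp add: X_def)
    next
      case False
      then obtain n' where n': "n = q + (m + n')" by (metis add.assoc le_Suc_ex not_less)
      have 1: "a (m + n') \<le> X" "a n' \<le> X" "b n' \<le> Y" using less.IH[of "m + n'"] less.IH[of n'] q n' by auto
      have "a n \<le> \<rho> * X + t * (X + Y) + Z"
        unfolding n' by (rule order.trans[OF a]) (intro add_mono mult_left_mono 1 c order.refl)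
      also have "\<dots> = X - d * X + (t * b0 + Z)" by (simp add: Y_def d_def algebra_simps)
      also have "\<dots> \<le> X"
      proof -
        have "t * b0 + Z = d * ((t * b0 + Z) / d)" using d by simp
        also have "\<dots> \<le> d * X" unfolding X_def using a0 d by (intro mult_left_mono) auto
        finally show ?thesis by simp
      qed
      finally show ?thesis .
    qed
    moreover have "b n \<le> Y"
    proof (cases "n < j")
      case True
      then have "b n \<le> b0" unfolding b0_def by (intro member_le_sum) (auto simp: nonneg)
      then show ?thesis using c X by (simp add: Y_def add_increasing)
    next
      case False
      then obtain n' where n': "n = j + n'" by (metis le_Suc_ex not_less)
      have "b n \<le> c * a n' + b n' / 2" unfolding n' by (rule b)
      also have "\<dots> \<le> c * X + Y / 2" using less.IH[of n'] j n' c by (intro add_mono mult_left_mono divide_right_mono) auto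
      also have "\<dots> \<le> Y" using b0 by (simp add: Y_def)
      finally show ?thesis .
    qed
    ultimately show ?case by simp
  qed
  then show thesis using that by blast
qed

locale attractor = spectral_bounds A C + solenoid l A \<phi> \<phi>1 \<phi>2 \<kappa>
  for A :: "real^'n^'n" and C l \<phi> \<phi>1 \<phi>2 \<kappa> +
  fixes s :: "nat \<Rightarrow> real"
  assumes s: "\<And>i. i \<in> {1..num_moduli A} \<Longrightarrow> s i > - real (dim (spec_space A i)) / 2"
begin

text \<open>The price of passing from \<open>\<eta>\<close> to \<open>freq A q \<eta>\<close> in a weighted integral.\<close>

definition loss :: "nat \<Rightarrow> real" where
  "loss q = weight_loss A C s q / \<bar>det A\<bar> ^ q"

text \<open>
  The cutoff \<open>norm (freq A n \<eta>) \<le> 1\<close> makes the energies finite from the start; it is compatible with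
  the recursion, which leads from \<open>n\<close> and \<open>\<eta>\<close> to \<open>n - q\<close> and \<open>freq A q \<eta>\<close>, and it disappears for
  \<open>n \<rightarrow> \<infinity>\<close>.
\<close>

definition energy :: "(real^'n \<Rightarrow> real) \<Rightarrow> nat \<Rightarrow> ennreal" where
  "energy P n = (\<integral>\<^sup>+\<eta>. ennreal (P \<eta> * weight A s \<eta>) * indicator {\<eta>. norm (freq A n \<eta>) \<le> 1} \<eta> \<partial>lborel)"

lemma det_nz: "det A \<noteq> 0"
  using invertible by (simp add: invertible_det_nz)

lemma loss_nonneg: "loss q \<ge> 0"
  unfolding loss_def using weight_loss_nonneg by simp

lemma invertible_freq: "invertible (transpose (matpow A q))"
  using det_nz by (simp add: invertible_det_nz det_matpow)

lemma freq_lower: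
  obtains c where "c > 0" "\<And>\<eta>. c * norm \<eta> \<le> norm (freq A q \<eta>)"
proof -
  obtain V where V: "V ** transpose (matpow A q) = mat 1"
    using invertible_freq invertible_left_inverse by blast
  define K where "K = onorm (\<lambda>v. V *v v) + 1"
  have K: "K > 0" unfolding K_def using onorm_pos_le[OF matrix_vector_mul_bounded_linear, of V] by simp
  have "norm \<eta> \<le> K * norm (freq A q \<eta>)" for \<eta>
  proof -
    have "norm \<eta> = norm (V *v freq A q \<eta>)" by (simp add: matrix_vector_mul_assoc V)
    also have "\<dots> \<le> onorm (\<lambda>v. V *v v) * norm (freq A q \<eta>)" by (rule onorm[OF matrix_vector_mul_bounded_linear])
    also have "\<dots> \<le> K * norm (freq A q \<eta>)" unfolding K_def by (intro mult_right_mono) auto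
    finally show ?thesis .
  qed
  then have "(1 / K) * norm \<eta> \<le> norm (freq A q \<eta>)" for \<eta> using K by (simp add: divide_le_eq mult.commute)
  then show thesis using that[of "1 / K"] K by simp
qed

lemma energy_shift:
  assumes [measurable]: "P \<in> borel_measurable borel" and P: "\<And>\<eta>. P \<eta> \<ge> 0" and q: "q \<ge> 1"
  shows "(\<integral>\<^sup>+\<eta>. ennreal (P (freq A q \<eta>) * weight A s \<eta>) * indicator {\<eta>. norm (freq A (q + n) \<eta>) \<le> 1} \<eta> \<partial>lborel)
    \<le> ennreal (loss q) * energy P n"
proof -
  let ?B = "transpose (matpow A q)"
  define f where "f = (\<lambda>\<eta>. ennreal (P \<eta> * weight A s \<eta>) * indicator {\<eta>. norm (freq A n \<eta>) \<le> 1} \<eta>)"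
  have [measurable]: "f \<in> borel_measurable borel" unfolding f_def by measurable
  have d: "\<bar>det ?B\<bar> = \<bar>det A\<bar> ^ q" by (simp add: det_matpow power_abs)
  have "(\<integral>\<^sup>+\<eta>. ennreal (P (freq A q \<eta>) * weight A s \<eta>) * indicator {\<eta>. norm (freq A (q + n) \<eta>) \<le> 1} \<eta> \<partial>lborel)
      \<le> (\<integral>\<^sup>+\<eta>. ennreal (weight_loss A C s q) * f (?B *v \<eta>) \<partial>lborel)"
  proof (rule nn_integral_mono)
    fix \<eta>
    have "P (freq A q \<eta>) * weight A s \<eta> \<le> P (freq A q \<eta>) * (weight_loss A C s q * weight A s (freq A q \<eta>))"
      by (rule mult_left_mono[OF weight_le_weight_freq[OF q] P])
    also have "\<dots> = weight_loss A C s q * (P (freq A q \<eta>) * weight A s (freq A q \<eta>))" by (simp only: mult_ac)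
    finally have "ennreal (P (freq A q \<eta>) * weight A s \<eta>) \<le> ennreal (weight_loss A C s q) * ennreal (P (freq A q \<eta>) * weight A s (freq A q \<eta>))"
      by (rule ennreal_le_mult[OF _ weight_loss_nonneg mult_nonneg_nonneg[OF P weight_nonneg]])
    then show "ennreal (P (freq A q \<eta>) * weight A s \<eta>) * indicator {\<eta>. norm (freq A (q + n) \<eta>) \<le> 1} \<eta>
        \<le> ennreal (weight_loss A C s q) * f (?B *v \<eta>)"
      unfolding f_def by (auto simp: freq_add split: split_indicator)
  qed
  also have "\<dots> = ennreal (weight_loss A C s q) * (\<integral>\<^sup>+\<eta>. f (?B *v \<eta>) \<partial>lborel)"
    by (rule nn_integral_cmult) measurable
  also have "\<dots> = ennreal (loss q) * (ennreal \<bar>det ?B\<bar> * (\<integral>\<^sup>+\<eta>. f (?B *v \<eta>) \<partial>lborel))"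
  proof -
    have "weight_loss A C s q = loss q * \<bar>det ?B\<bar>" unfolding loss_def d using det_nz by simp
    then show ?thesis using loss_nonneg by (simp add: ennreal_mult mult.assoc)
  qed
  also have "\<dots> = ennreal (loss q) * energy P n"
    unfolding energy_def f_def[symmetric] by (subst nn_integral_matrix[OF invertible_freq[of q], of f]) simp_all
  finally show ?thesis .
qed

text \<open>\<open>freq A n\<close> is invertible, hence the cutoff restricts \<open>\<eta>\<close> to a bounded set.\<close>

lemma energy_finite:
  assumes [measurable]: "P \<in> borel_measurable borel" and P: "\<And>\<eta>. P \<eta> \<le> K"
  shows "energy P n < \<infinity>"
proof -
  obtain c where c: "c > 0" "\<And>\<eta>. c * norm \<eta> \<le> norm (freq A n \<eta>)" using freq_lower by blast
  let ?I = "\<lambda>\<eta>. ennreal (weight A s \<eta>) * indicator {\<eta>. norm \<eta> \<le> 1 / c} \<eta>"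
  have "energy P n \<le> (\<integral>\<^sup>+\<eta>. ennreal \<bar>K\<bar> * ?I \<eta> \<partial>lborel)"
    unfolding energy_def
  proof (rule nn_integral_mono)
    fix \<eta>
    have "P \<eta> * weight A s \<eta> \<le> \<bar>K\<bar> * weight A s \<eta>"
      by (intro mult_right_mono weight_nonneg order.trans[OF P]) simp
    then have "ennreal (P \<eta> * weight A s \<eta>) \<le> ennreal \<bar>K\<bar> * ennreal (weight A s \<eta>)"
      by (rule ennreal_le_mult[OF _ abs_ge_zero weight_nonneg])
    moreover have "norm \<eta> \<le> 1 / c" if "norm (freq A n \<eta>) \<le> 1"
      using c(2)[of \<eta>] that c(1) by (simp add: le_divide_eq mult.commute)
    ultimately show "ennreal (P \<eta> * weight A s \<eta>) * indicator {\<eta>. norm (freq A n \<eta>) \<le> 1} \<eta> \<le> ennreal \<bar>K\<bar> * ?I \<eta>"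
      by (auto split: split_indicator)
  qed
  also have "\<dots> = ennreal \<bar>K\<bar> * (\<integral>\<^sup>+\<eta>. ?I \<eta> \<partial>lborel)" by (rule nn_integral_cmult) measurable
  also have "\<dots> < \<infinity>" using weight_locally_integrable[OF s, of "1 / c"] by (simp add: ennreal_mult_less_top)
  finally show ?thesis .
qed

definition a :: "nat \<Rightarrow> real" where "a n = enn2real (energy (G n) n)"
definition b :: "nat \<Rightarrow> real" where "b n = enn2real (energy (H n) n)"

lemma energy_a: "energy (G n) n = ennreal (a n)"
  using energy_finite[of "G n" 1 n] G_le_1 unfolding a_def by simp

lemma energy_b: "energy (H n) n = ennreal (b n)"
  using energy_finite[OF G_H_measurable(2) H_le, of n n] unfolding b_def by simp

lemma a_nonneg: "a n \<ge> 0" and b_nonneg: "b n \<ge> 0"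
  by (simp_all add: a_def b_def)

lemma b_recursion:
  assumes j: "j \<ge> 1" and K: "\<And>\<eta>. norm (freq A j \<eta>) \<le> K * norm \<eta>"
  shows "b (j + n) \<le> 2 * (pi * \<alpha> A \<kappa>)\<^sup>2 * loss j * a n + 2 * K\<^sup>2 / (real l ^ j)\<^sup>2 * loss j * b n"
proof -
  let ?c = "2 * (pi * \<alpha> A \<kappa>)\<^sup>2" and ?d = "2 * K\<^sup>2 / (real l ^ j)\<^sup>2"
  let ?I = "\<lambda>P \<eta>. ennreal (P (freq A j \<eta>) * weight A s \<eta>) * indicator {\<eta>. norm (freq A (j + n) \<eta>) \<le> 1} \<eta>"
  obtain c where c: "c > 0" "\<And>\<eta>. c * norm \<eta> \<le> norm (freq A j \<eta>)" using freq_lower by blast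
  have le: "H (j + n) \<eta> \<le> ?c * G n (freq A j \<eta>) + ?d * H n (freq A j \<eta>)" for \<eta>
  proof (cases "\<eta> = 0")
    case True
    then have "H (j + n) \<eta> = 0" by (simp add: H_def)
    then show ?thesis using G_nonneg H_nonneg by (simp add: add_nonneg_nonneg mult_nonneg_nonneg)
  next
    case False
    then have "norm (freq A j \<eta>) > 0" using c(2)[of \<eta>] c(1) by (smt (verit) mult_pos_pos zero_less_norm_iff)
    then show ?thesis using H_add_le[OF K False] by simp
  qed
  have "energy (H (j + n)) (j + n) \<le> (\<integral>\<^sup>+\<eta>. ennreal ?c * ?I (G n) \<eta> + ennreal ?d * ?I (H n) \<eta> \<partial>lborel)"
    unfolding energy_def
  proof (rule nn_integral_mono)
    fix \<eta>
    have "H (j + n) \<eta> * weight A s \<eta> \<le> (?c * G n (freq A j \<eta>) + ?d * H n (freq A j \<eta>)) * weight A s \<eta>"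
      by (rule mult_right_mono[OF le weight_nonneg])
    also have "\<dots> = ?c * (G n (freq A j \<eta>) * weight A s \<eta>) + ?d * (H n (freq A j \<eta>) * weight A s \<eta>)"
      by (simp only: distrib_right distrib_left mult_ac)
    finally have "ennreal (H (j + n) \<eta> * weight A s \<eta>) \<le> ennreal ?c * ennreal (G n (freq A j \<eta>) * weight A s \<eta>)
        + ennreal ?d * ennreal (H n (freq A j \<eta>) * weight A s \<eta>)"
      by (rule ennreal_le_mult_add) (simp_all add: G_nonneg H_nonneg weight_nonneg)
    then show "ennreal (H (j + n) \<eta> * weight A s \<eta>) * indicator {\<eta>. norm (freq A (j + n) \<eta>) \<le> 1} \<eta>
        \<le> ennreal ?c * ?I (G n) \<eta> + ennreal ?d * ?I (H n) \<eta>"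
      by (auto split: split_indicator)
  qed
  also have "\<dots> = ennreal ?c * (\<integral>\<^sup>+\<eta>. ?I (G n) \<eta> \<partial>lborel) + ennreal ?d * (\<integral>\<^sup>+\<eta>. ?I (H n) \<eta> \<partial>lborel)"
    by (simp add: nn_integral_add nn_integral_cmult)
  also have "\<dots> \<le> ennreal ?c * (ennreal (loss j) * energy (G n) n) + ennreal ?d * (ennreal (loss j) * energy (H n) n)"
    by (intro add_mono mult_left_mono energy_shift G_H_measurable G_nonneg H_nonneg j) auto
  also have "\<dots> = ennreal (?c * (loss j * a n) + ?d * (loss j * b n))"
    unfolding energy_a energy_b using loss_nonneg
    by (simp add: ennreal_mult[symmetric] ennreal_plus[symmetric] a_def b_def del: ennreal_plus)
  finally have "ennreal (b (j + n)) \<le> ennreal (?c * (loss j * a n) + ?d * (loss j * b n))"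
    unfolding energy_b .
  then have "b (j + n) \<le> ?c * (loss j * a n) + ?d * (loss j * b n)"
    using loss_nonneg by (subst (asm) ennreal_le_iff) (auto simp: a_def b_def)
  then show ?thesis by (simp only: mult.assoc)
qed

text \<open>
  The pointwise inequality is required for large \<open>\<eta>\<close> only; for the others \<open>G \<le> 1\<close> and the weight is
  integrable, with integral \<open>Z\<close>.
\<close>

lemma a_recursion:
  assumes q: "q \<ge> 1" and nonneg: "\<rho> \<ge> 0" "t \<ge> 0"
    and le: "\<And>\<eta>. norm \<eta> > R \<Longrightarrow> G (q + (m + n)) \<eta> \<le> \<rho> * G (m + n) (freq A q \<eta>)
        + t * (G n (freq A (q + m) \<eta>) + H n (freq A (q + m) \<eta>))"
    and Z: "(\<integral>\<^sup>+\<eta>. ennreal (weight A s \<eta>) * indicator {\<eta>. norm \<eta> \<le> R} \<eta> \<partial>lborel) = ennreal Z" "Z \<ge> 0"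
  shows "a (q + (m + n)) \<le> \<rho> * loss q * a (m + n) + t * loss (q + m) * (a n + b n) + Z"
proof -
  let ?N = "q + (m + n)"
  let ?X = "indicator {\<eta>. norm (freq A ?N \<eta>) \<le> 1} :: real^'n \<Rightarrow> ennreal"
  let ?I = "\<lambda>r P \<eta>. ennreal (P (freq A r \<eta>) * weight A s \<eta>) * ?X \<eta>"
  let ?Z = "\<lambda>\<eta>. ennreal (weight A s \<eta>) * indicator {\<eta>. norm \<eta> \<le> R} \<eta>"
  have "energy (G ?N) ?N \<le> (\<integral>\<^sup>+\<eta>. ennreal \<rho> * ?I q (G (m + n)) \<eta>
      + ennreal t * (?I (q + m) (G n) \<eta> + ?I (q + m) (H n) \<eta>) + ?Z \<eta> \<partial>lborel)"
    unfolding energy_def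
  proof (rule nn_integral_mono)
    fix \<eta>
    let ?w = "weight A s \<eta>"
    show "ennreal (G ?N \<eta> * ?w) * ?X \<eta> \<le> ennreal \<rho> * ?I q (G (m + n)) \<eta>
      + ennreal t * (?I (q + m) (G n) \<eta> + ?I (q + m) (H n) \<eta>) + ?Z \<eta>"
    proof (cases "norm \<eta> \<le> R")
      case True
      have "G ?N \<eta> * ?w \<le> 1 * ?w" by (rule mult_right_mono[OF G_le_1 weight_nonneg])
      then have "ennreal (G ?N \<eta> * ?w) * ?X \<eta> \<le> ennreal ?w"
        by (auto intro: ennreal_leI split: split_indicator)
      then show ?thesis using True by (simp add: add_increasing)
    next
      case False
      then have "G ?N \<eta> * ?w \<le> (\<rho> * G (m + n) (freq A q \<eta>) + t * (G n (freq A (q + m) \<eta>) + H n (freq A (q + m) \<eta>))) * ?w"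
        by (intro mult_right_mono le weight_nonneg) simp
      also have "\<dots> = \<rho> * (G (m + n) (freq A q \<eta>) * ?w) + t * (G n (freq A (q + m) \<eta>) * ?w + H n (freq A (q + m) \<eta>) * ?w)"
        by (simp only: distrib_right distrib_left mult_ac)
      finally have "ennreal (G ?N \<eta> * ?w) \<le> ennreal \<rho> * ennreal (G (m + n) (freq A q \<eta>) * ?w)
          + ennreal t * (ennreal (G n (freq A (q + m) \<eta>) * ?w) + ennreal (H n (freq A (q + m) \<eta>) * ?w))"
        by (subst ennreal_plus[symmetric], simp add: G_nonneg weight_nonneg, simp add: H_nonneg weight_nonneg,
          intro ennreal_le_mult_add) (simp_all add: G_nonneg H_nonneg weight_nonneg nonneg)
      then show ?thesis using False by (auto split: split_indicator)
    qed
  qed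
  also have "\<dots> = ennreal \<rho> * (\<integral>\<^sup>+\<eta>. ?I q (G (m + n)) \<eta> \<partial>lborel)
      + ennreal t * ((\<integral>\<^sup>+\<eta>. ?I (q + m) (G n) \<eta> \<partial>lborel) + (\<integral>\<^sup>+\<eta>. ?I (q + m) (H n) \<eta> \<partial>lborel)) + ennreal Z"
    by (simp add: nn_integral_add nn_integral_cmult Z)
  also have "\<dots> \<le> ennreal \<rho> * (ennreal (loss q) * energy (G (m + n)) (m + n))
      + ennreal t * (ennreal (loss (q + m)) * energy (G n) n + ennreal (loss (q + m)) * energy (H n) n) + ennreal Z"
  proof (intro add_mono mult_left_mono order.refl)
    show "(\<integral>\<^sup>+\<eta>. ?I q (G (m + n)) \<eta> \<partial>lborel) \<le> ennreal (loss q) * energy (G (m + n)) (m + n)"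
      by (intro energy_shift G_H_measurable G_nonneg q)
    show "(\<integral>\<^sup>+\<eta>. ?I (q + m) (G n) \<eta> \<partial>lborel) \<le> ennreal (loss (q + m)) * energy (G n) n"
      "(\<integral>\<^sup>+\<eta>. ?I (q + m) (H n) \<eta> \<partial>lborel) \<le> ennreal (loss (q + m)) * energy (H n) n"
      unfolding add.assoc[symmetric] using q by (intro energy_shift G_H_measurable G_nonneg H_nonneg; simp)+
  qed auto
  also have "\<dots> = ennreal (\<rho> * (loss q * a (m + n)) + t * (loss (q + m) * a n + loss (q + m) * b n) + Z)"
    unfolding energy_a energy_b using loss_nonneg nonneg Z(2)
    by (simp add: ennreal_mult[symmetric] ennreal_plus[symmetric] a_def b_def del: ennreal_plus)
  finally have "ennreal (a ?N) \<le> ennreal (\<rho> * (loss q * a (m + n)) + t * (loss (q + m) * a n + loss (q + m) * b n) + Z)"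
    unfolding energy_a .
  then have "a ?N \<le> \<rho> * (loss q * a (m + n)) + t * (loss (q + m) * a n + loss (q + m) * b n) + Z"
    using loss_nonneg nonneg Z(2) by (subst (asm) ennreal_le_iff) (auto simp: a_def b_def)
  then show ?thesis by (simp only: mult.assoc distrib_left)
qed

text \<open>
  The first two terms decay with \<open>norm \<eta>\<close>.  The third, the derivative of the innermost factor, does
  not; it is made small by \<open>m\<close>.
\<close>

lemma osc_const_le:
  assumes c: "c > 0" "\<And>\<eta>. c * norm \<eta> \<le> norm (freq A q \<eta>)"
    and K: "K > 0" "\<And>r v. norm (freq A r v) \<le> K * norm v" and L: "L > 0"
    and e: "e = \<alpha> A \<kappa> / real l ^ q * norm (freq A q \<eta>)"
    and \<eta>: "norm \<eta> \<ge> R" "R > 0" and r: "r = \<alpha> A \<kappa> * c / (4 * real l ^ q)"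
  shows "osc_const (q + m) (1 / real L) (e / 4) \<eta>
    \<le> (3 * real L / (2 * r) + 9/4 * \<alpha> A \<kappa> / r\<^sup>2) / R + 9/2 * K / (\<alpha> A \<kappa> * real l ^ m)"
proof -
  let ?\<alpha> = "\<alpha> A \<kappa>" and ?N = "norm \<eta>" and ?N' = "norm (freq A q \<eta>)"
  have \<alpha>: "?\<alpha> > 0" by (rule \<alpha>_pos)
  have N: "?N > 0" using \<eta> by linarith
  have N': "?N' > 0" using c(2)[of \<eta>] mult_pos_pos[OF c(1) N] by linarith
  have lq: "real l ^ q > 0" "real l ^ m > 0" using l0 by simp_all
  have r0: "r > 0" unfolding r using \<alpha> c(1) lq by simp
  have er: "r * ?N \<le> e / 4"
  proof -
    have "r * ?N = ?\<alpha> / (4 * real l ^ q) * (c * ?N)" by (simp add: r)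
    also have "\<dots> \<le> ?\<alpha> / (4 * real l ^ q) * ?N'" using \<alpha> lq c(2)[of \<eta>] by (intro mult_left_mono) auto
    also have "\<dots> = e / 4" by (simp add: e)
    finally show ?thesis .
  qed
  have rN: "r * ?N > 0" using r0 N by simp
  have 1: "(3 / (2 * (1 / real L))) / (e / 4) \<le> (3 * real L / (2 * r)) / R"
  proof -
    have "r * R \<le> e / 4" using mult_left_mono[OF \<eta>(1), of r] r0 er by linarith
    then have "(3 * real L / 2) / (e / 4) \<le> (3 * real L / 2) / (r * R)"
      using L r0 \<eta> by (intro frac_le) auto
    then show ?thesis by simp
  qed
  have 2: "9/8 * (2 * ?\<alpha> * ?N) / (e / 4)\<^sup>2 \<le> (9/4 * ?\<alpha> / r\<^sup>2) / R"
  proof -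
    have "9/8 * (2 * ?\<alpha> * ?N) / (e / 4)\<^sup>2 \<le> 9/8 * (2 * ?\<alpha> * ?N) / (r * ?N)\<^sup>2"
    proof (rule divide_left_mono)
      show "(r * ?N)\<^sup>2 \<le> (e / 4)\<^sup>2" using rN er by (intro power_mono) auto
      show "0 \<le> 9/8 * (2 * ?\<alpha> * ?N)" using \<alpha> N by simp
      have "e > 0" using rN er by linarith
      then show "0 < (e / 4)\<^sup>2 * (r * ?N)\<^sup>2" by (intro mult_pos_pos[OF zero_less_power zero_less_power[OF rN]]) simp
    qed
    also have "\<dots> = (9/4 * ?\<alpha> / r\<^sup>2) / ?N" using N r0 by (simp add: power2_eq_square field_simps)
    also have "\<dots> \<le> (9/4 * ?\<alpha> / r\<^sup>2) / R" using \<eta> \<alpha> r0 N by (intro divide_left_mono) auto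
    finally show ?thesis .
  qed
  have 3: "9/8 * (norm (freq A (q + m) \<eta>) / real l ^ (q + m)) / (e / 4) \<le> 9/2 * K / (?\<alpha> * real l ^ m)"
  proof -
    have "9/8 * (norm (freq A (q + m) \<eta>) / real l ^ (q + m)) / (e / 4)
        \<le> 9/8 * (K * ?N' / real l ^ (q + m)) / (e / 4)"
      using K(2)[of m "freq A q \<eta>"] rN er unfolding freq_add
      by (intro divide_right_mono mult_left_mono) auto
    also have "\<dots> = 9/2 * K / (?\<alpha> * real l ^ m)"
    proof -
      have "9/8 * (K * n / (x * y)) / (z / x * n / 4) = 9/2 * K / (z * y)"
        if "x > 0" "y > 0" "z > 0" "n > 0" for x y z n :: real using that by (simp add: field_simps)
      from this[OF lq \<alpha> N'] show ?thesis unfolding e power_add .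
    qed
    finally show ?thesis .
  qed
  show ?thesis unfolding osc_const_def using add_mono[OF add_mono[OF 1 2] 3] by (simp only: add_divide_distrib)
qed

text \<open>
  The parameters are chosen in the order in which they depend on each other: the lag \<open>j\<close> makes the
  derivatives contract, then \<open>m\<close> makes the third term of \<open>osc_const\<close> small, then the number \<open>L\<close> of windows makes
  them short enough for the refinement of far pairs, and finally the radius \<open>R\<close>, beyond which the
  inequality is used, makes the first two terms small.  Half of the contraction goes to the near pairs,
  where \<open>36 \<ge> 2 * 27/8\<close> is used, and a quarter to each of the two parts of the remainder.
\<close>

theorem energy_bounded:
  assumes q: "q \<ge> 1"
    and count: "\<And>(\<xi>::int) \<eta> x. x \<in> circle \<Longrightarrow> card {w \<in> words l q.
        \<bar>real_of_int \<xi> + inner \<eta> (S1 w x)\<bar> < 2 * (\<alpha> A \<kappa> / real l ^ q * norm (freq A q \<eta>))} \<le> M"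
    and small: "36 * (real M / real l ^ q * loss q) < 1"
    and decay: "(\<lambda>j. loss j / real l ^ j) \<longlonglongrightarrow> 0"
  obtains X where "\<And>n. energy (G n) n \<le> ennreal X"
proof -
  let ?\<alpha> = "\<alpha> A \<kappa>"
  have \<alpha>: "?\<alpha> > 0" by (rule \<alpha>_pos)
  obtain c where c: "c > 0" "\<And>\<eta>. c * norm \<eta> \<le> norm (freq A q \<eta>)" using freq_lower by blast
  obtain K where K: "K > 0" "\<And>r v. norm (freq A r v) \<le> K * norm v" using freq_bounded by blast
  have lp: "real l ^ p > 0" "real l ^ p \<ge> 1" for p using l by simp_all
  \<comment> \<open>The lag \<open>j\<close> of the recursion for the derivatives.\<close>
  have "eventually (\<lambda>j. loss j / real l ^ j < 1 / (4 * K\<^sup>2)) sequentially"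
    using order_tendstoD(2)[OF decay, of "1 / (4 * K\<^sup>2)"] K(1) by simp
  then obtain j0 where j0: "\<And>j. j \<ge> j0 \<Longrightarrow> loss j / real l ^ j < 1 / (4 * K\<^sup>2)"
    unfolding eventually_sequentially by blast
  define j where "j = Suc j0"
  have half: "2 * K\<^sup>2 / (real l ^ j)\<^sup>2 * loss j \<le> 1 / 2"
  proof -
    have "2 * K\<^sup>2 / (real l ^ j)\<^sup>2 * loss j = 2 * K\<^sup>2 * (loss j / real l ^ j) / real l ^ j" by (simp add: power2_eq_square)
    also have "\<dots> \<le> 2 * K\<^sup>2 * (loss j / real l ^ j) / 1"
      using lp loss_nonneg by (intro divide_left_mono) auto
    also have "\<dots> \<le> 2 * K\<^sup>2 * (1 / (4 * K\<^sup>2))"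
      using j0[of j] by (intro order.trans[OF eq_refl[OF div_by_1] mult_left_mono]) (auto simp: j_def)
    also have "\<dots> = 1 / 2" using K(1) by simp
    finally show ?thesis .
  qed
  define cb where "cb = 2 * (pi * ?\<alpha>)\<^sup>2 * loss j"
  have cb: "cb \<ge> 0" unfolding cb_def using loss_nonneg by simp
  \<comment> \<open>The number \<open>m\<close> of further letters beats the derivative of the innermost factor.\<close>
  have "(\<lambda>m. real l ^ q * (loss (m + q) / real l ^ (m + q))) \<longlonglongrightarrow> real l ^ q * 0"
    by (intro tendsto_mult tendsto_const LIMSEQ_ignore_initial_segment[OF decay])
  then have "eventually (\<lambda>m. real l ^ q * (loss (m + q) / real l ^ (m + q)) < ?\<alpha> / (54 * K * (1 + 2 * cb))) sequentially"
    using \<alpha> K(1) cb by (intro order_tendstoD(2)[of _ 0]) auto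
  then obtain m where m: "real l ^ q * (loss (m + q) / real l ^ (m + q)) < ?\<alpha> / (54 * K * (1 + 2 * cb))"
    unfolding eventually_sequentially by blast
  have m': "3 * (9/2 * K / (?\<alpha> * real l ^ m)) * loss (q + m) * (1 + 2 * cb) \<le> 1 / 4"
  proof -
    have "loss (q + m) / real l ^ m \<le> ?\<alpha> / (54 * K * (1 + 2 * cb))"
    proof -
      have "real l ^ q * (loss (m + q) / real l ^ (m + q)) = loss (q + m) / real l ^ m"
        using l by (simp add: power_add add.commute)
      then show ?thesis using m by linarith
    qed
    then have "loss (q + m) / real l ^ m * (27/2 * K * (1 + 2 * cb) / ?\<alpha>)
        \<le> ?\<alpha> / (54 * K * (1 + 2 * cb)) * (27/2 * K * (1 + 2 * cb) / ?\<alpha>)"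
      using \<alpha> K(1) cb by (intro mult_right_mono) auto
    also have "\<dots> = 1 / 4"
    proof -
      have eq: "?\<alpha> / (54 * K * u) * (27/2 * K * u / ?\<alpha>) = 1 / 4" if "u > 0" for u
        using \<alpha> K(1) that by simp
      show ?thesis by (rule eq) (use cb in simp)
    qed
    finally have fin: "loss (q + m) / real l ^ m * (27/2 * K * (1 + 2 * cb) / ?\<alpha>) \<le> 1 / 4" .
    have eq: "3 * (9/2 * K / (z * x)) * y * u = y / x * (27/2 * K * u / z)" for x y z u :: real by (simp add: mult_ac)
    show ?thesis unfolding eq by (rule fin)
  qed
  \<comment> \<open>Windows of length \<open>1 / L\<close> are short in the sense of \<open>far_refined\<close>.\<close>
  define L where "L = nat \<lceil>16 * real l ^ q / c\<rceil> + 1"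
  have L: "L > 0" "16 * real l ^ q / c \<le> real L" unfolding L_def by linarith+
  define r where "r = ?\<alpha> * c / (4 * real l ^ q)"
  define C1 where "C1 = 3 * real L / (2 * r) + 9/4 * ?\<alpha> / r\<^sup>2"
  have r0: "r > 0" unfolding r_def using \<alpha> c(1) lp by simp
  have C1: "C1 \<ge> 0" unfolding C1_def using r0 \<alpha> by (intro add_nonneg_nonneg) auto
  \<comment> \<open>The first quotient makes \<open>e > 1\<close>, the last summand serves the first two terms of \<open>osc_const\<close>.\<close>
  define R where "R = 1 + real l ^ q / (?\<alpha> * c) + 12 * C1 * loss (q + m) * (1 + 2 * cb)"
  have Rterms: "real l ^ q / (?\<alpha> * c) \<ge> 0" "12 * C1 * loss (q + m) * (1 + 2 * cb) \<ge> 0"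
    using \<alpha> c(1) lp C1 loss_nonneg cb by (auto intro!: mult_nonneg_nonneg divide_nonneg_nonneg)
  have R: "R > 0" "R > real l ^ q / (?\<alpha> * c)" "12 * C1 * loss (q + m) * (1 + 2 * cb) \<le> R"
    using Rterms unfolding R_def by linarith+
  define t where "t = 3 * (C1 / R + 9/2 * K / (?\<alpha> * real l ^ m))"
  have t0: "t \<ge> 0" unfolding t_def using C1 R K(1) \<alpha> lp by (intro mult_nonneg_nonneg add_nonneg_nonneg divide_nonneg_nonneg) auto
  define \<rho> where "\<rho> = 27/8 * real M / real l ^ q"
  have \<rho>0: "\<rho> \<ge> 0" unfolding \<rho>_def by simp
  have G_le: "G (q + (m + n)) \<eta> \<le> \<rho> * G (m + n) (freq A q \<eta>) + t * (G n (freq A (q + m) \<eta>) + H n (freq A (q + m) \<eta>))"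
    if \<eta>: "norm \<eta> > R" for \<eta> n
  proof -
    define e where "e = ?\<alpha> / real l ^ q * norm (freq A q \<eta>)"
    have ec: "?\<alpha> * c / real l ^ q * norm \<eta> \<le> e"
    proof -
      have "?\<alpha> / real l ^ q * (c * norm \<eta>) \<le> e" unfolding e_def using \<alpha> lp c(2) by (intro mult_left_mono) auto
      then show ?thesis by (simp add: mult_ac)
    qed
    have "1 < ?\<alpha> * c / real l ^ q * norm \<eta>"
    proof -
      have "real l ^ q / (?\<alpha> * c) < norm \<eta>" using R(2) \<eta> by linarith
      then show ?thesis using \<alpha> c(1) lp by (simp add: field_simps)
    qed
    then have e1: "e > 1" using ec by linarith
    have "16 * (?\<alpha> * norm \<eta>) = ?\<alpha> * c / real l ^ q * norm \<eta> * (16 * real l ^ q / c)" using c(1) l0 by simp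
    also have "\<dots> \<le> e * real L" using ec L(2) e1 c(1) by (intro mult_mono) auto
    finally have sm: "16 * (?\<alpha> * norm \<eta>) \<le> e * real L" .
    obtain c' where c': "c' > 0" "\<And>\<eta>. c' * norm \<eta> \<le> norm (freq A (q + m) \<eta>)" using freq_lower by blast
    have "norm (freq A (q + m) \<eta>) > 0" using c'(2)[of \<eta>] mult_pos_pos[OF c'(1), of "norm \<eta>"] \<eta> R(1) by linarith
    then have nz: "freq A (q + m) \<eta> \<noteq> 0" by simp
    have "G (q + (m + n)) \<eta> \<le> \<rho> * G (m + n) (freq A q \<eta>)
      + 3 * osc_const (q + m) (1 / real L) (e / 4) \<eta> * (G n (freq A (q + m) \<eta>) + H n (freq A (q + m) \<eta>))"
      using basic_inequality[OF L(1) e_def e1 sm _ nz, of M n] count[of _ _ \<eta>] unfolding \<rho>_def e_def integral_Q G_def[symmetric] by blast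
    also have "\<dots> \<le> \<rho> * G (m + n) (freq A q \<eta>) + t * (G n (freq A (q + m) \<eta>) + H n (freq A (q + m) \<eta>))"
      unfolding t_def C1_def
      using osc_const_le[OF c K L(1) e_def less_imp_le[OF \<eta>] R(1) r_def, of m] G_nonneg H_nonneg
      by (intro add_left_mono mult_right_mono mult_left_mono add_nonneg_nonneg) auto
    finally show ?thesis .
  qed
  define Z where "Z = enn2real (\<integral>\<^sup>+\<eta>. ennreal (weight A s \<eta>) * indicator {\<eta>. norm \<eta> \<le> R} \<eta> \<partial>lborel)"
  have Z: "(\<integral>\<^sup>+\<eta>. ennreal (weight A s \<eta>) * indicator {\<eta>. norm \<eta> \<le> R} \<eta> \<partial>lborel) = ennreal Z" "Z \<ge> 0"
    using weight_locally_integrable[OF s, of R] by (simp_all add: Z_def)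
  have rec_a: "a (q + (m + n)) \<le> \<rho> * loss q * a (m + n) + t * loss (q + m) * (a n + b n) + Z" for n
    by (rule a_recursion[OF q \<rho>0 t0 G_le Z])
  have rec_b: "b (j + n) \<le> cb * a n + b n / 2" for n
  proof -
    have "b (j + n) \<le> cb * a n + 2 * K\<^sup>2 / (real l ^ j)\<^sup>2 * loss j * b n"
      unfolding cb_def by (rule b_recursion[OF _ K(2)]) (simp add: j_def)
    also have "\<dots> \<le> cb * a n + 1 / 2 * b n" using half by (intro add_left_mono mult_right_mono) (auto simp: b_def)
    finally show ?thesis by simp
  qed
  have total: "\<rho> * loss q + t * loss (q + m) * (1 + 2 * cb) < 1"
  proof -
    have "\<rho> * loss q < 1 / 2"
    proof -
      have eq: "27/8 * x / y * z = 27/8 * (x / y * z)" for x y z :: real by simp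
      have lt: "27/8 * y < 1 / 2" if "36 * y < 1" for y :: real using that by simp
      show ?thesis unfolding \<rho>_def eq by (rule lt[OF small])
    qed
    moreover have "t * loss (q + m) * (1 + 2 * cb) = 3 * (C1 / R) * loss (q + m) * (1 + 2 * cb)
        + 3 * (9/2 * K / (?\<alpha> * real l ^ m)) * loss (q + m) * (1 + 2 * cb)"
      unfolding t_def by (simp only: distrib_left distrib_right)
    moreover have "3 * (C1 / R) * loss (q + m) * (1 + 2 * cb) \<le> 1 / 4"
    proof -
      have "3 * (C1 / R) * loss (q + m) * (1 + 2 * cb) = (12 * C1 * loss (q + m) * (1 + 2 * cb)) / R / 4" by simp
      also have "\<dots> \<le> 1 / 4"
      proof -
        have le: "y / R / 4 \<le> 1 / 4" if "y \<le> R" for y using that R(1) by (simp add: divide_le_eq)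
        show ?thesis by (rule le[OF R(3)])
      qed
      finally show ?thesis .
    qed
    ultimately show ?thesis using m' by linarith
  qed
  show thesis
  proof (rule coupled_recursion_bounded[of a b q j cb "t * loss (q + m)" "\<rho> * loss q" Z m])
    fix X assume X: "\<And>n. a n \<le> X"
    show thesis by (rule that[of X], unfold energy_a, rule ennreal_leI[OF X])
  qed (use rec_a rec_b q cb t0 \<rho>0 Z(2) loss_nonneg total in \<open>simp_all add: a_nonneg b_nonneg j_def\<close>)
qed

end

section \<open>The Fourier transform of the measure\<close>

lemma bernoulli_prob: "l \<ge> 1 \<Longrightarrow> product_prob_space (\<lambda>_::nat. uniform_count_measure {1..l::nat})"
  by (intro product_prob_spaceI prob_space_uniform_count_measure) auto

lemma space_bernoulli: "a \<in> space (bernoulli l) \<longleftrightarrow> (\<forall>i. a i \<in> {1..l})"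
  by (auto simp: bernoulli_def space_PiM space_uniform_count_measure)

lemma map_upt_eq_iff: "map a [0..<length w] = w \<longleftrightarrow> (\<forall>i<length w. a i = w ! i)"
  unfolding list_eq_iff_nth_eq by simp

lemma measurable_prefix: "(\<lambda>a. map a [0..<n]) \<in> bernoulli l \<rightarrow>\<^sub>M count_space (words l n)"
proof -
  have "(\<lambda>a. map a [0..<n]) -` {w} \<inter> space (bernoulli l) \<in> sets (bernoulli l)" if w: "w \<in> words l n" for w
  proof -
    have "(\<lambda>a. map a [0..<n]) -` {w} \<inter> space (bernoulli l) = {a \<in> space (bernoulli l). \<forall>i\<in>{..<n}. a i = w ! i}"
      unfolding length_words[OF w, symmetric] by (auto simp: map_upt_eq_iff)
    also have "\<dots> \<in> sets (bernoulli l)"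
    proof (intro sets.sets_Collect_finite_All)
      fix i
      have "(\<lambda>a. a i) \<in> bernoulli l \<rightarrow>\<^sub>M count_space {1..l}"
        unfolding bernoulli_def measurable_cong_sets[OF refl sets_uniform_count_measure_count_space[symmetric]]
        by (rule measurable_component_singleton) simp
      then have "(\<lambda>a. a i) -` ({w ! i} \<inter> {1..l}) \<inter> space (bernoulli l) \<in> sets (bernoulli l)" by (rule measurable_sets) simp
      also have "(\<lambda>a. a i) -` ({w ! i} \<inter> {1..l}) \<inter> space (bernoulli l) = {a \<in> space (bernoulli l). a i = w ! i}"
      proof (rule Set.set_eqI)
        fix a
        have "a i \<in> {1..l}" if "a \<in> space (bernoulli l)" using that by (simp add: space_bernoulli)
        then show "a \<in> (\<lambda>a. a i) -` ({w ! i} \<inter> {1..l}) \<inter> space (bernoulli l) \<longleftrightarrow> a \<in> {a \<in> space (bernoulli l). a i = w ! i}"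
          by blast
      qed
      finally show "{a \<in> space (bernoulli l). a i = w ! i} \<in> sets (bernoulli l)" .
    qed simp
    finally show ?thesis .
  qed
  moreover have "(\<lambda>a. map a [0..<n]) \<in> space (bernoulli l) \<rightarrow> words l n"
    by (auto simp: words_def space_bernoulli)
  ultimately show ?thesis by (subst measurable_count_space_eq2) auto
qed

lemma measure_prefix:
  assumes l: "l \<ge> 1" and w: "w \<in> words l n"
  shows "measure (bernoulli l) {a \<in> space (bernoulli l). map a [0..<n] = w} = 1 / real l ^ n"
proof -
  interpret product_prob_space "\<lambda>_::nat. uniform_count_measure {1..l}" UNIV by (rule bernoulli_prob[OF l])
  have wi: "w ! i \<in> {1..l}" if "i < n" for i using w that nth_mem[of i w] by (auto simp: words_def simp del: nth_mem)
  have "{a \<in> space (bernoulli l). map a [0..<n] = w} = {a \<in> space (bernoulli l). \<forall>i\<in>{..<n}. a i \<in> {w ! i}}"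
    unfolding length_words[OF w, symmetric] by (auto simp: map_upt_eq_iff)
  also have "emeasure (bernoulli l) \<dots> = (\<Prod>i<n. emeasure (uniform_count_measure {1..l}) {w ! i})"
    unfolding bernoulli_def by (rule emeasure_PiM_Collect) (use wi in \<open>auto simp: sets_uniform_count_measure\<close>)
  also have "\<dots> = (\<Prod>i<n. ennreal (1 / real l))"
    by (rule prod.cong) (use wi in \<open>auto simp: emeasure_uniform_count_measure\<close>)
  also have "\<dots> = ennreal (1 / real l ^ n)"
    by (simp add: ennreal_power power_one_over)
  finally show ?thesis by (intro measure_eq_emeasure_eq_ennreal) simp_all
qed

lemma prob_space_bernoulli: "l \<ge> 1 \<Longrightarrow> prob_space (bernoulli l)"
  unfolding bernoulli_def by (intro prob_space_PiM prob_space_uniform_count_measure) auto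

lemma integral_prefix:
  fixes h :: "nat list \<Rightarrow> complex"
  assumes l: "l \<ge> 1"
  shows "(\<integral>a. h (map a [0..<n]) \<partial>bernoulli l) = (\<Sum>w\<in>words l n. h w) / of_nat l ^ n"
proof -
  interpret prob_space "bernoulli l" by (rule prob_space_bernoulli[OF l])
  let ?A = "\<lambda>w. {a \<in> space (bernoulli l). map a [0..<n] = w}"
  have A: "?A w \<in> sets (bernoulli l)" if "w \<in> words l n" for w
  proof -
    have "(\<lambda>a. map a [0..<n]) -` {w} \<inter> space (bernoulli l) \<in> sets (bernoulli l)"
      by (rule measurable_sets[OF measurable_prefix]) (use that in simp)
    also have "(\<lambda>a. map a [0..<n]) -` {w} \<inter> space (bernoulli l) = ?A w" by auto
    finally show ?thesis .
  qed
  have "(\<integral>a. h (map a [0..<n]) \<partial>bernoulli l) = (\<integral>a. (\<Sum>w\<in>words l n. indicator (?A w) a *\<^sub>R h w) \<partial>bernoulli l)"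
  proof (rule Bochner_Integration.integral_cong[OF refl])
    fix a assume a: "a \<in> space (bernoulli l)"
    then have "map a [0..<n] \<in> words l n" by (auto simp: words_def space_bernoulli)
    moreover have "(\<Sum>w\<in>words l n. indicator (?A w) a *\<^sub>R h w) = (\<Sum>w\<in>words l n. if map a [0..<n] = w then h w else 0)"
      using a by (intro sum.cong) (auto simp: indicator_def)
    ultimately show "h (map a [0..<n]) = (\<Sum>w\<in>words l n. indicator (?A w) a *\<^sub>R h w)" by simp
  qed
  also have "\<dots> = (\<Sum>w\<in>words l n. \<integral>a. indicator (?A w) a *\<^sub>R h w \<partial>bernoulli l)"
    by (rule Bochner_Integration.integral_sum) (intro integrable_scaleR_left integrable_real_indicator A, simp_all add: emeasure_eq_measure)
  also have "\<dots> = (\<Sum>w\<in>words l n. (1 / real l ^ n) *\<^sub>R h w)"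
  proof (rule sum.cong[OF refl])
    fix w assume w: "w \<in> words l n"
    have "(\<integral>a. indicator (?A w) a *\<^sub>R h w \<partial>bernoulli l) = (\<integral>a. indicator (?A w) a \<partial>bernoulli l) *\<^sub>R h w"
      by (rule integral_scaleR_left) (intro integrable_real_indicator A w, simp add: emeasure_eq_measure)
    also have "(\<integral>a. indicator (?A w) a \<partial>bernoulli l) = measure (bernoulli l) (?A w \<inter> space (bernoulli l))"
      by (rule Bochner_Integration.integral_indicator)
    also have "?A w \<inter> space (bernoulli l) = ?A w" by auto
    finally show "(\<integral>a. indicator (?A w) a *\<^sub>R h w \<partial>bernoulli l) = (1 / real l ^ n) *\<^sub>R h w"
      by (simp only: measure_prefix[OF l w])
  qed
  also have "\<dots> = (\<Sum>w\<in>words l n. h w) / of_nat l ^ n"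
    by (simp add: scaleR_conv_of_real sum_divide_distrib)
  finally show ?thesis .
qed

lemma integral_cis_int:
  fixes k :: int
  shows "integral {0..1} (\<lambda>x. cis (2 * pi * real_of_int k * x)) = (if k = 0 then 1 else 0)"
proof (cases "k = 0")
  case False
  let ?c = "2 * pi * real_of_int k"
  have c: "complex_of_real ?c * \<i> \<noteq> 0" using False by simp
  have "((\<lambda>x. cis (?c * x)) has_integral cis (?c * 1) / (of_real ?c * \<i>) - cis (?c * 0) / (of_real ?c * \<i>)) {0..1}"
  proof (rule fundamental_theorem_of_calculus)
    fix x :: real
    have "((\<lambda>x. ?c * x) has_vector_derivative ?c * 1) (at x within {0..1})"
      by (rule has_vector_derivative_mult_right) (rule has_vector_derivative_id)
    from has_vector_derivative_divide[OF has_vector_derivative_cis[OF this], of "of_real ?c * \<i>"]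
    show "((\<lambda>x. cis (?c * x) / (of_real ?c * \<i>)) has_vector_derivative cis (?c * x)) (at x within {0..1})"
      using c by (simp add: scaleR_conv_of_real)
  qed simp
  moreover have "cis (?c * 1) = 1"
    using cis_multiple_2pi[of "real_of_int k"] by (simp add: mult_ac)
  ultimately show ?thesis using False by (simp add: integral_unique)
qed simp

text \<open>Expanding \<open>0 \<le> \<integral> |f - p|^2\<close> for the trigonometric polynomial \<open>p\<close> with the Fourier coefficients of \<open>f\<close>.\<close>

lemma Bessel_inequality:
  fixes f :: "real \<Rightarrow> complex"
  assumes f: "continuous_on UNIV f" and fin: "finite \<Xi>"
  shows "(\<Sum>\<xi>\<in>\<Xi>. (norm (integral {0..1} (\<lambda>x. cis (- 2 * pi * real_of_int \<xi> * x) * f x)))\<^sup>2) \<le> integral {0..1} (\<lambda>x. (norm (f x))\<^sup>2)"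
proof -
  define e where "e = (\<lambda>(\<xi>::int) x. cis (2 * pi * real_of_int \<xi> * x))"
  define c where "c = (\<lambda>\<xi>. integral {0..1} (\<lambda>x. cis (- 2 * pi * real_of_int \<xi> * x) * f x))"
  define p where "p = (\<lambda>x. \<Sum>\<xi>\<in>\<Xi>. c \<xi> * e \<xi> x)"
  have ce: "continuous_on UNIV (e \<xi>)" for \<xi> unfolding e_def by (intro continuous_intros)
  have cp: "continuous_on UNIV p" unfolding p_def by (intro continuous_intros ce)
  have c_alt: "integral {0..1} (\<lambda>x. f x * cnj (e \<xi> x)) = c \<xi>" for \<xi>
    unfolding c_def e_def cis_cnj by (simp add: mult.commute)
  have cnj_p: "cnj (p x) = (\<Sum>\<xi>\<in>\<Xi>. cnj (c \<xi>) * cnj (e \<xi> x))" for x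
    unfolding p_def cnj_sum complex_cnj_mult ..
  have fp: "integral {0..1} (\<lambda>x. f x * cnj (p x)) = (\<Sum>\<xi>\<in>\<Xi>. of_real ((norm (c \<xi>))\<^sup>2))"
  proof -
    have "(\<lambda>x. f x * cnj (p x)) = (\<lambda>x. \<Sum>\<xi>\<in>\<Xi>. cnj (c \<xi>) * (f x * cnj (e \<xi> x)))"
      unfolding cnj_p sum_distrib_left by (simp only: mult_ac)
    then have "integral {0..1} (\<lambda>x. f x * cnj (p x)) = (\<Sum>\<xi>\<in>\<Xi>. integral {0..1} (\<lambda>x. cnj (c \<xi>) * (f x * cnj (e \<xi> x))))"
      by (simp only:) (rule integral_sum[OF fin], intro integrable_cont continuous_intros f ce)
    also have "\<dots> = (\<Sum>\<xi>\<in>\<Xi>. cnj (c \<xi>) * c \<xi>)" by (simp only: integral_mult_right c_alt)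
    finally show ?thesis by (simp only: complex_norm_square mult.commute)
  qed
  have ep: "integral {0..1} (\<lambda>x. p x * cnj (e \<xi> x)) = c \<xi>" if "\<xi> \<in> \<Xi>" for \<xi>
  proof -
    have "(\<lambda>x. p x * cnj (e \<xi> x)) = (\<lambda>x. \<Sum>\<zeta>\<in>\<Xi>. c \<zeta> * cis (2 * pi * real_of_int (\<zeta> - \<xi>) * x))"
      unfolding p_def e_def sum_distrib_right cis_cnj mult.assoc cis_mult by (simp add: algebra_simps)
    then have "integral {0..1} (\<lambda>x. p x * cnj (e \<xi> x)) = (\<Sum>\<zeta>\<in>\<Xi>. integral {0..1} (\<lambda>x. c \<zeta> * cis (2 * pi * real_of_int (\<zeta> - \<xi>) * x)))"
      by (simp only:) (rule integral_sum[OF fin], intro integrable_cont continuous_intros)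
    also have "\<dots> = (\<Sum>\<zeta>\<in>\<Xi>. c \<zeta> * (if \<zeta> - \<xi> = 0 then 1 else 0))" by (simp only: integral_mult_right integral_cis_int)
    also have "\<dots> = (\<Sum>\<zeta>\<in>\<Xi>. if \<zeta> = \<xi> then c \<zeta> else 0)" by (rule sum.cong) auto
    also have "\<dots> = c \<xi>" using fin that by simp
    finally show ?thesis .
  qed
  have pp: "integral {0..1} (\<lambda>x. p x * cnj (p x)) = (\<Sum>\<xi>\<in>\<Xi>. of_real ((norm (c \<xi>))\<^sup>2))"
  proof -
    have "(\<lambda>x. p x * cnj (p x)) = (\<lambda>x. \<Sum>\<xi>\<in>\<Xi>. cnj (c \<xi>) * (p x * cnj (e \<xi> x)))"
      unfolding cnj_p sum_distrib_left by (simp only: mult_ac)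
    then have "integral {0..1} (\<lambda>x. p x * cnj (p x)) = (\<Sum>\<xi>\<in>\<Xi>. integral {0..1} (\<lambda>x. cnj (c \<xi>) * (p x * cnj (e \<xi> x))))"
      by (simp only:) (rule integral_sum[OF fin], intro integrable_cont continuous_intros cp ce)
    also have "\<dots> = (\<Sum>\<xi>\<in>\<Xi>. cnj (c \<xi>) * c \<xi>)" by (simp only: integral_mult_right) (simp add: ep)
    finally show ?thesis by (simp only: complex_norm_square mult.commute)
  qed
  let ?S = "\<Sum>\<xi>\<in>\<Xi>. (norm (c \<xi>))\<^sup>2"
  have Refp: "integral {0..1} (\<lambda>x. Re (f x * cnj (p x))) = ?S"
    using integral_linear[OF integrable_cont[of "\<lambda>x. f x * cnj (p x)" 0 1] bounded_linear_Re] fp f cp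
    by (simp add: o_def continuous_intros)
  have Repp: "integral {0..1} (\<lambda>x. (norm (p x))\<^sup>2) = ?S"
  proof -
    have "(\<lambda>x. (norm (p x))\<^sup>2) = (\<lambda>x. Re (p x * cnj (p x)))"
      by (simp only: complex_norm_square[symmetric] Re_complex_of_real)
    then show ?thesis
      using integral_linear[OF integrable_cont[of "\<lambda>x. p x * cnj (p x)" 0 1] bounded_linear_Re] pp cp
      by (simp add: o_def continuous_intros)
  qed
  have "0 \<le> integral {0..1} (\<lambda>x. (norm (f x - p x))\<^sup>2)"
    by (intro integral_nonneg integrable_cont continuous_intros f cp) auto
  also have "(\<lambda>x. (norm (f x - p x))\<^sup>2) = (\<lambda>x. ((norm (f x))\<^sup>2 - 2 * Re (f x * cnj (p x))) + (norm (p x))\<^sup>2)"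
    by (rule ext) (simp add: cmod_power2, simp add: power2_eq_square algebra_simps)
  also have "integral {0..1} \<dots> = (integral {0..1} (\<lambda>x. (norm (f x))\<^sup>2) - 2 * integral {0..1} (\<lambda>x. Re (f x * cnj (p x)))) + integral {0..1} (\<lambda>x. (norm (p x))\<^sup>2)"
    unfolding integral_mult_right[symmetric]
    by (subst Henstock_Kurzweil_Integration.integral_add, (intro integrable_cont continuous_intros f cp)+,
        subst Henstock_Kurzweil_Integration.integral_diff, (intro integrable_cont continuous_intros f cp)+) (rule refl)
  finally have "0 \<le> integral {0..1} (\<lambda>x. (norm (f x))\<^sup>2) - 2 * ?S + ?S" unfolding Refp Repp .
  then have "?S \<le> integral {0..1} (\<lambda>x. (norm (f x))\<^sup>2)" by linarith
  then show ?thesis unfolding c_def .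
qed

context solenoid
begin

lemma S_inf_limit:
  assumes x: "x \<in> circle" and a: "a \<in> space (bernoulli l)" and b0: "\<And>x. norm (\<phi> x) \<le> \<kappa>"
  shows "(\<lambda>n. S (map a [0..<n]) x) \<longlonglongrightarrow> S_inf l A \<phi> x a"
proof -
  define f where "f = (\<lambda>j. matpow A j *v \<phi> (branch l (map a [0..<Suc j]) x))"
  have "summable f"
  proof (rule summable_comparison_test[OF _ summable_mult2[OF summable, of \<kappa>]], intro exI allI impI)
    fix j
    have "norm (f j) \<le> onorm (\<lambda>v. matpow A j *v v) * norm (\<phi> (branch l (map a [0..<Suc j]) x))"
      unfolding f_def by (rule onorm[OF matrix_vector_mul_bounded_linear])
    also have "\<dots> \<le> onorm (\<lambda>v. matpow A j *v v) * \<kappa>"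
      by (intro mult_left_mono b0 onorm_pos_le[OF matrix_vector_mul_bounded_linear])
    finally show "norm (f j) \<le> onorm (\<lambda>v. matpow A j *v v) * \<kappa>" .
  qed
  then have "(\<lambda>n. \<Sum>j<n. f j) \<longlonglongrightarrow> suminf f" by (rule summable_LIMSEQ)
  moreover have "(\<Sum>j<n. f j) = S (map a [0..<n]) x" for n
    unfolding S_def f_def by (intro sum.cong) (auto simp: take_map)
  moreover have "suminf f = S_inf l A \<phi> x a"
  proof -
    have "set (map a [0..<Suc j]) \<subseteq> {1..l}" for j using a by (auto simp: space_bernoulli)
    then show ?thesis unfolding S_inf_def f_def by (simp only: inv_branch_eq[OF l1 _ x])
  qed
  ultimately show ?thesis by simp
qed

definition coeff :: "nat \<Rightarrow> int \<Rightarrow> real^'n \<Rightarrow> complex" where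
  "coeff n \<xi> \<eta> = integral {0..1} (\<lambda>x. cis (- 2 * pi * real_of_int \<xi> * x) * F n \<eta> x)"

lemma coeff_measurable [measurable]: "coeff n \<xi> \<in> borel_measurable borel"
proof -
  have "continuous_on UNIV (\<lambda>\<eta>. integral (cbox 0 1) (\<lambda>x. cis (- 2 * pi * real_of_int \<xi> * x) * F n \<eta> x))"
    by (rule integral_continuous_on_param)
      (use continuous_on_subset[OF continuous_F_joint(1)] in \<open>auto intro!: continuous_intros simp: case_prod_beta\<close>)
  then show ?thesis unfolding coeff_def by (intro borel_measurable_continuous_onI) simp
qed

lemma sum_coeff_le: "finite \<Xi> \<Longrightarrow> (\<Sum>\<xi>\<in>\<Xi>. (norm (coeff n \<xi> \<eta>))\<^sup>2) \<le> G n \<eta>"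
  unfolding coeff_def G_def by (rule Bessel_inequality[OF continuous_on_F])

abbreviation base :: "(real \<times> (nat \<Rightarrow> nat)) measure" where
  "base \<equiv> restrict_space lborel circle \<Otimes>\<^sub>M bernoulli l"

lemma finite_base: "finite_measure base" "pair_sigma_finite (restrict_space lborel circle) (bernoulli l)"
proof -
  have c: "circle \<in> sets lborel" by (simp add: circle_def)
  have 1: "finite_measure (restrict_space lborel circle)"
    by (rule finite_measureI) (use c in \<open>simp add: emeasure_restrict_space space_restrict_space\<close>, simp add: circle_def)
  interpret A: finite_measure "restrict_space lborel circle" by (rule 1)
  interpret B: prob_space "bernoulli l" by (rule prob_space_bernoulli[OF l1])
  show "finite_measure base" by (rule finite_measure_pair_measure) unfold_locales
  show "pair_sigma_finite (restrict_space lborel circle) (bernoulli l)" by unfold_locales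
qed

lemma space_base: "p \<in> space base \<longleftrightarrow> fst p \<in> circle \<and> snd p \<in> space (bernoulli l)"
  by (cases p) (auto simp: space_pair_measure space_restrict_space)

lemma measurable_fst_base [measurable]: "fst \<in> borel_measurable base"
proof -
  have "(\<lambda>x. x) \<in> borel_measurable (restrict_space lborel circle)" by (rule measurable_restrict_space1) simp
  from measurable_compose[OF measurable_fst this] show ?thesis .
qed

lemma S_prefix_measurable [measurable]: "(\<lambda>p. S (map (snd p) [0..<n]) (fst p)) \<in> borel_measurable base"
proof (rule measurable_compose_countable'[where f = "\<lambda>w p. S w (fst p)" and I = "words l n"])
  show "(\<lambda>p. S w (fst p)) \<in> borel_measurable base" for w
    by (rule measurable_compose[OF measurable_fst_base borel_measurable_continuous_onI[OF continuous_on_S]])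
  show "(\<lambda>p. map (snd p) [0..<n]) \<in> base \<rightarrow>\<^sub>M count_space (words l n)"
    by (rule measurable_compose[OF measurable_snd measurable_prefix])
qed (simp add: countable_finite)

text \<open>
  Integrating out the letters first turns the transform of the truncated measure into \<open>coeff\<close>; the
  truncations converge pointwise and the integrand has modulus 1.
\<close>

lemma fourier_limit:
  assumes b0: "\<And>x. norm (\<phi> x) \<le> \<kappa>"
  shows "(\<lambda>n. coeff n \<xi> \<eta>) \<longlonglongrightarrow> fourier (srb l A \<phi>) \<xi> \<eta>"
proof -
  interpret finite_measure base by (rule finite_base)
  interpret pair_sigma_finite "restrict_space lborel circle" "bernoulli l" by (rule finite_base)
  have S_inf_measurable [measurable]: "(\<lambda>p. S_inf l A \<phi> (fst p) (snd p)) \<in> borel_measurable base"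
    by (rule borel_measurable_LIMSEQ_metric[OF S_prefix_measurable S_inf_limit[OF _ _ b0]]) (simp_all add: space_base)
  let ?E = "\<lambda>y x. cis (- 2 * pi * (real_of_int \<xi> * x + inner \<eta> y))"
  have [measurable]: "cis \<in> borel_measurable borel" by (intro borel_measurable_continuous_onI continuous_intros)
  have E_measurable: "(\<lambda>p. ?E (g p) (fst p)) \<in> borel_measurable base" if "g \<in> borel_measurable base" for g
    using that by measurable
  have T: "(\<lambda>(x, a). (x, S_inf l A \<phi> x a)) \<in> base \<rightarrow>\<^sub>M borel"
    unfolding borel_prod[symmetric] case_prod_beta by measurable
  have "fourier (srb l A \<phi>) \<xi> \<eta> = (\<integral>p. ?E (S_inf l A \<phi> (fst p) (snd p)) (fst p) \<partial>base)"
    unfolding fourier_def srb_def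
    by (subst integral_distr[OF T]) (auto simp: case_prod_beta intro!: borel_measurable_continuous_onI continuous_intros)
  moreover have "(\<lambda>n. \<integral>p. ?E (S (map (snd p) [0..<n]) (fst p)) (fst p) \<partial>base)
      \<longlonglongrightarrow> (\<integral>p. ?E (S_inf l A \<phi> (fst p) (snd p)) (fst p) \<partial>base)"
  proof (rule integral_dominated_convergence[where w = "\<lambda>_. 1"])
    show "AE p in base. (\<lambda>n. ?E (S (map (snd p) [0..<n]) (fst p)) (fst p)) \<longlonglongrightarrow> ?E (S_inf l A \<phi> (fst p) (snd p)) (fst p)"
    proof (rule AE_I2)
      fix p assume "p \<in> space base"
      then have lim: "(\<lambda>n. S (map (snd p) [0..<n]) (fst p)) \<longlonglongrightarrow> S_inf l A \<phi> (fst p) (snd p)"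
        by (intro S_inf_limit b0) (simp_all add: space_base)
      show "(\<lambda>n. ?E (S (map (snd p) [0..<n]) (fst p)) (fst p)) \<longlonglongrightarrow> ?E (S_inf l A \<phi> (fst p) (snd p)) (fst p)"
        by (intro tendsto_intros lim)
    qed
  qed (simp_all add: E_measurable S_inf_measurable S_prefix_measurable del: mult_minus_left minus_mult_left)
  moreover have "(\<integral>p. ?E (S (map (snd p) [0..<n]) (fst p)) (fst p) \<partial>base) = coeff n \<xi> \<eta>" for n
  proof -
    have int: "integrable base (\<lambda>p. ?E (S (map (snd p) [0..<n]) (fst p)) (fst p))"
      by (rule integrable_const_bound[where B = 1, OF _ E_measurable[OF S_prefix_measurable]]) simp
    have "(\<integral>p. ?E (S (map (snd p) [0..<n]) (fst p)) (fst p) \<partial>base)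
        = (\<integral>x. (\<integral>a. ?E (S (map a [0..<n]) x) x \<partial>bernoulli l) \<partial>restrict_space lborel circle)"
      using integral_fst'[OF int] by simp
    also have "\<dots> = (\<integral>x. cis (- 2 * pi * real_of_int \<xi> * x) * F n \<eta> x \<partial>restrict_space lborel circle)"
    proof (rule Bochner_Integration.integral_cong[OF refl])
      fix x
      have "(\<integral>a. ?E (S (map a [0..<n]) x) x \<partial>bernoulli l) = (\<Sum>w\<in>words l n. ?E (S w x) x) / of_nat l ^ n"
        by (rule integral_prefix[OF l1])
      also have "\<dots> = cis (- 2 * pi * real_of_int \<xi> * x) * F n \<eta> x"
      proof -
        have "?E (S w x) x = cis (- 2 * pi * real_of_int \<xi> * x) * cis (- 2 * pi * inner \<eta> (S w x))" for w
          unfolding cis_mult by (simp only: distrib_left mult.assoc)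
        then show ?thesis unfolding F_def by (simp only: sum_distrib_left[symmetric] times_divide_eq_right)
      qed
      finally show "(\<integral>a. ?E (S (map a [0..<n]) x) x \<partial>bernoulli l) = cis (- 2 * pi * real_of_int \<xi> * x) * F n \<eta> x" .
    qed
    also have "\<dots> = (\<integral>x. indicator {0..1} x *\<^sub>R (cis (- 2 * pi * real_of_int \<xi> * x) * F n \<eta> x) \<partial>lborel)"
    proof (subst integral_restrict_space)
      show "circle \<inter> space lborel \<in> sets lborel" by (simp add: circle_def)
      show "(\<integral>x. indicator circle x *\<^sub>R (cis (- 2 * pi * real_of_int \<xi> * x) * F n \<eta> x) \<partial>lborel)
          = (\<integral>x. indicator {0..1} x *\<^sub>R (cis (- 2 * pi * real_of_int \<xi> * x) * F n \<eta> x) \<partial>lborel)"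
      proof (rule integral_cong_AE)
        have [measurable]: "F n \<eta> \<in> borel_measurable borel" by (rule borel_measurable_continuous_onI[OF continuous_on_F])
        show "(\<lambda>x. indicator circle x *\<^sub>R (cis (- 2 * pi * real_of_int \<xi> * x) * F n \<eta> x)) \<in> borel_measurable lborel"
          unfolding circle_def by measurable
        show "(\<lambda>x. indicator {0..1} x *\<^sub>R (cis (- 2 * pi * real_of_int \<xi> * x) * F n \<eta> x)) \<in> borel_measurable lborel"
          by measurable
        show "AE x in lborel. indicator circle x *\<^sub>R (cis (- 2 * pi * real_of_int \<xi> * x) * F n \<eta> x)
            = indicator {0..1} x *\<^sub>R (cis (- 2 * pi * real_of_int \<xi> * x) * F n \<eta> x)"
          by (rule AE_mp[OF AE_lborel_singleton[of 1]]) (auto simp: circle_def indicator_def)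
      qed
    qed
    also have "\<dots> = coeff n \<xi> \<eta>"
    proof -
      have "set_integrable lborel {0..1} (\<lambda>x. cis (- 2 * pi * real_of_int \<xi> * x) * F n \<eta> x)"
        by (rule borel_integrable_atLeastAtMost') (intro continuous_intros continuous_on_F)
      from set_borel_integral_eq_integral(2)[OF this] show ?thesis
        unfolding coeff_def set_lebesgue_integral_def .
    qed
    finally show ?thesis .
  qed
  ultimately show ?thesis by simp
qed

end

context attractor
begin

text \<open>
  Fatou's lemma, first for finitely many \<open>\<xi>\<close>, for which Bessel's inequality bounds the sum of the squared
  coefficients by \<open>G n\<close>.  The cutoff in \<open>energy\<close> is eventually satisfied by every \<open>\<eta>\<close>, since \<open>freq A n \<eta>\<close> tends to 0.
\<close>

theorem in_L2_Hdot_of_energy_bounded: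
  assumes b0: "\<And>x. norm (\<phi> x) \<le> \<kappa>" and X: "\<And>n. energy (G n) n \<le> ennreal X"
  shows "in_L2_Hdot A s (srb l A \<phi>)"
proof -
  let ?u = "\<lambda>\<xi> \<eta>. fourier (srb l A \<phi>) \<xi> \<eta>"
  let ?f = "\<lambda>\<xi> \<eta>. ennreal ((norm (?u \<xi> \<eta>))\<^sup>2 * weight A s \<eta>)"
  have [measurable]: "?u \<xi> \<in> borel_measurable borel" for \<xi>
    by (rule borel_measurable_LIMSEQ_metric[OF coeff_measurable fourier_limit[OF b0]])
  have fin: "(\<Sum>\<xi>\<in>\<Xi>. \<integral>\<^sup>+\<eta>. ?f \<xi> \<eta> \<partial>lborel) \<le> ennreal X" if \<Xi>: "finite \<Xi>" for \<Xi>
  proof -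
    let ?g = "\<lambda>n \<eta>. ennreal (G n \<eta> * weight A s \<eta>) * indicator {\<eta>. norm (freq A n \<eta>) \<le> 1} \<eta>"
    have "(\<Sum>\<xi>\<in>\<Xi>. \<integral>\<^sup>+\<eta>. ?f \<xi> \<eta> \<partial>lborel) = (\<integral>\<^sup>+\<eta>. (\<Sum>\<xi>\<in>\<Xi>. ?f \<xi> \<eta>) \<partial>lborel)"
      by (rule nn_integral_sum[symmetric]) measurable
    also have "\<dots> \<le> (\<integral>\<^sup>+\<eta>. liminf (\<lambda>n. ?g n \<eta>) \<partial>lborel)"
    proof (rule nn_integral_mono)
      fix \<eta>
      let ?v = "\<lambda>n. ennreal ((\<Sum>\<xi>\<in>\<Xi>. (norm (coeff n \<xi> \<eta>))\<^sup>2) * weight A s \<eta>)"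
      have "?v \<longlonglongrightarrow> ennreal ((\<Sum>\<xi>\<in>\<Xi>. (norm (?u \<xi> \<eta>))\<^sup>2) * weight A s \<eta>)"
        by (intro tendsto_intros fourier_limit b0 tendsto_ennrealI)
      then have lim: "liminf ?v = ennreal ((\<Sum>\<xi>\<in>\<Xi>. (norm (?u \<xi> \<eta>))\<^sup>2) * weight A s \<eta>)"
        by (intro lim_imp_Liminf) simp_all
      have "(\<lambda>n. norm (freq A n \<eta>)) \<longlonglongrightarrow> 0"
        using tendsto_norm[OF freq_tendsto_0[of \<eta>]] by simp
      then have "eventually (\<lambda>n. norm (freq A n \<eta>) < 1) sequentially" by (rule order_tendstoD) simp
      then have "eventually (\<lambda>n. ?v n \<le> ?g n \<eta>) sequentially"
      proof eventually_elim
        case (elim n)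
        have "(\<Sum>\<xi>\<in>\<Xi>. (norm (coeff n \<xi> \<eta>))\<^sup>2) * weight A s \<eta> \<le> G n \<eta> * weight A s \<eta>"
          by (rule mult_right_mono[OF sum_coeff_le[OF \<Xi>] weight_nonneg])
        then show ?case using elim by (simp add: ennreal_leI)
      qed
      then have "liminf ?v \<le> liminf (\<lambda>n. ?g n \<eta>)" by (rule Liminf_mono)
      moreover have "(\<Sum>\<xi>\<in>\<Xi>. ?f \<xi> \<eta>) = ennreal ((\<Sum>\<xi>\<in>\<Xi>. (norm (?u \<xi> \<eta>))\<^sup>2) * weight A s \<eta>)"
        unfolding sum_distrib_right by (rule sum_ennreal) (simp add: weight_nonneg)
      ultimately show "(\<Sum>\<xi>\<in>\<Xi>. ?f \<xi> \<eta>) \<le> liminf (\<lambda>n. ?g n \<eta>)" unfolding lim by simp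
    qed
    also have "\<dots> \<le> liminf (\<lambda>n. \<integral>\<^sup>+\<eta>. ?g n \<eta> \<partial>lborel)"
      by (rule nn_integral_liminf) measurable
    also have "\<dots> \<le> limsup (\<lambda>n. energy (G n) n)" unfolding energy_def by (rule Liminf_le_Limsup) simp
    also have "\<dots> \<le> ennreal X" by (rule Limsup_bounded) (simp add: X)
    finally show ?thesis .
  qed
  have "(\<integral>\<^sup>+\<xi>. (\<integral>\<^sup>+\<eta>. ?f \<xi> \<eta> \<partial>lborel) \<partial>count_space UNIV)
      = (\<integral>\<^sup>+i. (\<integral>\<^sup>+\<eta>. ?f (int_decode i) \<eta> \<partial>lborel) \<partial>count_space UNIV)"
    by (rule nn_integral_bij_count_space[OF bij_int_decode, symmetric])
  also have "\<dots> = (\<Sum>i. \<integral>\<^sup>+\<eta>. ?f (int_decode i) \<eta> \<partial>lborel)" by (rule nn_integral_count_space_nat)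
  also have "\<dots> \<le> ennreal X"
  proof (rule suminf_le_const)
    fix n
    have "(\<Sum>i<n. \<integral>\<^sup>+\<eta>. ?f (int_decode i) \<eta> \<partial>lborel) = (\<Sum>\<xi>\<in>int_decode ` {..<n}. \<integral>\<^sup>+\<eta>. ?f \<xi> \<eta> \<partial>lborel)"
      by (rule sum.reindex[symmetric, unfolded o_def]) (rule inj_int_decode)
    also have "\<dots> \<le> ennreal X" by (rule fin) simp
    finally show "(\<Sum>i<n. \<integral>\<^sup>+\<eta>. ?f (int_decode i) \<eta> \<partial>lborel) \<le> ennreal X" .
  qed (rule summableI)
  also have "\<dots> < \<infinity>" by simp
  finally show ?thesis unfolding in_L2_Hdot_def .
qed

end

section \<open>Concentration multiplicity and conclusion\<close>

lemma Cr_circle_derivs: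
  assumes "\<phi> \<in> Cr_circle r" "r \<ge> 2"
  shows "\<phi> (x + 1) = \<phi> x"
    "(\<phi> has_vector_derivative iter_deriv 1 \<phi> x) (at x)"
    "(iter_deriv 1 \<phi> has_vector_derivative iter_deriv 2 \<phi> x) (at x)"
    "continuous_on UNIV (iter_deriv 2 \<phi>)"
proof -
  have C: "C_class r \<phi>" and P: "periodic \<phi>" using assms(1) by (auto simp: Cr_circle_def)
  show "\<phi> (x + 1) = \<phi> x" using P by (simp add: periodic_def)
  have diff: "iter_deriv k \<phi> differentiable (at y)" if "k < r" for k y using C that by (simp add: C_class_def)
  have D: "(iter_deriv k \<phi> has_vector_derivative iter_deriv (Suc k) \<phi> y) (at y)" if "k < r" for k y
  proof -
    have "iter_deriv (Suc k) \<phi> y = vector_derivative (iter_deriv k \<phi>) (at y)" by (simp add: iter_deriv_def)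
    then show ?thesis using diff[OF that] by (simp only: vector_derivative_works)
  qed
  have "iter_deriv 0 \<phi> = \<phi>" by (simp add: iter_deriv_def)
  then show "(\<phi> has_vector_derivative iter_deriv 1 \<phi> x) (at x)" using D[of 0 x] assms(2) by simp
  show "(iter_deriv 1 \<phi> has_vector_derivative iter_deriv 2 \<phi> x) (at x)"
    using D[of 1 x] assms(2) by (simp add: numeral_2_eq_2)
  show "continuous_on UNIV (iter_deriv 2 \<phi>)"
  proof (cases "r = 2")
    case True
    then show ?thesis using C by (simp add: C_class_def)
  next
    case False
    then have "2 < r" using assms(2) by simp
    then show ?thesis
      by (intro differentiable_imp_continuous_on) (simp add: differentiable_on_def diff)
  qed
qed

context solenoid
begin

text \<open>
  The affine continuations of the inverse branches from any cylinder are \<open>branch\<close>, so the derivative does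
  not depend on the cylinder.
\<close>

lemma S_ext_deriv_eq:
  assumes c: "c \<in> words l p" and a: "a \<in> words l q"
  shows "S_ext_deriv l A \<phi> c a x = S1 a x"
proof -
  have "S_ext l A \<phi> c a y = S a y" for y
  proof -
    have "S_ext l A \<phi> c a y = (\<Sum>j=1..length a. matpow A (j - 1) *v \<phi> (branch l (take j a) y))"
      unfolding S_ext_def
    proof (rule sum.cong[OF refl])
      fix j
      have "set (take j a) \<subseteq> {1..l}" using a set_take_subset[of j a] by (auto simp: words_def)
      then show "matpow A (j - 1) *v \<phi> (ext_branch l c (take j a) y) = matpow A (j - 1) *v \<phi> (branch l (take j a) y)"
        by (simp only: ext_branch_eq[OF l c])
    qed
    also have "\<dots> = S a y"
      unfolding S_def by (rule sum.reindex_bij_witness[of _ Suc "\<lambda>j. j - 1"]) auto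
    finally show ?thesis .
  qed
  then have "S_ext l A \<phi> c a = S a" by (rule ext)
  then show ?thesis unfolding S_ext_deriv_def by (simp only: vector_derivative_at[OF S_deriv])
qed

text \<open>The infimum over \<open>p\<close> is attained, and for that \<open>p\<close> every \<open>x\<close> lies in the cylinder of a word of length \<open>p\<close>.\<close>

lemma card_near_le_conc_mult:
  assumes x: "x \<in> circle"
  shows "card {w \<in> words l q. \<bar>real_of_int \<xi> + inner \<eta> (S1 w x)\<bar> < 2 * (\<alpha> A \<kappa> / real l ^ q * norm (freq A q \<eta>))}
    \<le> conc_mult l A \<phi> \<kappa> q"
proof -
  have "conc_mult l A \<phi> \<kappa> q \<in> (\<lambda>p. mult_pq l A \<phi> \<kappa> p q) ` {1..}"
    unfolding conc_mult_def by (rule Inf_nat_def1) simp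
  then obtain p where p: "conc_mult l A \<phi> \<kappa> q = mult_pq l A \<phi> \<kappa> p q" by blast
  obtain c where c: "c \<in> words l p" "x \<in> cyl l c" using circle_cyl[OF l1 x] by blast
  let ?N = "\<lambda>c \<xi> \<eta>. card (conc l A \<phi> \<kappa> q c \<xi> \<eta>)"
  have fin: "finite (conc l A \<phi> \<kappa> q c \<xi> \<eta>)" for \<xi> \<eta>
    by (rule finite_subset[OF _ finite_words[of l q]]) (auto simp: conc_def)
  have star: "x \<in> cyl_star l c" unfolding cyl_star_def using c(2) by (intro UN_I[of 0]) auto
  have "{w \<in> words l q. \<bar>real_of_int \<xi> + inner \<eta> (S1 w x)\<bar> < 2 * (\<alpha> A \<kappa> / real l ^ q * norm (freq A q \<eta>))}
      \<subseteq> conc l A \<phi> \<kappa> q c \<xi> \<eta>"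
  proof
    fix w assume "w \<in> {w \<in> words l q. \<bar>real_of_int \<xi> + inner \<eta> (S1 w x)\<bar> < 2 * (\<alpha> A \<kappa> / real l ^ q * norm (freq A q \<eta>))}"
    then have w: "w \<in> words l q" and lt: "\<bar>real_of_int \<xi> + inner \<eta> (S1 w x)\<bar> < 2 * (\<alpha> A \<kappa> / real l ^ q * norm (freq A q \<eta>))" by auto
    have "\<bar>real_of_int \<xi> + inner \<eta> (S_ext_deriv l A \<phi> c w x)\<bar> < 2 * \<alpha> A \<kappa> / real l ^ q * norm (freq A q \<eta>)"
      unfolding S_ext_deriv_eq[OF c(1) w] using lt by (simp only: mult.assoc times_divide_eq_right times_divide_eq_left)
    then show "w \<in> conc l A \<phi> \<kappa> q c \<xi> \<eta>" unfolding conc_def using w star by blast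
  qed
  from card_mono[OF fin this] have "card {w \<in> words l q. \<bar>real_of_int \<xi> + inner \<eta> (S1 w x)\<bar> < 2 * (\<alpha> A \<kappa> / real l ^ q * norm (freq A q \<eta>))}
      \<le> ?N c \<xi> \<eta>" .
  also have "\<dots> \<le> (SUP (\<xi>, \<eta>)\<in>UNIV. ?N c \<xi> \<eta>)"
  proof -
    have "bdd_above (range (\<lambda>(\<xi>, \<eta>). ?N c \<xi> \<eta>))"
    proof (rule bdd_aboveI2)
      fix z :: "int \<times> (real^'n)"
      show "(case z of (\<xi>, \<eta>) \<Rightarrow> ?N c \<xi> \<eta>) \<le> card (words l q)"
        by (cases z) (auto intro!: card_mono simp: conc_def)
    qed
    from cSUP_upper[OF UNIV_I this, of "(\<xi>, \<eta>)"] show ?thesis by simp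
  qed
  also have "\<dots> \<le> mult_pq l A \<phi> \<kappa> p q"
    unfolding mult_pq_def by (rule Max_ge) (use c(1) in auto)
  finally show ?thesis unfolding p .
qed

end

context attractor
begin

text \<open>
  For a large frequency \<open>\<eta>\<close> the threshold in \<open>conc\<close> exceeds \<open>1/2\<close>, and some integer \<open>\<xi>\<close> lets the word
  \<open>1 \<dots> 1\<close> qualify.
\<close>

lemma conc_mult_pos: "conc_mult l A \<phi> \<kappa> q \<ge> 1"
proof -
  obtain c where c: "c > 0" "\<And>\<eta>. c * norm \<eta> \<le> norm (freq A q \<eta>)" using freq_lower by blast
  \<comment> \<open>The direction of \<open>\<eta>\<close> is arbitrary.\<close>
  define \<eta> :: "real^'n" where "\<eta> = (real l ^ q / (\<alpha> A \<kappa> * c)) *\<^sub>R axis undefined 1"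
  define w where "w = replicate q (1::nat)"
  define \<xi> where "\<xi> = round (- inner \<eta> (S1 w 0))"
  have lq: "real l ^ q > 0" using l0 by simp
  have "1 = \<alpha> A \<kappa> / real l ^ q * (c * norm \<eta>)" unfolding \<eta>_def using \<alpha>_pos c(1) lq by (simp add: norm_axis_1)
  also have "\<dots> \<le> \<alpha> A \<kappa> / real l ^ q * norm (freq A q \<eta>)" using \<alpha>_pos c lq by (intro mult_left_mono) auto
  finally have big: "1 \<le> \<alpha> A \<kappa> / real l ^ q * norm (freq A q \<eta>)" .
  have "\<bar>real_of_int \<xi> - (- inner \<eta> (S1 w 0))\<bar> \<le> 1 / 2" unfolding \<xi>_def by (rule of_int_round_abs_le)
  then have "\<bar>real_of_int \<xi> + inner \<eta> (S1 w 0)\<bar> < 2 * (\<alpha> A \<kappa> / real l ^ q * norm (freq A q \<eta>))" using big by simp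
  moreover have "w \<in> words l q" using l by (auto simp: w_def words_def)
  ultimately have "{w} \<subseteq> {w \<in> words l q. \<bar>real_of_int \<xi> + inner \<eta> (S1 w 0)\<bar> < 2 * (\<alpha> A \<kappa> / real l ^ q * norm (freq A q \<eta>))}" by blast
  from card_mono[OF _ this]
  have "1 \<le> card {w \<in> words l q. \<bar>real_of_int \<xi> + inner \<eta> (S1 w 0)\<bar> < 2 * (\<alpha> A \<kappa> / real l ^ q * norm (freq A q \<eta>))}" by simp
  also have "\<dots> \<le> conc_mult l A \<phi> \<kappa> q" by (rule card_near_le_conc_mult) (simp add: circle_def)
  finally show ?thesis .
qed

abbreviation loss_exponent :: real where
  "loss_exponent \<equiv> 2 * (real CARD('n) - 1) * (\<Sum>i=1..num_moduli A. \<bar>s i\<bar>)"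

abbreviation growth_rate :: real where
  "growth_rate \<equiv> real l * \<bar>det A\<bar> * (\<Prod>i=1..num_moduli A. modulus A i powr (2 * s i))"

lemma growth_rate_pos: "growth_rate > 0"
proof -
  have "modulus A i powr (2 * s i) > 0" if "i \<in> {1..num_moduli A}" for i
    using modulus_pos[OF invertible that] by simp
  then show ?thesis using l0 det_nz by (intro mult_pos_pos prod_pos) auto
qed

lemma loss_le_growth:
  assumes "q \<ge> 1"
  shows "loss q / real l ^ q \<le> (\<Prod>i=1..num_moduli A. C i powr (2 * \<bar>s i\<bar>)) * real q powr loss_exponent / growth_rate ^ q"
proof -
  have pos: "\<bar>det A\<bar> ^ q > 0" "real l ^ q > 0" using det_nz l0 by simp_all
  have "weight_loss A C s q / \<bar>det A\<bar> ^ q / real l ^ q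
      \<le> (\<Prod>i=1..num_moduli A. C i powr (2 * \<bar>s i\<bar>)) * real q powr loss_exponent
        / (\<Prod>i=1..num_moduli A. modulus A i powr (2 * s i)) ^ q / \<bar>det A\<bar> ^ q / real l ^ q"
    by (intro divide_right_mono weight_loss_le assms) (use pos in auto)
  also have "\<dots> = (\<Prod>i=1..num_moduli A. C i powr (2 * \<bar>s i\<bar>)) * real q powr loss_exponent / growth_rate ^ q"
    by (simp only: power_mult_distrib divide_divide_eq_left mult_ac)
  finally show ?thesis unfolding loss_def .
qed

lemma loss_exponent_nonneg: "loss_exponent \<ge> 0"
proof -
  have "1 \<le> CARD('n)" by (simp add: Suc_leI)
  then have "real CARD('n) - 1 \<ge> 0" by linarith
  then show ?thesis by (intro mult_nonneg_nonneg sum_nonneg) auto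
qed

text \<open>Exponential decay wins over the polynomial factor.\<close>

lemma loss_decay:
  assumes "growth_rate > 1"
  shows "(\<lambda>j. loss j / real l ^ j) \<longlonglongrightarrow> 0"
proof -
  let ?P = "\<Prod>i=1..num_moduli A. C i powr (2 * \<bar>s i\<bar>)"
  define k where "k = nat \<lceil>loss_exponent\<rceil>"
  have k: "loss_exponent \<le> real k" unfolding k_def by linarith
  have P: "?P \<ge> 0" by (intro prod_nonneg) auto
  have "summable (\<lambda>j. real j ^ k * (1 / growth_rate) ^ j)"
    using assms growth_rate_pos by (intro summable_poly_power) (simp_all add: divide_less_eq)
  from tendsto_mult_left[OF summable_LIMSEQ_zero[OF this], of ?P]
  have lim: "(\<lambda>j. ?P * (real j ^ k * (1 / growth_rate) ^ j)) \<longlonglongrightarrow> 0" by simp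
  show ?thesis
  proof (rule Lim_null_comparison[OF _ lim], rule eventually_sequentiallyI[of 1])
    fix j :: nat assume j: "1 \<le> j"
    have "norm (loss j / real l ^ j) = loss j / real l ^ j" using loss_nonneg l0 by simp
    also have "\<dots> \<le> ?P * real j powr loss_exponent / growth_rate ^ j" by (rule loss_le_growth[OF j])
    also have "\<dots> \<le> ?P * real j ^ k / growth_rate ^ j"
    proof (intro divide_right_mono mult_left_mono P)
      have "real j powr loss_exponent \<le> real j powr real k" using j k by (intro powr_mono) auto
      also have "\<dots> = real j ^ k" using j by (intro powr_realpow) simp
      finally show "real j powr loss_exponent \<le> real j ^ k" .
    qed (use growth_rate_pos in \<open>simp add: less_imp_le\<close>)
    also have "\<dots> = ?P * (real j ^ k * (1 / growth_rate) ^ j)" by (simp only: power_divide power_one times_divide_eq_right mult_1_right mult.assoc)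
    finally show "norm (loss j / real l ^ j) \<le> ?P * (real j ^ k * (1 / growth_rate) ^ j)" .
  qed
qed

text \<open>
  The hypothesis bounds \<open>growth_rate ^ q\<close> below by a product of numbers at least 1, so
  \<open>growth_rate\<close> exceeds 1; that is what makes the losses decay for all exponents and not only for \<open>q\<close>.
\<close>

theorem energy_bounded_of_conc_mult:
  assumes q: "q \<ge> 1"
    and hyp: "B_const A C s * real q powr loss_exponent * real (conc_mult l A \<phi> \<kappa> q) < growth_rate ^ q"
  obtains X where "\<And>n. energy (G n) n \<le> ennreal X"
proof -
  let ?P = "\<Prod>i=1..num_moduli A. C i powr (2 * \<bar>s i\<bar>)"
  let ?M = "conc_mult l A \<phi> \<kappa> q"
  have P1: "?P \<ge> 1"
    using C_ge_1 by (intro prod_ge_1 ge_one_powr_ge_zero) auto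
  have k1: "real q powr loss_exponent \<ge> 1"
    using q loss_exponent_nonneg by (intro ge_one_powr_ge_zero) auto
  have M1: "real ?M \<ge> 1" using conc_mult_pos[of q] by simp
  have "1 * 1 * 1 \<le> B_const A C s * real q powr loss_exponent * real ?M"
    unfolding B_const_def using P1 k1 M1 by (intro mult_mono) auto
  then have "1 < growth_rate ^ q" using hyp by linarith
  have growth: "growth_rate > 1"
  proof (rule ccontr)
    assume "\<not> growth_rate > 1"
    then have "growth_rate ^ q \<le> 1" using growth_rate_pos by (intro power_le_one) auto
    then show False using \<open>1 < growth_rate ^ q\<close> by linarith
  qed
  have g: "growth_rate ^ q > 0" using growth_rate_pos by simp
  have "36 * (real ?M / real l ^ q * loss q) = 36 * real ?M * (loss q / real l ^ q)" by simp
  also have "\<dots> \<le> 36 * real ?M * (?P * real q powr loss_exponent / growth_rate ^ q)"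
    by (intro mult_left_mono loss_le_growth q) simp
  also have "\<dots> = B_const A C s * real q powr loss_exponent * real ?M / growth_rate ^ q"
    unfolding B_const_def by (simp only: times_divide_eq_right mult_ac)
  also have "\<dots> < 1" using hyp g by (simp only: divide_less_eq_1_pos)
  finally have small: "36 * (real ?M / real l ^ q * loss q) < 1" .
  show thesis
    by (rule energy_bounded[OF q _ small loss_decay[OF growth]], erule card_near_le_conc_mult, rule that)
qed

end

theorem theorem1:
  fixes l r N :: nat
    and A :: "real^'n^'n"
    and \<phi> :: "real \<Rightarrow> real^'n"
    and \<kappa> :: real
    and C s :: "nat \<Rightarrow> real"
  assumes "l \<ge> 2" and "r \<ge> 2"
    and "invertible A" and "spec_radius A < 1"
    and "\<phi> \<in> Cr_circle r"
    and "\<kappa> > 0" and "\<phi> \<in> U_ball r \<kappa>"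
    and "admissible_N l A \<phi> \<kappa> N"
    and "block_bounds A C"
    and "\<forall>i\<in>{1..num_moduli A}. s i > - real (dim (spec_space A i)) / 2"
    and "\<exists>q\<ge>N. B_const A C s
             * real q powr (2 * (real CARD('n) - 1) * (\<Sum>i=1..num_moduli A. \<bar>s i\<bar>))
             * real (conc_mult l A \<phi> \<kappa> q)
           < (real l * \<bar>det A\<bar> * (\<Prod>i=1..num_moduli A. modulus A i powr (2 * s i))) ^ q"
  shows "in_L2_Hdot A s (srb l A \<phi>)"
proof -
  obtain q where q: "q \<ge> N" and hyp: "B_const A C s
             * real q powr (2 * (real CARD('n) - 1) * (\<Sum>i=1..num_moduli A. \<bar>s i\<bar>))
             * real (conc_mult l A \<phi> \<kappa> q)
           < (real l * \<bar>det A\<bar> * (\<Prod>i=1..num_moduli A. modulus A i powr (2 * s i))) ^ q"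
    using assms(11) by blast
  have q1: "q \<ge> 1" using q assms(8) by (simp add: admissible_N_def)
  have b: "norm (iter_deriv k \<phi> x) \<le> \<kappa>" if "k \<le> 2" for k x
    using assms(7) assms(2) that by (simp add: U_ball_def)
  have b0: "norm (\<phi> x) \<le> \<kappa>" for x using b[of 0 x] by (simp add: iter_deriv_def)
  have bounds: "spectral_bounds A C" by (rule spectral_bounds.intro[OF assms(3,4,9)])
  interpret attractor A C l \<phi> "iter_deriv 1 \<phi>" "iter_deriv 2 \<phi>" \<kappa> s
    by (intro attractor.intro solenoid.intro attractor_axioms.intro bounds assms
        Cr_circle_derivs[OF assms(5,2)] b spectral_bounds.summable_onorm_matpow[OF bounds]
        assms(10)[rule_format]) simp_all
  obtain X where X: "\<And>n. energy (G n) n \<le> ennreal X"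
    using energy_bounded_of_conc_mult[OF q1 hyp] by blast
  show ?thesis by (rule in_L2_Hdot_of_energy_bounded[OF b0 X])
qed

end
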